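(* Let $X$ be an abelian surface with Picard number $2$. Then $X$ is self-mirror if and only if the discriminant form $(A,q)$ of $\mathrm{NS}(X)$ satisfies both of the following conditions: (a) For any prime $p\equiv3\pmod 4$, the $p$-Sylow subgroup $A_p\subseteq A$ has the form $A_p\cong(\mathbb{Z}/p^k\mathbb{Z})\oplus(\mathbb{Z}/p^k\mathbb{Z})$ for some integer $k\ge 0$. (b) The $2$-Sylow subgroup $A_2\subseteq A$ equipped with the restricted form $q_2:=q|_{A_2}$ is isomorphic to one of the following (where $a_1,a_2$ are integers representing $\overline{a}_1,\overline{a}_2$): (i) $A_2\cong(\mathbb{Z}/2^k\mathbb{Z})\oplus(\mathbb{Z}/2^k\mathbb{Z})$ for some integer $k\geq 1$, and there exist odd integers $\theta_1,\theta_2$ with $\theta_1+\theta_2\equiv0\pmod 4$ such that $q_2(\overline{a}_1,\overline{a}_2)=\dfrac{\theta_1a_1^2}{2^k}+\dfrac{\theta_2a_2^2}{2^k}$ for each $(\overline{a}_1,\overline{a}_2)\in A_2$. (ii) $A_2\cong(\mathbb{Z}/2^k\mathbb{Z})\oplus(\mathbb{Z}/2^{k+1}\mathbb{Z})$ for some integer $k\geq 1$, and there exist odd integers $\theta_1,\theta_2$ with $\theta_1+\theta_2\equiv0\pmod 4$ such that $q_2(\overline{a}_1,\overline{a}_2)=\dfrac{\theta_1a_1^2}{2^k}+\dfrac{\theta_2a_2^2}{2^{k+1}}$ for each $(\overline{a}_1,\overline{a}_2)\in A_2$. (iii) $A_2\cong(\mathbb{Z}/2^k\mathbb{Z})\oplus(\mathbb{Z}/2^k\mathbb{Z})$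 for some integer $k\geq 0$, and there exists an odd integer $\theta$ such that $q_2(\overline{a}_1,\overline{a}_2)=\dfrac{\theta a_1a_2}{2^{k-1}}$ for each $(\overline{a}_1,\overline{a}_2)\in A_2$. (iv) $A_2\cong(\mathbb{Z}/2^k\mathbb{Z})\oplus(\mathbb{Z}/2^k\mathbb{Z})$ for some integer $k\geq 0$, and there exists an odd integer $\theta$ such that $q_2(\overline{a}_1,\overline{a}_2)=\dfrac{\theta(a_1^2+a_1a_2+a_2^2)}{2^{k-1}}$ for each $(\overline{a}_1,\overline{a}_2)\in A_2$.
   Context: Abelian surfaces are over $\mathbb{C}$. For an abelian surface $X$, $\mathrm{NS}(X)\subseteq H^2(X,\mathbb{Z})$ is the N\'eron--Severi lattice and $T(X)=\mathrm{NS}(X)^\perp\subseteq H^2(X,\mathbb{Z})$. $N(X)=H^0(X,\mathbb{Z})\oplus\mathrm{NS}(X)\oplus H^4(X,\mathbb{Z})$ carries the Mukai pairing $(r,D,s)\cdot(r',D',s')=DD'-rs'-sr'$. $X$ is self-mirror if there is a lattice isometry $T(X)\cong N(X)$. The discriminant form of an even lattice $M$ is the finite group $A=M^*/M$ with the quadratic form $q\colon A\to\mathbb{Q}/2\mathbb{Z}$ induced by the $\mathbb{Q}$-valued form on $M^*$. The equalities for $q_2$ are in $\mathbb{Q}/2\mathbb{Z}$. Sylow subgroups may be trivial. *)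

theory Defs
  imports
    "HOL-Analysis.Analysis"
    "HOL-Algebra.Elementary_Groups"
begin

section \<open>Lattices with a bilinear form\<close>

text \<open>A lattice is a pair of a form \<open>b\<close> on an ambient abelian group and a subgroup \<open>M\<close> of it.\<close>

definition lattice_isometric ::
    "('a::ab_group_add \<Rightarrow> 'a \<Rightarrow> real) \<Rightarrow> 'a set \<Rightarrow>
     ('b::ab_group_add \<Rightarrow> 'b \<Rightarrow> real) \<Rightarrow> 'b set \<Rightarrow> bool" where
  "lattice_isometric b M b' M' \<longleftrightarrow>
    (\<exists>\<phi>. bij_betw \<phi> M M' \<and>
         (\<forall>x\<in>M. \<forall>y\<in>M. \<phi> (x + y) = \<phi> x + \<phi> y) \<and>
         (\<forall>x\<in>M. \<forall>y\<in>M. b' (\<phi> x) (\<phi> y) = b x y))"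

definition int_independent :: "'a::real_vector set \<Rightarrow> bool" where
  "int_independent B \<longleftrightarrow>
    (\<forall>c::'a \<Rightarrow> int. (\<Sum>x\<in>B. of_int (c x) *\<^sub>R x) = 0 \<longrightarrow> (\<forall>x\<in>B. c x = 0))"

definition group_rank :: "'a::real_vector set \<Rightarrow> nat" where
  "group_rank M = Max {card B | B. B \<subseteq> M \<and> finite B \<and> int_independent B}"

text \<open>The first condition says that \<open>x\<close> lies in \<open>M \<otimes> \<rat>\<close>, realised inside the ambient vector space.\<close>

definition dual_lattice :: "('a::real_vector \<Rightarrow> 'a \<Rightarrow> real) \<Rightarrow> 'a set \<Rightarrow> 'a set" where
  "dual_lattice b M =
    {x. (\<exists>n::nat. n > 0 \<and> real n *\<^sub>R x \<in> M) \<and> (\<forall>y\<in>M. b x y \<in> \<int>)}"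

definition disc_group :: "('a::real_vector \<Rightarrow> 'a \<Rightarrow> real) \<Rightarrow> 'a set \<Rightarrow> 'a set monoid" where
  "disc_group b M = \<lparr>carrier = dual_lattice b M, monoid.mult = (+), one = 0\<rparr> Mod M"

text \<open>An element of \<open>\<rat>/2\<int>\<close> is represented by the corresponding coset of \<open>2\<int>\<close> in the reals.\<close>

definition mod_2Z :: "real \<Rightarrow> real set" where
  "mod_2Z r = {r + 2 * of_int m | m::int. True}"

definition disc_form :: "('a::real_vector \<Rightarrow> 'a \<Rightarrow> real) \<Rightarrow> 'a set \<Rightarrow> real set" where
  "disc_form b a = (\<Union>x\<in>a. mod_2Z (b x x))"

text \<open>The \<open>p\<close>-Sylow subgroup, for groups (such as finite abelian ones) in which it is unique.\<close>

definition sylow_subgroup :: "nat \<Rightarrow> 'a monoid \<Rightarrow> 'a monoid" where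
  "sylow_subgroup p G =
    G\<lparr>carrier := (THE H. subgroup H G \<and> card H = p ^ multiplicity p (order G))\<rparr>"


section \<open>Two-dimensional complex tori\<close>

text \<open>\<open>b\<close> is a \<open>\<int>\<close>-basis of the lattice \<open>\<Lambda>\<close>; it is oriented if it is positive for the
  orientation of \<open>\<complex>\<^sup>2\<close> given by its complex structure.\<close>

definition period_det :: "(complex^2)^4 \<Rightarrow> real" where
  "period_det b = det ((\<chi> i. vector [Re (b$i$1), Im (b$i$1), Re (b$i$2), Im (b$i$2)]) :: real^4^4)"

definition period_basis :: "(complex^2) set \<Rightarrow> (complex^2)^4 \<Rightarrow> bool" where
  "period_basis \<Lambda> b \<longleftrightarrow>
    period_det b \<noteq> 0 \<and> \<Lambda> = range (\<lambda>n::int^4. \<Sum>i\<in>UNIV. of_int (n$i) *\<^sub>R b$i)"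

definition oriented_basis :: "(complex^2) set \<Rightarrow> (complex^2)^4 \<Rightarrow> bool" where
  "oriented_basis \<Lambda> b \<longleftrightarrow> period_basis \<Lambda> b \<and> period_det b > 0"

definition complex_lattice :: "(complex^2) set \<Rightarrow> bool" where
  "complex_lattice \<Lambda> \<longleftrightarrow> (\<exists>b. period_basis \<Lambda> b)"

text \<open>For the torus \<open>X = \<complex>\<^sup>2/\<Lambda>\<close> one has \<open>H\<^sub>1(X,\<int>) = \<Lambda>\<close> and \<open>H\<^sup>k(X,\<int>) = Alt\<^sup>k(\<Lambda>,\<int>)\<close>, the cup
  product being the exterior product. An alternating form on \<open>\<Lambda>\<close> is given by its unique
  \<open>\<real>\<close>-bilinear extension to \<open>\<complex>\<^sup>2\<close>.\<close>

type_synonym form2 = "(complex^2) \<Rightarrow>\<^sub>L (complex^2) \<Rightarrow>\<^sub>L real"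

abbreviation val :: "form2 \<Rightarrow> complex^2 \<Rightarrow> complex^2 \<Rightarrow> real" where
  "val E x y \<equiv> blinfun_apply (blinfun_apply E x) y"

definition H2 :: "(complex^2) set \<Rightarrow> form2 set" where
  "H2 \<Lambda> = {E. (\<forall>x. val E x x = 0) \<and> (\<forall>x\<in>\<Lambda>. \<forall>y\<in>\<Lambda>. val E x y \<in> \<int>)}"

text \<open>The value of \<open>E \<and> F\<close> on four vectors.\<close>

definition wedge :: "form2 \<Rightarrow> form2 \<Rightarrow> (complex^2)^4 \<Rightarrow> real" where
  "wedge E F b =
     val E (b$1) (b$2) * val F (b$3) (b$4) - val E (b$1) (b$3) * val F (b$2) (b$4)
   + val E (b$1) (b$4) * val F (b$2) (b$3) + val E (b$2) (b$3) * val F (b$1) (b$4)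
   - val E (b$2) (b$4) * val F (b$1) (b$3) + val E (b$3) (b$4) * val F (b$1) (b$2)"

text \<open>The fundamental class of \<open>X\<close> is \<open>b\<^sub>1 \<and> b\<^sub>2 \<and> b\<^sub>3 \<and> b\<^sub>4\<close> for any oriented basis \<open>b\<close> of \<open>\<Lambda>\<close>;
  two such bases differ by a matrix of determinant 1, so the choice does not matter.\<close>

definition cup :: "(complex^2) set \<Rightarrow> form2 \<Rightarrow> form2 \<Rightarrow> real" where
  "cup \<Lambda> E F = wedge E F (SOME b. oriented_basis \<Lambda> b)"


section \<open>Line bundles and the Neron--Severi lattice\<close>

definition holomorphic_C2 :: "(complex^2 \<Rightarrow> complex) \<Rightarrow> bool" where
  "holomorphic_C2 f \<longleftrightarrow>
    (\<forall>v. \<exists>D. (f has_derivative D) (at v) \<and> (\<forall>c w. D (c *s w) = c * D w))"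

text \<open>Every holomorphic line bundle on \<open>X\<close> is the quotient of \<open>\<complex>\<^sup>2 \<times> \<complex>\<close> by the action
  \<open>\<lambda> \<cdot> (v, t) = (v + \<lambda>, f \<lambda> v * t)\<close> of \<open>\<Lambda>\<close> for a factor of automorphy \<open>f\<close>.\<close>

definition factor_of_automorphy ::
    "(complex^2) set \<Rightarrow> (complex^2 \<Rightarrow> complex^2 \<Rightarrow> complex) \<Rightarrow> bool" where
  "factor_of_automorphy \<Lambda> f \<longleftrightarrow>
    (\<forall>l\<in>\<Lambda>. holomorphic_C2 (f l) \<and> (\<forall>v. f l v \<noteq> 0)) \<and>
    (\<forall>l\<in>\<Lambda>. \<forall>m\<in>\<Lambda>. \<forall>v. f (l + m) v = f l (v + m) * f m v)"

text \<open>\<open>E\<close> is the first Chern class of the line bundle given by \<open>f\<close>: the image of the class of \<open>f\<close>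
  under the connecting map \<open>H\<^sup>1(\<Lambda>, O\<^sup>*(\<complex>\<^sup>2)) \<rightarrow> H\<^sup>2(\<Lambda>, \<int>)\<close> of the exponential sequence, where a
  2-cocycle \<open>F\<close> corresponds to the alternating form \<open>(l, m) \<mapsto> F(l, m) - F(m, l)\<close> (conventions of
  Birkenhake and Lange, Complex Abelian Varieties, Theorem 2.1.2).\<close>

definition first_chern ::
    "(complex^2) set \<Rightarrow> (complex^2 \<Rightarrow> complex^2 \<Rightarrow> complex) \<Rightarrow> form2 \<Rightarrow> bool" where
  "first_chern \<Lambda> f E \<longleftrightarrow> E \<in> H2 \<Lambda> \<and>
    (\<exists>g. (\<forall>l\<in>\<Lambda>. holomorphic_C2 (g l) \<and> (\<forall>v. f l v = exp (2 * complex_of_real pi * \<i> * g l v))) \<and>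
         (\<forall>l\<in>\<Lambda>. \<forall>m\<in>\<Lambda>. \<forall>v.
            complex_of_real (val E l m) = g m (v + l) + g l v - g l (v + m) - g m v))"

definition NS :: "(complex^2) set \<Rightarrow> form2 set" where
  "NS \<Lambda> = {E. \<exists>f. factor_of_automorphy \<Lambda> f \<and> first_chern \<Lambda> f E}"

text \<open>An abelian surface is a complex torus that carries a positive definite line bundle. The
  Hermitian form attached to \<open>E\<close> is \<open>H(u,v) = E(\<i>u,v) + \<i>E(u,v)\<close>, so \<open>H(v,v) = E(\<i>v,v)\<close>.\<close>

definition abelian_surface :: "(complex^2) set \<Rightarrow> bool" where
  "abelian_surface \<Lambda> \<longleftrightarrow>
    complex_lattice \<Lambda> \<and> (\<exists>E\<in>NS \<Lambda>. \<forall>v. v \<noteq> 0 \<longrightarrow> val E (\<i> *s v) v > 0)"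

definition picard_number :: "(complex^2) set \<Rightarrow> nat" where
  "picard_number \<Lambda> = group_rank (NS \<Lambda>)"

definition transcendental_lattice :: "(complex^2) set \<Rightarrow> form2 set" where
  "transcendental_lattice \<Lambda> = {E \<in> H2 \<Lambda>. \<forall>D\<in>NS \<Lambda>. cup \<Lambda> E D = 0}"

definition mukai_lattice :: "(complex^2) set \<Rightarrow> (int \<times> form2 \<times> int) set" where
  "mukai_lattice \<Lambda> = UNIV \<times> NS \<Lambda> \<times> UNIV"

definition mukai_pairing ::
    "(complex^2) set \<Rightarrow> int \<times> form2 \<times> int \<Rightarrow> int \<times> form2 \<times> int \<Rightarrow> real" where
  "mukai_pairing \<Lambda> = (\<lambda>(r, D, s) (r', D', s'). cup \<Lambda> D D' - of_int (r * s') - of_int (s * r'))"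

definition self_mirror :: "(complex^2) set \<Rightarrow> bool" where
  "self_mirror \<Lambda> \<longleftrightarrow>
    lattice_isometric (cup \<Lambda>) (transcendental_lattice \<Lambda>) (mukai_pairing \<Lambda>) (mukai_lattice \<Lambda>)"

end

theory Submission
  imports Defs "HOL-Complex_Analysis.Cauchy_Integral_Formula" "HOL-Number_Theory.Euler_Criterion"
    "HOL-Algebra.Sylow"
begin

text \<open>Write the form on \<open>NS(X)\<close> as \<open>2m(ax\<^sup>2 + bxy + cy\<^sup>2)\<close> with \<open>a, b, c\<close> coprime and put \<open>D = b\<^sup>2 - 4ac\<close>,
  which is positive by the Hodge index theorem. Being self-mirror and having a discriminant form as in (a)
  and (b) are both equivalent to the condition that \<open>16\<close> and the primes \<open>p \<equiv> 3 (mod 4)\<close> do not divide \<open>D\<close>.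

  By the Lefschetz theorem on (1,1)-classes, here obtained by averaging the cocycle condition over a
  fundamental parallelepiped, \<open>NS(X)\<close> is saturated of rank 2 in \<open>H\<^sup>2(X,\<int>) = U\<^sup>3\<close>. The automorphisms of \<open>U\<^sup>3\<close>
  bring such a sublattice \<open>N\<close> into a normal position, in which one reads off that \<open>T(X) = U \<oplus> N(-1)\<close>; so \<open>X\<close> is
  self-mirror iff \<open>U \<oplus> N\<close> and \<open>U \<oplus> N(-1)\<close> are isometric. If the condition on \<open>D\<close> holds, then
  \<open>t\<^sup>2 + 4s\<^sup>2 = k\<^sup>2D\<close> has a solution with \<open>s\<close> coprime to \<open>m, t, k\<close>; then \<open>(t + k\<surd>D)/2\<close> has norm \<open>- s\<^sup>2\<close>, and
  multiplication by it yields an isotropic vector \<open>e\<close> of \<open>U \<oplus> N\<close> with \<open>e\<^sup>\<bottom>/e\<close> isometric to \<open>N(-1)\<close>. Conversely,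
  comparing the values of the two forms on the vectors divisible by \<open>p\<close>-powers in the dual lattice gives a
  square root of \<open>-1\<close> modulo \<open>p\<close> or \<open>4\<close>.

  The Sylow subgroups of the discriminant group are computed by diagonalizing the form over \<open>\<int>\<^sub>p\<close>: if \<open>p\<close> is
  odd they have type \<open>(p\<^sup>j, p\<^sup>j\<^sup>+\<^sup>v)\<close>, where \<open>v\<close> is the exponent of \<open>p\<close> in \<open>D\<close>.\<close>

section \<open>Holomorphic functions on \<open>\<complex>\<^sup>2\<close> averaged over periods\<close>

text \<open>The hard direction is the existence of an isometry. Multiplication by
  \<open>(t + k sqrt D)/2\<close> multiplies the form by the norm
  \<open>(t^2 - k^2 D)/4 = - s^2\<close>, so after division by \<open>s\<close> it is an
  anti-isometry, but only of \<open>N\<close> tensored with the rationals; \<open>N\<close> and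
  \<open>N(-1)\<close> themselves need not be isometric. The hyperbolic plane absorbs the
  denominator: the isotropic vector \<open>e\<close> has \<open>s\<close> as its first coordinate,
  and coprimality of \<open>s\<close> with \<open>m\<close>, \<open>t\<close>, \<open>k\<close> and
  the leading coefficient \<open>a\<close> lets \<open>e\<close> pair to 1 with some vector, so that
  a plane \<open>U\<close> splits off with complement \<open>N(-1)\<close>. The condition on
  \<open>a\<close> is met by a change of basis, because a primitive form represents numbers prime to
  any given one. The number 16 arises as \<open>4 * 4\<close>: \<open>D\<close> is odd or
  \<open>D = 4 \<Delta>\<close>, and a sum of two coprime squares is never divisible by 4. In the
  discriminant group the same number is seen, for even \<open>b\<close>, in the exponents of the two
  cyclic factors of the 2-part: their difference is the exponent of 2 in
  \<open>\<Delta>\<close>.\<close>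

definition seg_avg :: "'a::euclidean_space \<Rightarrow> ('a \<Rightarrow> complex) \<Rightarrow> 'a \<Rightarrow> complex" where
  "seg_avg w h v = integral {0..1} (\<lambda>t. h (v + t *\<^sub>R w))"

lemma seg_avg_continuous:
  assumes "continuous_on UNIV h"
  shows "continuous_on UNIV (seg_avg w h)"
proof -
  have "continuous_on (UNIV \<times> cbox 0 1) (\<lambda>(v, t). h (v + t *\<^sub>R w))"
    unfolding case_prod_beta
    by (rule continuous_on_compose2[OF assms]) (auto intro!: continuous_intros)
  from integral_continuous_on_param[OF this] show ?thesis
    by (simp add: seg_avg_def[abs_def])
qed

lemma seg_integrable:
  fixes h :: "'a::euclidean_space \<Rightarrow> complex"
  assumes "continuous_on UNIV h"
  shows "(\<lambda>t. h (v + t *\<^sub>R w)) integrable_on {0..1::real}"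
proof (rule integrable_continuous_real)
  show "continuous_on {0..1} (\<lambda>t. h (v + t *\<^sub>R w))"
    by (rule continuous_on_compose2[OF assms]) (auto intro!: continuous_intros)
qed

lemma seg_avg_commute:
  assumes "continuous_on UNIV h"
  shows "seg_avg u (seg_avg w h) = seg_avg w (seg_avg u h)"
proof
  fix v
  have "continuous_on (cbox (0,0) (1,1)) (\<lambda>(t, s). h (v + t *\<^sub>R u + s *\<^sub>R w))"
    unfolding case_prod_beta
    by (rule continuous_on_compose2[OF assms]) (auto intro!: continuous_intros)
  from integral_swap_continuous[OF this]
  show "seg_avg u (seg_avg w h) v = seg_avg w (seg_avg u h) v"
    by (simp add: seg_avg_def algebra_simps)
qed

lemma seg_avg_diff:
  assumes "continuous_on UNIV f" "continuous_on UNIV h"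
  shows "seg_avg w (\<lambda>v. f v - h v) = (\<lambda>v. seg_avg w f v - seg_avg w h v)"
  by (rule ext) (simp add: seg_avg_def Henstock_Kurzweil_Integration.integral_diff seg_integrable assms)

lemma seg_avg_add:
  assumes "continuous_on UNIV f" "continuous_on UNIV h"
  shows "seg_avg w (\<lambda>v. f v + h v) = (\<lambda>v. seg_avg w f v + seg_avg w h v)"
  by (rule ext) (simp add: seg_avg_def Henstock_Kurzweil_Integration.integral_add seg_integrable assms)

lemma seg_avg_cmult: "seg_avg w (\<lambda>v. c * h v) = (\<lambda>v. c * seg_avg w h v)"
  by (rule ext) (simp add: seg_avg_def)

lemma seg_avg_const: "seg_avg w (\<lambda>v. c) = (\<lambda>v. c)"
  by (rule ext) (simp add: seg_avg_def)

definition dirderiv :: "(complex^2 \<Rightarrow> complex) \<Rightarrow> complex^2 \<Rightarrow> complex^2 \<Rightarrow> complex" where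
  "dirderiv h w v = deriv (\<lambda>\<zeta>. h (v + \<zeta> *s w)) 0"

lemma scaleC_bounded_linear: "bounded_linear (\<lambda>\<zeta>::complex. \<zeta> *s (w::complex^2))"
proof -
  have "linear (\<lambda>\<zeta>::complex. \<zeta> *s w)"
    by (rule linearI) (auto simp: vec_eq_iff algebra_simps)
  then show ?thesis by (simp add: linear_conv_bounded_linear)
qed

lemma scaleR_eq_scaleC: "t *\<^sub>R (w::complex^2) = complex_of_real t *s w"
  unfolding vec_eq_iff vector_scaleR_component vector_smult_component by (simp add: scaleR_conv_of_real)

lemma holomorphic_C2_slice:
  fixes v w :: "complex^2"
  assumes "(h has_derivative D) (at (v + z *s w))" "\<forall>c w. D (c *s w) = c * D w"
  shows "((\<lambda>\<zeta>. h (v + \<zeta> *s w)) has_field_derivative D w) (at z)"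
proof -
  have "((\<lambda>\<zeta>. v + \<zeta> *s w) has_derivative (\<lambda>\<zeta>. \<zeta> *s w)) (at z)"
    using bounded_linear.has_derivative[OF scaleC_bounded_linear has_derivative_ident]
    by (auto intro!: derivative_eq_intros)
  from has_derivative_compose[OF this assms(1)]
  show ?thesis
    using assms(2) by (simp add: has_field_derivative_def mult.commute[of _ "D w"])
qed

lemma dirderiv_eq:
  assumes "(h has_derivative D) (at v)" "\<forall>c w. D (c *s w) = c * D w"
  shows "dirderiv h w v = D w"
  unfolding dirderiv_def
  by (rule DERIV_imp_deriv) (rule holomorphic_C2_slice, use assms in auto)

lemma holomorphic_C2_continuous: "holomorphic_C2 h \<Longrightarrow> continuous_on UNIV h"
  unfolding holomorphic_C2_def
  by (metis continuous_at_imp_continuous_on has_derivative_continuous)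

lemma holomorphic_C2_slice_holomorphic:
  "holomorphic_C2 h \<Longrightarrow> (\<lambda>\<zeta>. h (v + \<zeta> *s w)) holomorphic_on UNIV"
  unfolding holomorphic_on_def holomorphic_C2_def
  by (metis field_differentiable_def field_differentiable_at_within holomorphic_C2_slice)

text \<open>\<open>holomorphic_C2\<close> provides a derivative at every point but no continuity of
  it. Cauchy's formula on the unit circle of the slice through \<open>v\<close> in direction
  \<open>w\<close> writes the derivative as an integral whose integrand is jointly continuous in
  \<open>v\<close> and the angle.\<close>

lemma dirderiv_continuous:
  assumes "holomorphic_C2 h"
  shows "continuous_on UNIV (dirderiv h w)"
proof -
  have cont: "continuous_on UNIV h"
    by (rule holomorphic_C2_continuous[OF assms])
  let ?c = "circlepath 0 1"
  have eq: "dirderiv h w v = 1 / (2 * of_real pi * \<i>) *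
      integral (cbox 0 1) (\<lambda>t. h (v + ?c t *s w) / (?c t)^2 * (2 * of_real pi * \<i> * exp (2 * of_real pi * \<i> * of_real t)))" for v
  proof -
    have hol: "(\<lambda>\<zeta>. h (v + \<zeta> *s w)) holomorphic_on UNIV"
      by (rule holomorphic_C2_slice_holomorphic[OF assms])
    have "((\<lambda>u. (\<lambda>\<zeta>. h (v + \<zeta> *s w)) u / (u - 0) ^ Suc 1) has_contour_integral
        complex_of_real (2 * pi) * \<i> / fact 1 * (deriv ^^ 1) (\<lambda>\<zeta>. h (v + \<zeta> *s w)) 0) ?c"
      by (rule Cauchy_has_contour_integral_higher_derivative_circlepath[where f="\<lambda>\<zeta>. h (v + \<zeta> *s w)" and z=0 and r=1 and w=0 and k=1])
         (use hol in \<open>auto intro: holomorphic_on_imp_continuous_on holomorphic_on_subset\<close>)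
    then have "contour_integral ?c (\<lambda>u. h (v + u *s w) / u^2) = 2 * of_real pi * \<i> * dirderiv h w v"
      by (simp add: contour_integral_unique dirderiv_def power2_eq_square)
    moreover have "contour_integral ?c (\<lambda>u. h (v + u *s w) / u^2) =
       integral (cbox 0 1) (\<lambda>t. h (v + ?c t *s w) / (?c t)^2 * (2 * of_real pi * \<i> * exp (2 * of_real pi * \<i> * of_real t)))"
      unfolding contour_integral_integral
      by (simp add: vector_derivative_circlepath)
    ultimately show ?thesis by (simp add: field_simps)
  qed
  have "continuous_on (UNIV \<times> cbox 0 1) (\<lambda>(v, t). h (v + ?c t *s w) / (?c t)^2 *
      (2 * of_real pi * \<i> * exp (2 * of_real pi * \<i> * of_real t)))"
  proof -
    have c: "continuous_on (UNIV \<times> cbox 0 1) (\<lambda>p::(complex^2)\<times>real. ?c (snd p))"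
      unfolding circlepath by (auto intro!: continuous_intros)
    have c2: "continuous_on (UNIV \<times> cbox 0 1) (\<lambda>p::(complex^2)\<times>real. ?c (snd p) *s w)"
      by (rule continuous_on_compose2[OF linear_continuous_on[OF scaleC_bounded_linear] c, of UNIV]) auto
    have "continuous_on (UNIV \<times> cbox 0 1) (\<lambda>p::(complex^2)\<times>real. h (fst p + ?c (snd p) *s w))"
      by (rule continuous_on_compose2[OF cont continuous_on_add[OF continuous_on_fst[OF continuous_on_id] c2]]) auto
    moreover have "?c t \<noteq> 0" for t by (simp add: circlepath)
    ultimately show ?thesis unfolding case_prod_beta using c
      by (auto intro!: continuous_intros)
  qed
  from integral_continuous_on_param[OF this]
  show ?thesis unfolding eq[abs_def] by (intro continuous_intros) auto
qed

lemma segment_difference: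
  assumes "holomorphic_C2 h"
  shows "h (v + w) - h v = seg_avg w (dirderiv h w) v"
proof -
  have "((\<lambda>t. dirderiv h w (v + t *\<^sub>R w)) has_integral h (v + 1 *\<^sub>R w) - h (v + 0 *\<^sub>R w)) {0..1}"
  proof (rule fundamental_theorem_of_calculus)
    fix x :: real
    obtain D where D: "(h has_derivative D) (at (v + x *\<^sub>R w))" "\<forall>c w. D (c *s w) = c * D w"
      using assms unfolding holomorphic_C2_def by blast
    have "((\<lambda>t. v + t *\<^sub>R w) has_derivative (\<lambda>t. t *\<^sub>R w)) (at x within {0..1})"
      by (auto intro!: derivative_eq_intros)
    from has_derivative_compose[where g=h, OF this, of D] D(1)
    have "((\<lambda>t. h (v + t *\<^sub>R w)) has_derivative (\<lambda>t. D (t *\<^sub>R w))) (at x within {0..1})"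
      by simp
    then show "((\<lambda>t. h (v + t *\<^sub>R w)) has_vector_derivative dirderiv h w (v + x *\<^sub>R w)) (at x within {0..1})"
      using linear_scale[OF has_derivative_linear[OF D(1)]]
      by (simp add: has_vector_derivative_def dirderiv_eq[OF D])
  qed auto
  then show ?thesis by (simp add: seg_avg_def integral_unique)
qed

lemma dirderiv_linear:
  assumes "holomorphic_C2 h"
  shows "dirderiv h (u + w) v = dirderiv h u v + dirderiv h w v"
    and "dirderiv h (c *s w) v = c * dirderiv h w v"
proof -
  obtain D where D: "(h has_derivative D) (at v)" "\<forall>c w. D (c *s w) = c * D w"
    using assms unfolding holomorphic_C2_def by blast
  show "dirderiv h (u + w) v = dirderiv h u v + dirderiv h w v"
    using linear_add[OF has_derivative_linear[OF D(1)]] by (simp add: dirderiv_eq[OF D])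
  show "dirderiv h (c *s w) v = c * dirderiv h w v"
    using D(2) by (simp add: dirderiv_eq[OF D])
qed

text \<open>The average of \<open>df\<close> over a fundamental parallelepiped, with one factor of the average evaluated
  by the fundamental theorem of calculus.\<close>

lemma averaged_Cauchy_Riemann:
  fixes b1 b2 b3 b4 :: "complex^2"
  assumes h: "holomorphic_C2 h"
    and rel: "c1 *s b1 + c2 *s b2 + c3 *s b3 + c4 *s b4 = 0"
  shows "c1 * seg_avg b2 (seg_avg b3 (seg_avg b4 (\<lambda>v. h (v + b1) - h v))) v
       + c2 * seg_avg b1 (seg_avg b3 (seg_avg b4 (\<lambda>v. h (v + b2) - h v))) v
       + c3 * seg_avg b1 (seg_avg b2 (seg_avg b4 (\<lambda>v. h (v + b3) - h v))) v
       + c4 * seg_avg b1 (seg_avg b2 (seg_avg b3 (\<lambda>v. h (v + b4) - h v))) v = 0"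
proof -
  let ?I = "\<lambda>f. seg_avg b1 (seg_avg b2 (seg_avg b3 (seg_avg b4 f)))"
  have d: "(\<lambda>v. h (v + w) - h v) = seg_avg w (dirderiv h w)" for w
    using segment_difference[OF h] by blast
  note c = seg_avg_continuous dirderiv_continuous[OF h]
  note sw = seg_avg_commute
  have 1: "seg_avg b2 (seg_avg b3 (seg_avg b4 (seg_avg b1 f))) = ?I f" if "continuous_on UNIV f" for f
    by (simp add: sw[of _ b4 b1] sw[of _ b3 b1] sw[of _ b2 b1] c that)
  have 2: "seg_avg b1 (seg_avg b3 (seg_avg b4 (seg_avg b2 f))) = ?I f" if "continuous_on UNIV f" for f
    by (simp add: sw[of _ b4 b2] sw[of _ b3 b2] c that)
  have 3: "seg_avg b1 (seg_avg b2 (seg_avg b4 (seg_avg b3 f))) = ?I f" if "continuous_on UNIV f" for f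
    by (simp add: sw[of _ b4 b3] c that)
  let ?d = "\<lambda>w. dirderiv h w"
  have cc: "continuous_on UNIV (\<lambda>v. c1 * ?d b1 v)" "continuous_on UNIV (\<lambda>v. c2 * ?d b2 v)"
     "continuous_on UNIV (\<lambda>v. c3 * ?d b3 v)" "continuous_on UNIV (\<lambda>v. c4 * ?d b4 v)"
     "continuous_on UNIV (\<lambda>v. c1 * ?d b1 v + c2 * ?d b2 v)"
     "continuous_on UNIV (\<lambda>v. c1 * ?d b1 v + c2 * ?d b2 v + c3 * ?d b3 v)"
    by (intro continuous_intros c)+
  have Iadd: "?I (\<lambda>v. f v + g v) = (\<lambda>v. ?I f v + ?I g v)"
    if "continuous_on UNIV f" "continuous_on UNIV g" for f g
    using that by (simp add: seg_avg_add c)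
  have Imul: "?I (\<lambda>v. a * f v) = (\<lambda>v. a * ?I f v)" for a f
    by (simp add: seg_avg_cmult)
  have "c1 * ?I (?d b1) v + c2 * ?I (?d b2) v + c3 * ?I (?d b3) v + c4 * ?I (?d b4) v
     = ?I (\<lambda>v. c1 * ?d b1 v + c2 * ?d b2 v + c3 * ?d b3 v + c4 * ?d b4 v) v"
    by (simp only: Iadd cc Imul)
  \<comment> \<open>All four averages now run over the same parallelepiped, so the complex linearity
    of the derivative in its direction lets the relation among the periods act under the
    integral.\<close>
  also have "(\<lambda>v. c1 * ?d b1 v + c2 * ?d b2 v + c3 * ?d b3 v + c4 * ?d b4 v) =
      (\<lambda>v. dirderiv h (c1 *s b1 + c2 *s b2 + c3 *s b3 + c4 *s b4) v)"
    by (simp add: dirderiv_linear[OF h])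
  also have "\<dots> = (\<lambda>v. 0)"
    unfolding rel using dirderiv_linear(2)[OF h, of 0 0] by simp
  finally show ?thesis
    by (simp add: d 1 2 3 c seg_avg_const)
qed

text \<open>A constant equals its own averages, so each \<open>e_ij\<close> may be averaged over two
  faces of the parallelepiped, one for each of its indices. Collecting the terms that contain the
  same \<open>g_j\<close> leaves sums to which \<open>averaged_Cauchy_Riemann\<close> applies, with
  the relation \<open>c\<close> or with the relation \<open>d\<close>.\<close>

lemma averaged_cocycle_vanishes:
  fixes b1 b2 b3 b4 :: "complex^2"
  assumes hol: "holomorphic_C2 g1" "holomorphic_C2 g2" "holomorphic_C2 g3" "holomorphic_C2 g4"
    and c: "c1 *s b1 + c2 *s b2 + c3 *s b3 + c4 *s b4 = 0"
    and d: "d1 *s b1 + d2 *s b2 + d3 *s b3 + d4 *s b4 = 0"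
    and e: "\<And>v. (g2 (v + b1) - g2 v) - (g1 (v + b2) - g1 v) = e12"
       "\<And>v. (g3 (v + b1) - g3 v) - (g1 (v + b3) - g1 v) = e13"
       "\<And>v. (g4 (v + b1) - g4 v) - (g1 (v + b4) - g1 v) = e14"
       "\<And>v. (g3 (v + b2) - g3 v) - (g2 (v + b3) - g2 v) = e23"
       "\<And>v. (g4 (v + b2) - g4 v) - (g2 (v + b4) - g2 v) = e24"
       "\<And>v. (g4 (v + b3) - g4 v) - (g3 (v + b4) - g3 v) = e34"
  shows "(c1*d2 - c2*d1)*e12 + (c1*d3 - c3*d1)*e13 + (c1*d4 - c4*d1)*e14
       + (c2*d3 - c3*d2)*e23 + (c2*d4 - c4*d2)*e24 + (c3*d4 - c4*d3)*e34 = 0"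
proof -
  let ?A = "seg_avg"
  let ?J1 = "\<lambda>f. ?A b2 (?A b3 (?A b4 f))" and ?J2 = "\<lambda>f. ?A b1 (?A b3 (?A b4 f))"
  let ?J3 = "\<lambda>f. ?A b1 (?A b2 (?A b4 f))" and ?J4 = "\<lambda>f. ?A b1 (?A b2 (?A b3 f))"
  let ?D = "\<lambda>(w::complex^2) f v. f (v + w) - f v :: complex"
  have cD: "continuous_on UNIV (?D w f)" if "holomorphic_C2 f" for w f
    using holomorphic_C2_continuous[OF that]
    by (auto intro!: continuous_intros continuous_on_compose2[of UNIV f])
  note C = seg_avg_continuous cD hol
  note sw = seg_avg_commute
  have diff: "?A u (\<lambda>v. f v - h v) = (\<lambda>v. ?A u f v - ?A u h v)"
    if "continuous_on UNIV f" "continuous_on UNIV h" for u f h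
    using that by (rule seg_avg_diff)
  have comm: "?J1 (?J2 f) = ?J2 (?J1 f)" "?J1 (?J3 f) = ?J3 (?J1 f)" "?J1 (?J4 f) = ?J4 (?J1 f)"
     "?J2 (?J3 f) = ?J3 (?J2 f)" "?J2 (?J4 f) = ?J4 (?J2 f)" "?J3 (?J4 f) = ?J4 (?J3 f)"
    if "continuous_on UNIV f" for f
    by (simp_all add: sw[of _ b4 b1] sw[of _ b3 b1] sw[of _ b2 b1] sw[of _ b4 b2] sw[of _ b3 b2] sw[of _ b4 b3] C that)
  \<comment> \<open>The inner face \<open>K\<close> goes with the period \<open>w\<close>, as
    \<open>averaged_Cauchy_Riemann\<close> demands; the outer face \<open>J\<close> goes with the
    index of \<open>g\<close>, so that all terms with the same \<open>g\<close> carry the same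
    \<open>J\<close>.\<close>
  define T where "T = (\<lambda>J K g w. (J::(complex^2 \<Rightarrow> complex) \<Rightarrow> complex^2 \<Rightarrow> complex) (K (?D w g)) 0)"
  have split: "e = T J K g w - T J K g' w'"
    if "\<And>v. ?D w g v - ?D w' g' v = e" "holomorphic_C2 g" "holomorphic_C2 g'"
      "J \<in> {?J1,?J2,?J3,?J4}" "K \<in> {?J1,?J2,?J3,?J4}" for J K g w g' w' e
  proof -
    have "e = J (K (\<lambda>v. ?D w g v - ?D w' g' v)) 0"
      unfolding that(1) using that(4,5) by (auto simp: seg_avg_const)
    also have "\<dots> = T J K g w - T J K g' w'"
      unfolding T_def using that(4,5) by (auto simp: diff C that(2,3))
    finally show ?thesis .
  qed
  have Jlin: "J (\<lambda>v. x1 * f1 v + x2 * f2 v + x3 * f3 v + x4 * f4 v) 0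
      = x1 * J f1 0 + x2 * J f2 0 + x3 * J f3 0 + x4 * J f4 0"
    if "J \<in> {?J1,?J2,?J3,?J4}" "continuous_on UNIV f1" "continuous_on UNIV f2"
       "continuous_on UNIV f3" "continuous_on UNIV f4" for J x1 x2 x3 x4 f1 f2 f3 f4
  proof -
    have "continuous_on UNIV (\<lambda>v. x * f v)" if "continuous_on UNIV f" for x and f :: "complex^2 \<Rightarrow> complex"
      using that by (intro continuous_intros)
    moreover have "continuous_on UNIV (\<lambda>v. f v + f' v)"
       if "continuous_on UNIV f" "continuous_on UNIV f'" for f f' :: "complex^2 \<Rightarrow> complex"
      using that by (intro continuous_intros)
    ultimately show ?thesis
      using that by (auto simp: seg_avg_add seg_avg_cmult C)
  qed
  have Z: "x1 * T J ?J1 g b1 + x2 * T J ?J2 g b2 + x3 * T J ?J3 g b3 + x4 * T J ?J4 g b4 = 0"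
    if "J \<in> {?J1,?J2,?J3,?J4}" "holomorphic_C2 g" "x1 *s b1 + x2 *s b2 + x3 *s b3 + x4 *s b4 = 0"
    for J g x1 x2 x3 x4
  proof -
    have "x1 * T J ?J1 g b1 + x2 * T J ?J2 g b2 + x3 * T J ?J3 g b3 + x4 * T J ?J4 g b4
      = J (\<lambda>v. x1 * ?J1 (?D b1 g) v + x2 * ?J2 (?D b2 g) v + x3 * ?J3 (?D b3 g) v + x4 * ?J4 (?D b4 g) v) 0"
      unfolding T_def by (rule Jlin[symmetric]) (use that(1,2) in \<open>auto intro!: C\<close>)
    also have "\<dots> = 0"
      unfolding averaged_Cauchy_Riemann[OF that(2,3)] using that(1) by (auto simp: seg_avg_const)
    finally show ?thesis .
  qed
  have T21: "T ?J1 ?J2 g w = T ?J2 ?J1 g w" "T ?J1 ?J3 g w = T ?J3 ?J1 g w" "T ?J1 ?J4 g w = T ?J4 ?J1 g w"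
     "T ?J2 ?J3 g w = T ?J3 ?J2 g w" "T ?J2 ?J4 g w = T ?J4 ?J2 g w" "T ?J3 ?J4 g w = T ?J4 ?J3 g w"
    if "holomorphic_C2 g" for g w
    unfolding T_def by (simp_all only: comm cD[OF that])
  have E: "e12 = T ?J2 ?J1 g2 b1 - T ?J1 ?J2 g1 b2" "e13 = T ?J3 ?J1 g3 b1 - T ?J1 ?J3 g1 b3"
     "e14 = T ?J4 ?J1 g4 b1 - T ?J1 ?J4 g1 b4" "e23 = T ?J3 ?J2 g3 b2 - T ?J2 ?J3 g2 b3"
     "e24 = T ?J4 ?J2 g4 b2 - T ?J2 ?J4 g2 b4" "e34 = T ?J4 ?J3 g4 b3 - T ?J3 ?J4 g3 b4"
    using split[OF e(1) hol(2,1), of ?J2 ?J1] split[OF e(2) hol(3,1), of ?J3 ?J1] split[OF e(3) hol(4,1), of ?J4 ?J1]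
       split[OF e(4) hol(3,2), of ?J3 ?J2] split[OF e(5) hol(4,2), of ?J4 ?J2] split[OF e(6) hol(4,3), of ?J4 ?J3]
    by (simp_all add: T21 hol)
  have zc: "c1 * T J ?J1 g b1 + c2 * T J ?J2 g b2 + c3 * T J ?J3 g b3 + c4 * T J ?J4 g b4 = 0"
     and zd: "d1 * T J ?J1 g b1 + d2 * T J ?J2 g b2 + d3 * T J ?J3 g b3 + d4 * T J ?J4 g b4 = 0"
    if "J \<in> {?J1,?J2,?J3,?J4}" "holomorphic_C2 g" for J g
    using Z[OF that c] Z[OF that d] by auto
  \<comment> \<open>The diagonal terms, with \<open>g_i\<close> and \<open>b_i\<close>, come with
    the factor \<open>d_i c_i - c_i d_i\<close> and cancel; they are inserted to complete the
    sums.\<close>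
  have "(c1*d2 - c2*d1)*e12 + (c1*d3 - c3*d1)*e13 + (c1*d4 - c4*d1)*e14
       + (c2*d3 - c3*d2)*e23 + (c2*d4 - c4*d2)*e24 + (c3*d4 - c4*d3)*e34
     = d1 * (c1 * T ?J1 ?J1 g1 b1 + c2 * T ?J1 ?J2 g1 b2 + c3 * T ?J1 ?J3 g1 b3 + c4 * T ?J1 ?J4 g1 b4)
     + d2 * (c1 * T ?J2 ?J1 g2 b1 + c2 * T ?J2 ?J2 g2 b2 + c3 * T ?J2 ?J3 g2 b3 + c4 * T ?J2 ?J4 g2 b4)
     + d3 * (c1 * T ?J3 ?J1 g3 b1 + c2 * T ?J3 ?J2 g3 b2 + c3 * T ?J3 ?J3 g3 b3 + c4 * T ?J3 ?J4 g3 b4)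
     + d4 * (c1 * T ?J4 ?J1 g4 b1 + c2 * T ?J4 ?J2 g4 b2 + c3 * T ?J4 ?J3 g4 b3 + c4 * T ?J4 ?J4 g4 b4)
     - c1 * (d1 * T ?J1 ?J1 g1 b1 + d2 * T ?J1 ?J2 g1 b2 + d3 * T ?J1 ?J3 g1 b3 + d4 * T ?J1 ?J4 g1 b4)
     - c2 * (d1 * T ?J2 ?J1 g2 b1 + d2 * T ?J2 ?J2 g2 b2 + d3 * T ?J2 ?J3 g2 b3 + d4 * T ?J2 ?J4 g2 b4)
     - c3 * (d1 * T ?J3 ?J1 g3 b1 + d2 * T ?J3 ?J2 g3 b2 + d3 * T ?J3 ?J3 g3 b3 + d4 * T ?J3 ?J4 g3 b4)
     - c4 * (d1 * T ?J4 ?J1 g4 b1 + d2 * T ?J4 ?J2 g4 b2 + d3 * T ?J4 ?J3 g4 b3 + d4 * T ?J4 ?J4 g4 b4)"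
    unfolding E by (simp only: ring_distribs right_diff_distrib left_diff_distrib) (simp only: ac_simps, simp)
  also have "\<dots> = 0"
    using zc[of ?J1 g1] zc[of ?J2 g2] zc[of ?J3 g3] zc[of ?J4 g4]
      zd[of ?J1 g1] zd[of ?J2 g2] zd[of ?J3 g3] zd[of ?J4 g4] hol by simp
  finally show ?thesis .
qed

section \<open>The Neron--Severi group\<close>

lemma val_simps [simp]:
  "val E (x + y) z = val E x z + val E y z" "val E x (y + z) = val E x y + val E x z"
  "val E (x - y) z = val E x z - val E y z" "val E x (y - z) = val E x y - val E x z"
  "val E (- x) z = - val E x z" "val E x (- z) = - val E x z"
  "val E (c *\<^sub>R x) z = c * val E x z" "val E x (c *\<^sub>R z) = c * val E x z"
  "val E 0 z = 0" "val E x 0 = 0"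
  "val (E + F) x z = val E x z + val F x z" "val (E - F) x z = val E x z - val F x z"
  "val (c *\<^sub>R E) x z = c * val E x z" "val (- E) x z = - val E x z" "val 0 x z = 0"
  by (simp_all add: blinfun.bilinear_simps)

lemma alternating_swap:
  assumes "\<And>x. val E x x = 0"
  shows "val E x y = - val E y x"
proof -
  have "val E (x + y) (x + y) = 0" by (rule assms)
  then show ?thesis using assms[of x] assms[of y] by simp
qed

lemma alternating_combination:
  assumes "\<And>x. val E x x = 0"
  shows "val E (u1 *\<^sub>R c1 + u2 *\<^sub>R c2 + u3 *\<^sub>R c3 + u4 *\<^sub>R c4)
      (v1 *\<^sub>R c1 + v2 *\<^sub>R c2 + v3 *\<^sub>R c3 + v4 *\<^sub>R c4) =
     val E c1 c2 * (u1 * v2 - u2 * v1) + val E c1 c3 * (u1 * v3 - u3 * v1)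
   + val E c1 c4 * (u1 * v4 - u4 * v1) + val E c2 c3 * (u2 * v3 - u3 * v2)
   + val E c2 c4 * (u2 * v4 - u4 * v2) + val E c3 c4 * (u3 * v4 - u4 * v3)"
  by (simp only: val_simps assms alternating_swap[OF assms, of c2 c1] alternating_swap[OF assms, of c3 c1]
      alternating_swap[OF assms, of c4 c1] alternating_swap[OF assms, of c3 c2]
      alternating_swap[OF assms, of c4 c2] alternating_swap[OF assms, of c4 c3])
    (simp add: algebra_simps)

definition real_coords :: "complex^2 \<Rightarrow> real^4" where
  "real_coords v = vector [Re (v$1), Im (v$1), Re (v$2), Im (v$2)]"

lemma real_coords_nth:
  "real_coords v $ 1 = Re (v$1)" "real_coords v $ 2 = Im (v$1)"
  "real_coords v $ 3 = Re (v$2)" "real_coords v $ 4 = Im (v$2)"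
  unfolding real_coords_def vector_def by simp_all

lemma real_coords_linear:
  "real_coords (u + v) = real_coords u + real_coords v"
  "real_coords (c *\<^sub>R v) = c *\<^sub>R real_coords v"
  by (simp_all add: vec_eq_iff forall_4 real_coords_nth)

lemma real_coords_inject: "real_coords u = real_coords v \<longleftrightarrow> u = v"
  by (auto simp: vec_eq_iff forall_4 forall_2 real_coords_nth complex_eq_iff)

locale period_lattice =
  fixes \<Lambda> :: "(complex^2) set" and b :: "(complex^2)^4"
  assumes period_basis: "period_basis \<Lambda> b"
begin

definition period_matrix :: "real^4^4" where
  "period_matrix = (\<chi> i. real_coords (b$i))"

definition coord :: "4 \<Rightarrow> complex^2 \<Rightarrow> real" where
  "coord k v = (real_coords v v* matrix_inv period_matrix) $ k"

lemma invertible_period_matrix: "invertible period_matrix"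
  using period_basis
  unfolding invertible_det_nz period_basis_def period_det_def period_matrix_def real_coords_def
  by simp

lemma matrix_inv_period_matrix:
  "period_matrix ** matrix_inv period_matrix = mat 1"
  "matrix_inv period_matrix ** period_matrix = mat 1"
  using someI_ex[OF invertible_period_matrix[unfolded invertible_def]]
  unfolding matrix_inv_def by blast+

lemma real_coords_comb:
  "real_coords (\<Sum>k\<in>UNIV. (x$k) *\<^sub>R b$k) = x v* period_matrix"
  unfolding sum_4 real_coords_linear
  by (simp add: vec_eq_iff forall_4 vector_matrix_mult_def sum_4 period_matrix_def mult.commute)

lemma coord_expand: "(\<Sum>k\<in>UNIV. coord k v *\<^sub>R b$k) = v"
proof -
  let ?x = "real_coords v v* matrix_inv period_matrix"
  have "real_coords (\<Sum>k\<in>UNIV. (?x$k) *\<^sub>R b$k) = real_coords v v* (matrix_inv period_matrix ** period_matrix)"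
    unfolding real_coords_comb by (simp add: vector_matrix_mul_assoc)
  also have "\<dots> = real_coords v"
    by (simp add: matrix_inv_period_matrix)
  finally show ?thesis by (simp add: real_coords_inject coord_def)
qed

lemma coord_comb: "coord k (\<Sum>i\<in>UNIV. (x$i) *\<^sub>R b$i) = x $ k"
  unfolding coord_def real_coords_comb
  by (simp add: vector_matrix_mul_assoc matrix_inv_period_matrix)

lemma coord_add: "coord k (u + v) = coord k u + coord k v"
  by (simp add: coord_def real_coords_linear vector_matrix_left_distrib)

lemma coord_scale: "coord k (c *\<^sub>R v) = c * coord k v"
  by (simp add: coord_def real_coords_linear vector_matrix_mult_def sum_distrib_left algebra_simps)

lemma coord_bounded_linear: "bounded_linear (coord k)"
  using coord_add coord_scale
  by (auto simp: linear_conv_bounded_linear[symmetric] intro: linearI)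

lemma coord_basis: "coord k (b$j) = (if k = j then 1 else 0)"
proof -
  have "(\<Sum>i\<in>UNIV. (axis j (1::real) $ i) *\<^sub>R b$i) = (\<Sum>i\<in>UNIV. if i = j then b$i else 0)"
    by (rule sum.cong) (auto simp: axis_def)
  then have "b$j = (\<Sum>i\<in>UNIV. (axis j 1 $ i) *\<^sub>R b$i)" by simp
  then show ?thesis using coord_comb[of k "axis j 1"] by (simp add: axis_def)
qed

lemma lattice_iff: "v \<in> \<Lambda> \<longleftrightarrow> (\<forall>k. coord k v \<in> \<int>)"
proof
  assume "v \<in> \<Lambda>"
  then obtain n :: "int^4" where "v = (\<Sum>i\<in>UNIV. of_int (n$i) *\<^sub>R b$i)"
    using period_basis by (auto simp: period_basis_def)
  then have "coord k v = of_int (n$k)" for k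
    using coord_comb[of k "\<chi> i. of_int (n$i)"] by simp
  then show "\<forall>k. coord k v \<in> \<int>" by simp
next
  assume "\<forall>k. coord k v \<in> \<int>"
  then have "of_int \<lfloor>coord k v\<rfloor> = coord k v" for k
    using \<open>\<forall>k. coord k v \<in> \<int>\<close> by (auto elim!: allE[of _ k] Ints_cases)
  then have "(\<Sum>i\<in>UNIV. of_int ((\<chi> i. \<lfloor>coord i v\<rfloor>)$i) *\<^sub>R b$i) = (\<Sum>i\<in>UNIV. coord i v *\<^sub>R b$i)"
    by (simp only: vec_lambda_beta)
  then have "(\<Sum>i\<in>UNIV. of_int ((\<chi> i. \<lfloor>coord i v\<rfloor>)$i) *\<^sub>R b$i) = v"
    unfolding coord_expand .
  then have "v \<in> range (\<lambda>n::int^4. \<Sum>i\<in>UNIV. of_int (n$i) *\<^sub>R b$i)"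
    by (rule range_eqI[OF sym])
  then show "v \<in> \<Lambda>"
    using period_basis by (simp add: period_basis_def)
qed

lemma basis_in_lattice: "b$i \<in> \<Lambda>"
  by (simp add: lattice_iff coord_basis)

lemma alternating_expand:
  assumes "\<And>x. val E x x = 0"
  shows "val E u v =
     val E (b$1) (b$2) * (coord 1 u * coord 2 v - coord 2 u * coord 1 v)
   + val E (b$1) (b$3) * (coord 1 u * coord 3 v - coord 3 u * coord 1 v)
   + val E (b$1) (b$4) * (coord 1 u * coord 4 v - coord 4 u * coord 1 v)
   + val E (b$2) (b$3) * (coord 2 u * coord 3 v - coord 3 u * coord 2 v)
   + val E (b$2) (b$4) * (coord 2 u * coord 4 v - coord 4 u * coord 2 v)
   + val E (b$3) (b$4) * (coord 3 u * coord 4 v - coord 4 u * coord 3 v)"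
proof -
  have u: "coord 1 u *\<^sub>R b$1 + coord 2 u *\<^sub>R b$2 + coord 3 u *\<^sub>R b$3 + coord 4 u *\<^sub>R b$4 = u"
    and v: "coord 1 v *\<^sub>R b$1 + coord 2 v *\<^sub>R b$2 + coord 3 v *\<^sub>R b$3 + coord 4 v *\<^sub>R b$4 = v"
    using coord_expand[unfolded sum_4] by blast+
  show ?thesis
    using alternating_combination[OF assms, where ?c1.0="b$1" and ?c2.0="b$2" and ?c3.0="b$3" and ?c4.0="b$4"
       and ?u1.0="coord 1 u" and ?u2.0="coord 2 u" and ?u3.0="coord 3 u" and ?u4.0="coord 4 u"
       and ?v1.0="coord 1 v" and ?v2.0="coord 2 v" and ?v3.0="coord 3 v" and ?v4.0="coord 4 v"]
    unfolding u v .
qed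

lemma NS_imp_type_11:
  assumes "E \<in> NS \<Lambda>"
  shows "val E (\<i> *s u) (\<i> *s w) = val E u w"
proof -
  obtain g where E: "E \<in> H2 \<Lambda>" and hol: "\<And>l. l \<in> \<Lambda> \<Longrightarrow> holomorphic_C2 (g l)"
    and g: "\<And>l m v. l \<in> \<Lambda> \<Longrightarrow> m \<in> \<Lambda> \<Longrightarrow> complex_of_real (val E l m) = g m (v + l) + g l v - g l (v + m) - g m v"
    using assms unfolding NS_def first_chern_def by blast
  have alt: "\<And>x. val E x x = 0" using E by (simp add: H2_def)
  \<comment> \<open>Every \<open>u\<close> yields a relation among the periods: the coordinates of
    \<open>u\<close> plus \<open>\<i>\<close> times those of \<open>\<i> *s u\<close> combine to
    \<open>u + \<i> *s (\<i> *s u) = 0\<close>.\<close>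
  define c where "c = (\<lambda>u k. complex_of_real (coord k u) + \<i> * complex_of_real (coord k (\<i> *s u)))"
  have rel: "c u 1 *s b$1 + c u 2 *s b$2 + c u 3 *s b$3 + c u 4 *s b$4 = 0" for u
  proof -
    have "c u 1 *s b$1 + c u 2 *s b$2 + c u 3 *s b$3 + c u 4 *s b$4
      = (\<Sum>k\<in>UNIV. coord k u *\<^sub>R b$k) + \<i> *s (\<Sum>k\<in>UNIV. coord k (\<i> *s u) *\<^sub>R b$k)"
      by (simp add: sum_4 c_def scaleR_eq_scaleC vector_add_ldistrib vector_sadd_rdistrib vector_smult_assoc)
    also have "\<dots> = 0"
      unfolding coord_expand by (simp add: vec_eq_iff)
    finally show ?thesis .
  qed
  have e: "(g (b$j) (v + b$i) - g (b$j) v) - (g (b$i) (v + b$j) - g (b$i) v) = complex_of_real (val E (b$i) (b$j))" for i j v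
    using g[OF basis_in_lattice basis_in_lattice, of i j v] by simp
  have "(c u 1 * c w 2 - c u 2 * c w 1) * complex_of_real (val E (b$1) (b$2))
      + (c u 1 * c w 3 - c u 3 * c w 1) * complex_of_real (val E (b$1) (b$3))
      + (c u 1 * c w 4 - c u 4 * c w 1) * complex_of_real (val E (b$1) (b$4))
      + (c u 2 * c w 3 - c u 3 * c w 2) * complex_of_real (val E (b$2) (b$3))
      + (c u 2 * c w 4 - c u 4 * c w 2) * complex_of_real (val E (b$2) (b$4))
      + (c u 3 * c w 4 - c u 4 * c w 3) * complex_of_real (val E (b$3) (b$4)) = 0"
    by (rule averaged_cocycle_vanishes[of "g (b$1)" "g (b$2)" "g (b$3)" "g (b$4)", OF _ _ _ _ rel rel])
       (auto simp only: e intro!: hol basis_in_lattice)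
  \<comment> \<open>The real part of this relation is \<open>E(u,w) - E(\<i>u,\<i>w)\<close>,
    expanded in the basis.\<close>
  from arg_cong[OF this, of Re]
  show ?thesis
    unfolding alternating_expand[OF alt, of u w] alternating_expand[OF alt, of "\<i> *s u" "\<i> *s w"]
    by (simp add: c_def algebra_simps)
qed

text \<open>Appell--Humbert: the factor of automorphy attached to the Hermitian form
  \<open>H(u,v) = E(\<i>u,v) + \<i>E(u,v)\<close> and to the semicharacter
  \<open>exp (\<pi>\<i> (\<Sum>i<j. n\<^sub>i n\<^sub>j E(b\<^sub>i,b\<^sub>j)))\<close>.\<close>

lemma type_11_imp_NS:
  assumes E: "E \<in> H2 \<Lambda>" and inv: "\<And>u w. val E (\<i> *s u) (\<i> *s w) = val E u w"
  shows "E \<in> NS \<Lambda>"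
proof -
  have alt: "\<And>x. val E x x = 0" and int: "\<And>x y. x \<in> \<Lambda> \<Longrightarrow> y \<in> \<Lambda> \<Longrightarrow> val E x y \<in> \<int>"
    using E by (simp_all add: H2_def)
  define H where "H = (\<lambda>u v. complex_of_real (val E (\<i> *s u) v) + \<i> * complex_of_real (val E u v))"
  define e where "e = (\<lambda>i j. val E (b$i) (b$j))"
  \<comment> \<open>\<open>s\<close> is the strictly upper triangular half of \<open>E\<close> and
    is integral on \<open>\<Lambda>\<close>. The Hermitian part of \<open>g\<close> has the cocycle
    defect \<open>E(l,m)/2\<close>; the term \<open>s l l / 2\<close> adds the symmetrized
    \<open>s\<close>, and the total defect becomes the integer \<open>s l m\<close>.\<close>
  define s where "s = (\<lambda>u v. coord 1 u * coord 2 v * e 1 2 + coord 1 u * coord 3 v * e 1 3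
     + coord 1 u * coord 4 v * e 1 4 + coord 2 u * coord 3 v * e 2 3 + coord 2 u * coord 4 v * e 2 4
     + coord 3 u * coord 4 v * e 3 4)"
  define g where "g = (\<lambda>l v. (H v l + H l l / 2) / (2 * \<i>) + complex_of_real (s l l) / 2)"
  have ii: "\<i> *s (\<i> *s u) = - u" for u :: "complex^2"
    by (simp add: vec_eq_iff)
  have iadd: "\<i> *s (u + v) = \<i> *s u + \<i> *s v" for u v :: "complex^2"
    by (simp add: vec_eq_iff algebra_simps)
  have Hadd: "H (u + v) w = H u w + H v w" "H u (v + w) = H u v + H u w" for u v w
    by (simp_all add: H_def iadd algebra_simps)
  have sym: "val E (\<i> *s u) v = val E (\<i> *s v) u" for u v
    using inv[of "\<i> *s u" v] alternating_swap[OF alt, of u "\<i> *s v"] by (simp add: ii)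
  have Hskew: "H u v - H v u = 2 * \<i> * complex_of_real (val E u v)" for u v
    using alternating_swap[OF alt, of v u] by (simp add: H_def sym[of u v])
  have Hlin: "H (c *s u) w = c * H u w" for c u w
  proof -
    have 1: "c *s u = Re c *\<^sub>R u + Im c *\<^sub>R (\<i> *s u)"
      by (simp add: vec_eq_iff complex_eq_iff)
    have 2: "\<i> *s (c *s u) = Re c *\<^sub>R (\<i> *s u) - Im c *\<^sub>R u"
      by (simp add: vec_eq_iff complex_eq_iff)
    show ?thesis
      unfolding H_def 2 unfolding 1 by (simp add: complex_eq_iff algebra_simps)
  qed
  have hol: "holomorphic_C2 (g l)" for l
  proof -
    have "linear (\<lambda>v. H v l / (2 * \<i>))"
      by (rule linearI) (simp_all add: Hadd Hlin scaleR_eq_scaleC scaleR_conv_of_real distrib_left diff_divide_distrib)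
    then have bl: "bounded_linear (\<lambda>v. H v l / (2 * \<i>))" by (simp add: linear_conv_bounded_linear)
    have "(g l has_derivative (\<lambda>w. H w l / (2 * \<i>))) (at v)" for v
      unfolding g_def add_divide_distrib
      by (rule derivative_eq_intros bounded_linear.has_derivative[OF bl] refl)+ simp
    then show ?thesis
      unfolding holomorphic_C2_def by (intro allI exI conjI) (auto simp: Hlin)
  qed
  have sE: "s u v - s v u = val E u v" for u v
    unfolding s_def e_def alternating_expand[OF alt, of u v] by (simp add: algebra_simps)
  have sadd: "s (u + v) w = s u w + s v w" "s u (v + w) = s u v + s u w" for u v w
    by (simp_all add: s_def coord_add algebra_simps)
  have sint: "s l m \<in> \<int>" if "l \<in> \<Lambda>" "m \<in> \<Lambda>" for l m
    using that int[OF basis_in_lattice basis_in_lattice] unfolding s_def e_def lattice_iff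
    by (auto intro!: Ints_add Ints_mult)
  have coc: "g (l + m) v = g l (v + m) + g m v + complex_of_real (s l m)" for l m v
  proof -
    have "H l m = H m l + 2 * \<i> * complex_of_real (val E l m)"
      using Hskew[of l m] by (simp add: algebra_simps)
    then have "g (l + m) v - (g l (v + m) + g m v)
       = complex_of_real (val E l m) / 2 + complex_of_real (s l m + s m l) / 2"
      unfolding g_def Hadd sadd by (simp add: field_simps)
    also have "\<dots> = complex_of_real (s l m)"
      using sE[of l m] by (simp add: field_simps flip: of_real_diff)
    finally show ?thesis by (simp add: algebra_simps)
  qed
  define f where "f = (\<lambda>l v. exp (2 * complex_of_real pi * \<i> * g l v))"
  have fhol: "holomorphic_C2 (f l)" for l
    unfolding holomorphic_C2_def
  proof
    fix v
    obtain D where D: "(g l has_derivative D) (at v)" "\<forall>c w. D (c *s w) = c * D w"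
      using hol[of l] unfolding holomorphic_C2_def by blast
    have "((\<lambda>v. 2 * complex_of_real pi * \<i> * g l v) has_derivative (\<lambda>w. 2 * complex_of_real pi * \<i> * D w)) (at v)"
      by (intro derivative_intros D(1))
    moreover have "(exp has_derivative (\<lambda>h. exp (2 * complex_of_real pi * \<i> * g l v) * h)) (at (2 * complex_of_real pi * \<i> * g l v))"
      using DERIV_exp by (simp only: has_field_derivative_def)
    ultimately have "((\<lambda>v. exp (2 * complex_of_real pi * \<i> * g l v)) has_derivative
        (\<lambda>w. exp (2 * complex_of_real pi * \<i> * g l v) * (2 * complex_of_real pi * \<i> * D w))) (at v)"
      by (rule has_derivative_compose[where g=exp and x=v and s=UNIV])
    then have "(f l has_derivative (\<lambda>w. f l v * (2 * complex_of_real pi * \<i> * D w))) (at v)"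
      by (simp only: f_def)
    then show "\<exists>D. (f l has_derivative D) (at v) \<and> (\<forall>c w. D (c *s w) = c * D w)"
      using D(2) by (intro exI[of _ "\<lambda>w. f l v * (2 * complex_of_real pi * \<i> * D w)"] conjI) auto
  qed
  have "f (l + m) v = f l (v + m) * f m v" if lm: "l \<in> \<Lambda>" "m \<in> \<Lambda>" for l m v
  proof -
    obtain k :: int where k: "s l m = of_int k" using sint[OF lm] by (auto elim: Ints_cases)
    have "f (l + m) v = f l (v + m) * f m v * exp (2 * complex_of_real pi * \<i> * of_int k)"
      unfolding f_def coc k exp_add[symmetric] by (simp add: algebra_simps)
    also have "exp (2 * complex_of_real pi * \<i> * of_int k) = 1"
      using exp_integer_2pi[of "of_int k"] by (simp add: mult_ac)
    finally show ?thesis by simp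
  qed
  then have "factor_of_automorphy \<Lambda> f"
    by (simp add: factor_of_automorphy_def fhol) (simp add: f_def)
  moreover have "first_chern \<Lambda> f E"
    unfolding first_chern_def
  proof (intro conjI exI[of _ g] ballI allI E hol)
    fix l m v
    have "H l m - H m l = 2 * \<i> * complex_of_real (val E l m)" by (rule Hskew)
    then show "complex_of_real (val E l m) = g m (v + l) + g l v - g l (v + m) - g m v"
      by (simp add: g_def Hadd field_simps)
  qed (simp add: f_def)
  ultimately show ?thesis by (auto simp: NS_def)
qed

lemma NS_eq: "NS \<Lambda> = {E \<in> H2 \<Lambda>. \<forall>u w. val E (\<i> *s u) (\<i> *s w) = val E u w}"
proof (intro equalityI subsetI)
  fix E assume "E \<in> NS \<Lambda>"
  moreover from this have "E \<in> H2 \<Lambda>" by (auto simp: NS_def first_chern_def)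
  ultimately show "E \<in> {E \<in> H2 \<Lambda>. \<forall>u w. val E (\<i> *s u) (\<i> *s w) = val E u w}"
    using NS_imp_type_11 by simp
qed (auto intro: type_11_imp_NS)

end

section \<open>The Hodge index theorem\<close>

lemma wedge_linear:
  "wedge (E + F) G b = wedge E G b + wedge F G b" "wedge E (F + G) b = wedge E F b + wedge E G b"
  "wedge (E - F) G b = wedge E G b - wedge F G b" "wedge E (F - G) b = wedge E F b - wedge E G b"
  "wedge (c *\<^sub>R E) G b = c * wedge E G b" "wedge E (c *\<^sub>R G) b = c * wedge E G b"
  "wedge (- E) G b = - wedge E G b" "wedge E (- G) b = - wedge E G b"
  by (simp_all add: wedge_def algebra_simps)

lemma wedge_sym: "wedge E F b = wedge F E b"
  by (simp add: wedge_def algebra_simps)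

text \<open>The Hodge index theorem. In the real basis \<open>e\<^sub>1, \<i>e\<^sub>1, e\<^sub>2, \<i>e\<^sub>2\<close> a form of type (1,1) has four free
  entries, on which the Pfaffian is a form of signature (1,3).\<close>

definition C1 :: "complex^2" where "C1 = axis 1 1"
definition C2 :: "complex^2" where "C2 = axis 2 1"

lemma C_expand: "v = Re (v$1) *\<^sub>R C1 + Im (v$1) *\<^sub>R (\<i> *s C1) + Re (v$2) *\<^sub>R C2 + Im (v$2) *\<^sub>R (\<i> *s C2)"
  by (simp add: vec_eq_iff forall_2 C1_def C2_def axis_def complex_eq_iff)

definition pfaffian :: "form2 \<Rightarrow> real" where
  "pfaffian E = val E C1 (\<i> *s C1) * val E C2 (\<i> *s C2) - val E C1 C2 * val E (\<i> *s C1) (\<i> *s C2)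
     + val E C1 (\<i> *s C2) * val E (\<i> *s C1) C2"

text \<open>This is \<open>Pf(A S A^T) = det A Pf S\<close> for 4 by 4 matrices; the last factor is
  \<open>det A\<close> by Laplace expansion along the first two columns.\<close>

lemma pfaffian_change_of_basis:
  fixes S12 S13 S14 S23 S24 S34 :: real
  shows "((S12 * (u1 * v2 - u2 * v1) + S13 * (u1 * v3 - u3 * v1) + S14 * (u1 * v4 - u4 * v1)
        + S23 * (u2 * v3 - u3 * v2) + S24 * (u2 * v4 - u4 * v2) + S34 * (u3 * v4 - u4 * v3))
       * (S12 * (w1 * x2 - w2 * x1) + S13 * (w1 * x3 - w3 * x1) + S14 * (w1 * x4 - w4 * x1)
        + S23 * (w2 * x3 - w3 * x2) + S24 * (w2 * x4 - w4 * x2) + S34 * (w3 * x4 - w4 * x3))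
   - (S12 * (u1 * w2 - u2 * w1) + S13 * (u1 * w3 - u3 * w1) + S14 * (u1 * w4 - u4 * w1)
        + S23 * (u2 * w3 - u3 * w2) + S24 * (u2 * w4 - u4 * w2) + S34 * (u3 * w4 - u4 * w3))
       * (S12 * (v1 * x2 - v2 * x1) + S13 * (v1 * x3 - v3 * x1) + S14 * (v1 * x4 - v4 * x1)
        + S23 * (v2 * x3 - v3 * x2) + S24 * (v2 * x4 - v4 * x2) + S34 * (v3 * x4 - v4 * x3))
   + (S12 * (u1 * x2 - u2 * x1) + S13 * (u1 * x3 - u3 * x1) + S14 * (u1 * x4 - u4 * x1)
        + S23 * (u2 * x3 - u3 * x2) + S24 * (u2 * x4 - u4 * x2) + S34 * (u3 * x4 - u4 * x3))
       * (S12 * (v1 * w2 - v2 * w1) + S13 * (v1 * w3 - v3 * w1) + S14 * (v1 * w4 - v4 * w1)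
        + S23 * (v2 * w3 - v3 * w2) + S24 * (v2 * w4 - v4 * w2) + S34 * (v3 * w4 - v4 * w3)))
  = (S12 * S34 - S13 * S24 + S14 * S23)
   * ((u1 * v2 - u2 * v1) * (w3 * x4 - w4 * x3) - (u1 * w2 - u2 * w1) * (v3 * x4 - v4 * x3)
    + (u1 * x2 - u2 * x1) * (v3 * w4 - v4 * w3) + (v1 * w2 - v2 * w1) * (u3 * x4 - u4 * x3)
    - (v1 * x2 - v2 * x1) * (u3 * w4 - u4 * w3) + (w1 * x2 - w2 * x1) * (u3 * v4 - u4 * v3))"
  by (simp add: algebra_simps)

lemma wedge_pfaffian:
  obtains \<kappa> where "\<And>E. (\<And>x. val E x x = 0) \<Longrightarrow> wedge E E b = 2 * \<kappa> * pfaffian E"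
proof -
  \<comment> \<open>\<open>m\<close> and \<open>n\<close> are the 2 by 2 minors in the two complex
    coordinates, and \<open>\<kappa>\<close> is the Laplace expansion of \<open>period_det b\<close>
    by them.\<close>
  define m where "m = (\<lambda>i j. Re (b$i$1) * Im (b$j$1) - Im (b$i$1) * Re (b$j$1))"
  define n where "n = (\<lambda>i j. Re (b$i$2) * Im (b$j$2) - Im (b$i$2) * Re (b$j$2))"
  define \<kappa> where "\<kappa> = m 1 2 * n 3 4 - m 1 3 * n 2 4 + m 1 4 * n 2 3 + m 2 3 * n 1 4 - m 2 4 * n 1 3 + m 3 4 * n 1 2"
  have "wedge E E b = 2 * \<kappa> * pfaffian E" if alt: "\<And>x. val E x x = 0" for E
  proof -
    have e: "val E (b$i) (b$j) = val E C1 (\<i> *s C1) * (Re (b$i$1) * Im (b$j$1) - Im (b$i$1) * Re (b$j$1))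
       + val E C1 C2 * (Re (b$i$1) * Re (b$j$2) - Re (b$i$2) * Re (b$j$1))
       + val E C1 (\<i> *s C2) * (Re (b$i$1) * Im (b$j$2) - Im (b$i$2) * Re (b$j$1))
       + val E (\<i> *s C1) C2 * (Im (b$i$1) * Re (b$j$2) - Re (b$i$2) * Im (b$j$1))
       + val E (\<i> *s C1) (\<i> *s C2) * (Im (b$i$1) * Im (b$j$2) - Im (b$i$2) * Im (b$j$1))
       + val E C2 (\<i> *s C2) * (Re (b$i$2) * Im (b$j$2) - Im (b$i$2) * Re (b$j$2))" for i j
      by (subst C_expand[of "b$i"], subst C_expand[of "b$j"]) (rule alternating_combination[OF alt])
    have "wedge E E b = 2 * (val E (b$1) (b$2) * val E (b$3) (b$4) - val E (b$1) (b$3) * val E (b$2) (b$4)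
        + val E (b$1) (b$4) * val E (b$2) (b$3))"
      by (simp add: wedge_def)
    also have "\<dots> = 2 * (pfaffian E * \<kappa>)"
      unfolding e pfaffian_change_of_basis pfaffian_def \<kappa>_def m_def n_def by (rule refl)
    finally show ?thesis by simp
  qed
  then show ?thesis by (rule that)
qed

text \<open>A (1,1) form amounts to a Hermitian 2 by 2 matrix with determinant
  \<open>pfaffian\<close>. The determinant of a positive definite \<open>E\<close> is positive, and
  the reversed Cauchy-Schwarz inequality excludes a nonzero \<open>F\<close> orthogonal to
  \<open>E\<close> of nonnegative square. Orthogonality enters as additivity of
  \<open>pfaffian\<close>.\<close>

lemma hodge_index_pfaffian:
  assumes E: "\<And>x. val E x x = 0" "\<And>u w. val E (\<i> *s u) (\<i> *s w) = val E u w" "\<And>v. v \<noteq> 0 \<Longrightarrow> val E (\<i> *s v) v > 0"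
    and F: "\<And>x. val F x x = 0" "\<And>u w. val F (\<i> *s u) (\<i> *s w) = val F u w"
    and orth: "pfaffian (E + F) = pfaffian E + pfaffian F" and "F \<noteq> 0"
  shows "pfaffian E > 0" "pfaffian F < 0"
proof -
  have ii: "\<i> *s (\<i> *s u) = - u" for u :: "complex^2"
    by (simp add: vec_eq_iff)
  have S: "val G (\<i> *s C1) (\<i> *s C2) = val G C1 C2" "val G (\<i> *s C1) C2 = - val G C1 (\<i> *s C2)"
    if "\<And>u w. val G (\<i> *s u) (\<i> *s w) = val G u w" for G
    using that[of C1 C2] that[of "\<i> *s C1" C2] by (simp_all add: ii)
  define a where "a = - val E C1 (\<i> *s C1)"
  define d where "d = - val E C2 (\<i> *s C2)"
  define \<beta> where "\<beta> = val E C1 C2"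
  define \<gamma> where "\<gamma> = val E C1 (\<i> *s C2)"
  define a' where "a' = - val F C1 (\<i> *s C1)"
  define d' where "d' = - val F C2 (\<i> *s C2)"
  define \<beta>' where "\<beta>' = val F C1 C2"
  define \<gamma>' where "\<gamma>' = val F C1 (\<i> *s C2)"
  have pE: "pfaffian E = a * d - \<beta>^2 - \<gamma>^2" and pF: "pfaffian F = a' * d' - \<beta>'^2 - \<gamma>'^2"
    by (simp_all add: pfaffian_def S[OF E(2)] S[OF F(2)] a_def d_def \<beta>_def \<gamma>_def a'_def d'_def \<beta>'_def \<gamma>'_def power2_eq_square)
  have orth': "a * d' + d * a' = 2 * (\<beta> * \<beta>' + \<gamma> * \<gamma>')"
    using orth by (simp add: pfaffian_def S[OF E(2)] S[OF F(2)] a_def d_def \<beta>_def \<gamma>_def a'_def d'_def \<beta>'_def \<gamma>'_def algebra_simps)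
  have nz: "C1 \<noteq> 0" "C2 \<noteq> 0" by (auto simp: C1_def C2_def)
  have apos: "a > 0" "d > 0"
    using E(3)[OF nz(1)] E(3)[OF nz(2)] alternating_swap[OF E(1), of C1] alternating_swap[OF E(1), of C2]
    by (simp_all add: a_def d_def)
  \<comment> \<open>A column of the adjugate of the Hermitian matrix: on it the Hermitian form takes
    the value \<open>d\<close> times the determinant.\<close>
  define v where "v = d *\<^sub>R C1 + \<gamma> *\<^sub>R C2 - \<beta> *\<^sub>R (\<i> *s C2)"
  have iv: "\<i> *s v = d *\<^sub>R (\<i> *s C1) + \<gamma> *\<^sub>R (\<i> *s C2) + \<beta> *\<^sub>R C2"
    unfolding v_def by (simp add: vec_eq_iff algebra_simps complex_eq_iff)
  have "v $ 1 = of_real d" by (simp add: v_def C1_def C2_def axis_def scaleR_conv_of_real[where 'a=complex])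
  then have "v \<noteq> 0" using apos by auto
  from E(3)[OF this] have "val E (\<i> *s v) v > 0" .
  also have "val E (\<i> *s v) v = d * (a * d - \<beta>^2 - \<gamma>^2)"
    unfolding iv unfolding v_def
    using alternating_swap[OF E(1), of "\<i> *s C1" C1] alternating_swap[OF E(1), of "\<i> *s C2" C1]
      alternating_swap[OF E(1), of "\<i> *s C2" C2] alternating_swap[OF E(1), of C2 C1]
    by (simp add: S[OF E(2)] E(1) a_def d_def \<beta>_def \<gamma>_def algebra_simps power2_eq_square)
  finally show pEpos: "pfaffian E > 0"
    using apos unfolding pE by (simp add: zero_less_mult_iff)
  have Fnz: "\<not> (a' = 0 \<and> d' = 0 \<and> \<beta>' = 0 \<and> \<gamma>' = 0)"
  proof
    assume z: "a' = 0 \<and> d' = 0 \<and> \<beta>' = 0 \<and> \<gamma>' = 0"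
    have "val F u w = 0" for u w
      using z unfolding a'_def d'_def \<beta>'_def \<gamma>'_def
      by (subst C_expand[of u], subst C_expand[of w], subst alternating_combination[OF F(1)])
         (simp add: S[OF F(2)])
    then have "F = 0" by (intro blinfun_eqI) simp
    then show False using \<open>F \<noteq> 0\<close> by simp
  qed
  show "pfaffian F < 0"
  proof (rule ccontr)
    assume "\<not> pfaffian F < 0"
    then have le: "\<beta>'^2 + \<gamma>'^2 \<le> a' * d'" unfolding pF by simp
    have lt: "\<beta>^2 + \<gamma>^2 < a * d" using pEpos unfolding pE by simp
    have cs: "(\<beta> * \<beta>' + \<gamma> * \<gamma>')^2 \<le> (\<beta>^2 + \<gamma>^2) * (\<beta>'^2 + \<gamma>'^2)"
    proof -
      have "(\<beta>^2 + \<gamma>^2) * (\<beta>'^2 + \<gamma>'^2) - (\<beta> * \<beta>' + \<gamma> * \<gamma>')^2 = (\<beta> * \<gamma>' - \<gamma> * \<beta>')^2"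
        by (simp add: algebra_simps power2_eq_square)
      then show ?thesis by (metis diff_ge_0_iff_ge zero_le_power2)
    qed
    have "4 * (a * d) * (a' * d') \<le> (a * d' + d * a')^2"
      using zero_le_power2[of "a * d' - d * a'"] by (simp add: algebra_simps power2_eq_square)
    also have "\<dots> = 4 * (\<beta> * \<beta>' + \<gamma> * \<gamma>')^2" unfolding orth' by (simp only: power_mult_distrib) simp
    finally have 1: "(a * d) * (a' * d') \<le> (\<beta>^2 + \<gamma>^2) * (\<beta>'^2 + \<gamma>'^2)" using cs by simp
    have 2: "(\<beta>^2 + \<gamma>^2) * (\<beta>'^2 + \<gamma>'^2) \<le> (\<beta>^2 + \<gamma>^2) * (a' * d')"
      by (rule mult_left_mono[OF le]) simp
    have 3: "a' * d' \<ge> 0" using le by (rule order_trans[rotated]) simp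
    have "a' * d' = 0"
    proof (rule ccontr)
      assume "a' * d' \<noteq> 0"
      then have "a' * d' > 0" using 3 by linarith
      then have "(\<beta>^2 + \<gamma>^2) * (a' * d') < a * d * (a' * d')" using lt by (intro mult_strict_right_mono)
      then show False using 1 2 by simp
    qed
    then have bz: "\<beta>' = 0" "\<gamma>' = 0" using le unfolding \<open>a' * d' = 0\<close> by (simp_all add: sum_power2_le_zero_iff)
    then have "a * d' = - (d * a')" using orth' by simp
    with \<open>a' * d' = 0\<close> apos have "a' = 0 \<and> d' = 0" by auto
    with bz Fnz show False by simp
  qed
qed

section \<open>The cohomology lattice of the torus in integer coordinates\<close>

type_synonym int6 = "int \<times> int \<times> int \<times> int \<times> int \<times> int"

declare split_paired_All [simp del] split_paired_Ex [simp del]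

text \<open>The lattice \<open>U\<^sup>3\<close>, with the last four coordinates arranged as a matrix under the determinant.\<close>

fun pair6 :: "int6 \<Rightarrow> int6 \<Rightarrow> int" where
  "pair6 (x, y, p, q, r, s) (x', y', p', q', r', s') =
     x * y' + y * x' + p * s' + s * p' - q * r' - r * q'"

fun smul6 :: "int \<Rightarrow> int6 \<Rightarrow> int6" where
  "smul6 k (x, y, p, q, r, s) = (k * x, k * y, k * p, k * q, k * r, k * s)"

lemma smul6_add: "smul6 (k + l) t = smul6 k t + smul6 l t" "smul6 k (t + u) = smul6 k t + smul6 k u"
  by (cases t; cases u; simp add: algebra_simps)+

lemma smul6_assoc: "smul6 k (smul6 l t) = smul6 (k * l) t"
  by (cases t) simp

lemma smul6_one: "smul6 1 t = t" by (cases t) simp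

lemma smul6_eq_0: "smul6 k t = 0 \<longleftrightarrow> k = 0 \<or> t = 0"
  by (cases t) (auto simp: zero_prod_def)

lemma smul6_0: "smul6 0 t = 0" by (simp add: smul6_eq_0)

lemma smul6_minus: "smul6 (- k) t = - smul6 k t" "smul6 k (- t) = - smul6 k t"
  by (cases t; simp)+

lemma pair6_sym: "pair6 t u = pair6 u t"
  by (cases t; cases u) (simp add: algebra_simps)

lemma pair6_add: "pair6 (t + u) v = pair6 t v + pair6 u v" "pair6 v (t + u) = pair6 v t + pair6 v u"
  by (cases t; cases u; cases v; simp add: algebra_simps)+

lemma pair6_smul: "pair6 (smul6 k t) v = k * pair6 t v" "pair6 v (smul6 k t) = k * pair6 v t"
  by (cases t; cases v; simp add: algebra_simps)+

lemma pair6_minus: "pair6 (- t) v = - pair6 t v" "pair6 v (- t) = - pair6 v t"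
  by (cases t; cases v; simp add: algebra_simps)+

lemma pair6_even: "even (pair6 t t)"
  by (cases t) simp

context period_lattice
begin

definition coord_wedge :: "4 \<Rightarrow> 4 \<Rightarrow> form2" where
  "coord_wedge i j = Blinfun (\<lambda>v. coord i v *\<^sub>R Blinfun (coord j) - coord j v *\<^sub>R Blinfun (coord i))"

lemma val_coord_wedge: "val (coord_wedge i j) u v = coord i u * coord j v - coord j u * coord i v"
proof -
  have "bounded_linear (\<lambda>v. coord i v *\<^sub>R Blinfun (coord j) - coord j v *\<^sub>R Blinfun (coord i))"
    by (intro bounded_linear_sub bounded_linear_scaleR_const coord_bounded_linear)
  then show ?thesis
    by (simp add: coord_wedge_def bounded_linear_Blinfun_apply coord_bounded_linear blinfun.bilinear_simps)
qed

text \<open>The slots are arranged so that the cup product becomes \<open>pair6\<close>: in the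
  exterior product 12 meets 34 and 14 meets 23 with sign +, 13 meets 24 with sign -.\<close>

fun cls :: "int6 \<Rightarrow> form2" where
  "cls (x, y, p, q, r, s) = of_int x *\<^sub>R coord_wedge 1 2 + of_int y *\<^sub>R coord_wedge 3 4 + of_int p *\<^sub>R coord_wedge 1 4
     + of_int s *\<^sub>R coord_wedge 2 3 + of_int q *\<^sub>R coord_wedge 1 3 + of_int r *\<^sub>R coord_wedge 2 4"

lemma cls_add: "cls (t + u) = cls t + cls u"
  by (cases t; cases u) (simp add: algebra_simps)

lemma cls_smul: "cls (smul6 k t) = of_int k *\<^sub>R cls t"
  by (cases t) (simp add: algebra_simps)

lemma cls_zero: "cls 0 = 0"
  by (simp add: zero_prod_def)

declare cls.simps [simp del]

lemma val_cls:
  "val (cls (x, y, p, q, r, s)) (b$1) (b$2) = of_int x" "val (cls (x, y, p, q, r, s)) (b$3) (b$4) = of_int y"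
  "val (cls (x, y, p, q, r, s)) (b$1) (b$4) = of_int p" "val (cls (x, y, p, q, r, s)) (b$1) (b$3) = of_int q"
  "val (cls (x, y, p, q, r, s)) (b$2) (b$4) = of_int r" "val (cls (x, y, p, q, r, s)) (b$2) (b$3) = of_int s"
  by (simp_all add: cls.simps val_coord_wedge coord_basis)

lemma cls_inj: "cls t = cls u \<longleftrightarrow> t = u"
proof
  assume e: "cls t = cls u"
  obtain x y p q r s where t: "t = (x, y, p, q, r, s)" by (cases t)
  obtain x' y' p' q' r' s' where u: "u = (x', y', p', q', r', s')" by (cases u)
  show "t = u"
    using val_cls[of x y p q r s] val_cls[of x' y' p' q' r' s'] e unfolding t u
    by simp
qed simp

lemma cls_H2: "cls t \<in> H2 \<Lambda>"
  by (cases t) (auto simp: cls.simps H2_def val_coord_wedge lattice_iff intro!: Ints_add Ints_mult Ints_diff)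

lemma H2_alternating: "E \<in> H2 \<Lambda> \<Longrightarrow> val E x x = 0"
  by (simp add: H2_def)

lemma H2_cls:
  assumes "E \<in> H2 \<Lambda>"
  obtains t where "E = cls t"
proof -
  have int: "of_int \<lfloor>val E (b$i) (b$j)\<rfloor> = val E (b$i) (b$j)" for i j
    using assms basis_in_lattice by (auto simp: H2_def elim!: Ints_cases ballE[of _ _ "b$i"] ballE[of _ _ "b$j"])
  define t where "t = (\<lfloor>val E (b$1) (b$2)\<rfloor>, \<lfloor>val E (b$3) (b$4)\<rfloor>, \<lfloor>val E (b$1) (b$4)\<rfloor>,
     \<lfloor>val E (b$1) (b$3)\<rfloor>, \<lfloor>val E (b$2) (b$4)\<rfloor>, \<lfloor>val E (b$2) (b$3)\<rfloor>)"
  have "val E u v = val (cls t) u v" for u v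
    using alternating_expand[OF H2_alternating[OF assms], of u v] unfolding t_def
    by (simp add: cls.simps val_coord_wedge int)
  then have "E = cls t" by (intro blinfun_eqI) simp
  then show ?thesis by (rule that)
qed

lemma range_cls: "range cls = H2 \<Lambda>"
  using H2_cls cls_H2 by (auto elim: H2_cls)

lemma wedge_cls: "wedge (cls t) (cls u) b = of_int (pair6 t u)"
  by (cases t; cases u) (simp only: wedge_def val_cls pair6.simps, simp)

definition NS6 :: "int6 set" where "NS6 = {t. cls t \<in> NS \<Lambda>}"

lemma NS6_add: "t \<in> NS6 \<Longrightarrow> u \<in> NS6 \<Longrightarrow> t + u \<in> NS6"
  using cls_H2[of "t + u"] by (simp add: NS6_def NS_eq cls_add)

lemma NS6_saturated: "smul6 k t \<in> NS6 \<longleftrightarrow> k = 0 \<or> t \<in> NS6"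
  using cls_H2[of t] cls_H2[of "smul6 k t"] by (auto simp: NS6_def NS_eq cls_smul)

lemma NS_cls: "NS \<Lambda> = cls ` NS6"
proof -
  have "NS \<Lambda> \<subseteq> range cls" unfolding range_cls by (auto simp: NS_eq)
  then show ?thesis by (auto simp: NS6_def)
qed

text \<open>A positive class \<open>E\<close> and the projection of a second class orthogonal to \<open>E\<close> have squares of
  opposite sign.\<close>

lemma NS6_hodge_index:
  assumes pos: "E \<in> NS \<Lambda>" "\<And>v. v \<noteq> 0 \<Longrightarrow> val E (\<i> *s v) v > 0"
    and t: "t \<in> NS6" "u \<in> NS6" and indep: "\<And>k l. smul6 k t + smul6 l u = 0 \<Longrightarrow> k = 0 \<and> l = 0"
    and rank: "\<And>z. z \<in> NS6 \<Longrightarrow> \<exists>m i j. m \<noteq> 0 \<and> smul6 m z = smul6 i t + smul6 j u"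
  shows "pair6 t t * pair6 u u < (pair6 t u)\<^sup>2"
proof -
  obtain \<kappa> where \<kappa>: "\<And>E. (\<And>x. val E x x = 0) \<Longrightarrow> wedge E E b = 2 * \<kappa> * pfaffian E"
    using wedge_pfaffian by blast
  obtain e where e: "e \<in> NS6" "E = cls e" using pos(1) NS_cls by auto
  have \<kappa>0: "\<kappa> \<noteq> 0"
  proof
    assume "\<kappa> = 0"
    then have "wedge (cls (1,1,0,0,0,0)) (cls (1,1,0,0,0,0)) b = 0"
      using \<kappa>[OF H2_alternating[OF cls_H2], of "(1,1,0,0,0,0)"] by simp
    then show False unfolding wedge_cls by simp
  qed
  have opposite: "pair6 e e * pair6 w w < 0"
    if w: "w \<in> NS6" "w \<noteq> 0" "pair6 e w = 0" for w
  proof -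
    have alt: "val (cls v) x x = 0" for v x by (rule H2_alternating[OF cls_H2])
    have inv: "val (cls v) (\<i> *s x) (\<i> *s y) = val (cls v) x y" if "v \<in> NS6" for v x y
      using that by (simp add: NS6_def NS_eq)
    have q: "of_int (pair6 v v) = 2 * \<kappa> * pfaffian (cls v)" for v
      using \<kappa>[OF alt] wedge_cls[of v v] by simp
    have "2 * \<kappa> * pfaffian (cls e + cls w) = of_int (pair6 (e + w) (e + w))"
      using q[of "e + w"] by (simp add: cls_add)
    also have "\<dots> = 2 * \<kappa> * (pfaffian (cls e) + pfaffian (cls w))"
      using w(3) pair6_sym[of w e] by (simp add: pair6_add q distrib_left)
    finally have "pfaffian (cls e + cls w) = pfaffian (cls e) + pfaffian (cls w)" using \<kappa>0 by simp
    moreover have "cls w \<noteq> 0" using w(2) cls_inj[of w 0] by (simp add: cls_zero)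
    ultimately have "pfaffian (cls e) > 0" "pfaffian (cls w) < 0"
      using hodge_index_pfaffian[of "cls e" "cls w"] alt inv[OF e(1)] inv[OF w(1)] pos(2) unfolding e(2) by blast+
    then have "pfaffian (cls e) * pfaffian (cls w) < 0" by (rule mult_pos_neg)
    then have "4 * \<kappa>\<^sup>2 * (pfaffian (cls e) * pfaffian (cls w)) < 0"
      using \<kappa>0 mult_pos_neg[of "4 * \<kappa>\<^sup>2" "pfaffian (cls e) * pfaffian (cls w)"] by simp
    also have "4 * \<kappa>\<^sup>2 * (pfaffian (cls e) * pfaffian (cls w)) = of_int (pair6 e e * pair6 w w)"
      by (simp add: q power2_eq_square)
    finally show ?thesis by (simp only: of_int_less_0_iff)
  qed
  have sc: "smul6 k v \<in> NS6" if "v \<in> NS6" for k v using that NS6_saturated by simp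
  have ortho: "pair6 e e * pair6 v v < (pair6 e v)\<^sup>2" if v: "v \<in> NS6" "smul6 (pair6 e e) v - smul6 (pair6 e v) e \<noteq> 0" for v
  proof -
    let ?w = "smul6 (pair6 e e) v + smul6 (- pair6 e v) e"
    have "pair6 e e * pair6 ?w ?w < 0"
    proof (rule opposite)
      show "?w \<in> NS6" by (intro NS6_add sc v(1) e(1))
      show "?w \<noteq> 0" using v(2) by (simp only: smul6_minus add_uminus_conv_diff) simp
      show "pair6 e ?w = 0" by (simp only: pair6_add pair6_smul) simp
    qed
    also have "pair6 ?w ?w = pair6 e e * (pair6 e e * pair6 v v - (pair6 e v)\<^sup>2)"
      by (simp only: pair6_add pair6_smul pair6_sym[of v e]) (simp add: algebra_simps power2_eq_square)
    finally have "(pair6 e e)\<^sup>2 * (pair6 e e * pair6 v v - (pair6 e v)\<^sup>2) < 0"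
      by (simp add: power2_eq_square mult.assoc)
    then show ?thesis by (simp add: mult_less_0_iff)
  qed
  \<comment> \<open>The orthogonal complement of \<open>e\<close> contains a nonzero vector of the
    rank two span of \<open>t\<close> and \<open>u\<close>; by \<open>opposite\<close> the product
    of its square with that of \<open>e\<close> is negative.\<close>
  have ee: "pair6 e e \<noteq> 0"
  proof -
    have "\<exists>k l. (k \<noteq> 0 \<or> l \<noteq> 0) \<and> pair6 e (smul6 k t + smul6 l u) = 0"
    proof (cases "pair6 e t = 0")
      case True
      then show ?thesis by (intro exI[of _ 1] exI[of _ 0]) (simp add: pair6_add pair6_smul)
    next
      case False
      then show ?thesis
        by (intro exI[of _ "pair6 e u"] exI[of _ "- pair6 e t"]) (simp add: pair6_add pair6_smul)
    qed
    then obtain k l where "k \<noteq> 0 \<or> l \<noteq> 0" "pair6 e (smul6 k t + smul6 l u) = 0" by blast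
    then have "pair6 e e * pair6 (smul6 k t + smul6 l u) (smul6 k t + smul6 l u) < 0"
      using indep by (intro opposite NS6_add sc t) blast+
    then show ?thesis by auto
  qed
  obtain m i j where m: "m \<noteq> 0" "smul6 m e = smul6 i t + smul6 j u" using rank[OF e(1)] by blast
  \<comment> \<open>\<open>i \<noteq> 0\<close> makes \<open>u\<close> independent of
    \<open>e\<close>. Replacing \<open>e\<close> by \<open>t\<close> changes the Gram determinant by
    the factor \<open>i^2\<close>, up to the \<open>m^2\<close> from clearing denominators.\<close>
  have step: "pair6 t t * pair6 u u < (pair6 t u)\<^sup>2"
    if t: "t \<in> NS6" "u \<in> NS6" and indep: "\<And>k l. smul6 k t + smul6 l u = 0 \<Longrightarrow> k = 0 \<and> l = 0"
     and m: "m \<noteq> 0" "smul6 m e = smul6 i t + smul6 j u" and "i \<noteq> 0" for t u i j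
  proof -
    have "smul6 (pair6 e e) u - smul6 (pair6 e u) e \<noteq> 0"
    proof
      assume "smul6 (pair6 e e) u - smul6 (pair6 e u) e = 0"
      then have q: "smul6 (pair6 e e) u = smul6 (pair6 e u) e" by simp
      have "smul6 (m * pair6 e e) u = smul6 m (smul6 (pair6 e u) e)"
        unfolding q[symmetric] by (simp add: smul6_assoc)
      also have "\<dots> = smul6 (pair6 e u) (smul6 m e)"
        by (simp add: smul6_assoc mult.commute)
      also have "\<dots> = smul6 (pair6 e u * i) t + smul6 (pair6 e u * j) u"
        unfolding m(2) by (simp add: smul6_add smul6_assoc)
      finally have "smul6 (pair6 e u * i) t + smul6 (pair6 e u * j - m * pair6 e e) u = 0"
        using smul6_add(1)[of "pair6 e u * j - m * pair6 e e" "m * pair6 e e" u] by (simp add: algebra_simps)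
      from indep[OF this] \<open>i \<noteq> 0\<close> m(1) ee show False by auto
    qed
    from ortho[OF t(2) this] have "m\<^sup>2 * (pair6 e e * pair6 u u) < m\<^sup>2 * (pair6 e u)\<^sup>2"
      using m(1) by (intro mult_strict_left_mono) auto
    also have "m\<^sup>2 * (pair6 e e * pair6 u u) = pair6 (smul6 m e) (smul6 m e) * pair6 u u"
      by (simp add: pair6_smul power2_eq_square)
    also have "m\<^sup>2 * (pair6 e u)\<^sup>2 = (pair6 (smul6 m e) u)\<^sup>2"
      by (simp add: pair6_smul power_mult_distrib)
    finally have "i\<^sup>2 * (pair6 t t * pair6 u u) < i\<^sup>2 * (pair6 t u)\<^sup>2"
      unfolding m(2) using pair6_sym[of u t]
      by (simp add: pair6_add pair6_smul power2_eq_square algebra_simps)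
    then show ?thesis using \<open>i \<noteq> 0\<close> by (simp add: mult_less_cancel_left)
  qed
  have "i \<noteq> 0 \<or> j \<noteq> 0"
  proof (rule ccontr)
    assume "\<not> ?thesis"
    then have "smul6 m e = 0" using m(2) by (simp add: smul6_0)
    then have "e = 0" using m(1) smul6_eq_0 by simp
    then show False using ee by (simp add: zero_prod_def)
  qed
  then show ?thesis
  proof
    assume "j \<noteq> 0"
    have indep': "k = 0 \<and> l = 0" if "smul6 k u + smul6 l t = 0" for k l
      using indep[of l k] that by (simp add: add.commute)
    have m': "smul6 m e = smul6 j u + smul6 i t" using m(2) by (simp add: add.commute)
    have "pair6 u u * pair6 t t < (pair6 u t)\<^sup>2"
      by (rule step[OF t(2,1) indep' m(1) m' \<open>j \<noteq> 0\<close>])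
    then show ?thesis by (simp add: pair6_sym[of u t] mult.commute)
  qed (use step[OF t indep m] in auto)
qed

end

section \<open>Integral independence and the Picard number\<close>

lemma rat_common_denominator:
  assumes "finite S"
  shows "\<exists>d::int. d > 0 \<and> (\<forall>v\<in>S. \<exists>k::int. of_int d * (c v :: rat) = of_int k)"
  using assms
proof (induction S rule: finite_induct)
  case (insert x S)
  then obtain d where d: "d > 0" "\<forall>v\<in>S. \<exists>k::int. of_int d * c v = of_int k" by blast
  obtain p q where pq: "c x = Fract p q" "q > 0" by (cases "c x") auto
  have "\<exists>k::int. of_int (d * q) * c v = of_int k" if "v \<in> insert x S" for v
  proof (cases "v = x")
    case True
    then have "of_int (d * q) * c v = of_int (d * p)"
      using pq by (simp add: Fract_of_int_quotient)
    then show ?thesis by blast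
  next
    case False
    then have "v \<in> S" using that by simp
    with d(2) obtain k :: int where "of_int d * c v = of_int k" by blast
    then have "of_int (d * q) * c v = of_int (k * q)" by (simp add: mult_ac)
    then show ?thesis by blast
  qed
  then show ?case using d(1) pq(2) by (intro exI[of _ "d * q"]) auto
qed (auto intro: exI[of _ 1])

text \<open>\<open>bool \<times> 3\<close> serves as an index type with six elements; over
  \<open>rat\<close> the dimension theory of vector spaces becomes available for integral
  independence.\<close>

definition rat_coords :: "int6 \<Rightarrow> rat^(bool \<times> 3)" where
  "rat_coords = (\<lambda>(x, y, p, q, r, s). \<chi> i. of_int
     (case i of (True, k) \<Rightarrow> if k = 1 then x else if k = 2 then y else p
              | (False, k) \<Rightarrow> if k = 1 then q else if k = 2 then r else s))"

lemma rat_coords_eq_0: "rat_coords t = 0 \<longleftrightarrow> t = 0"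
  by (cases t) (auto simp: rat_coords_def vec_eq_iff forall_3 split_paired_All zero_prod_def all_bool_eq)

lemma rat_coords_add: "rat_coords (t + u) = rat_coords t + rat_coords u"
  by (cases t; cases u) (simp add: rat_coords_def vec_eq_iff forall_3 split_paired_All all_bool_eq)

lemma rat_coords_smul: "rat_coords (smul6 k t) = of_int k *s rat_coords t"
  by (cases t) (simp add: rat_coords_def vec_eq_iff forall_3 split_paired_All all_bool_eq)

context period_lattice
begin

lemma sum_cls:
  assumes "finite B" "B \<subseteq> H2 \<Lambda>"
  shows "\<exists>t. (\<Sum>E\<in>B. of_int (c E) *\<^sub>R E) = cls t \<and> rat_coords t = (\<Sum>E\<in>B. of_int (c E) *s rat_coords (inv_into UNIV cls E))"
  using assms
proof (induction B rule: finite_induct)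
  case empty
  show ?case by (intro exI[of _ 0]) (simp add: cls_zero rat_coords_eq_0)
next
  case (insert E B)
  then obtain t where t: "(\<Sum>E\<in>B. of_int (c E) *\<^sub>R E) = cls t"
    "rat_coords t = (\<Sum>E\<in>B. of_int (c E) *s rat_coords (inv_into UNIV cls E))" by auto
  have "E \<in> range cls" using insert.prems unfolding range_cls by simp
  then have "cls (inv_into UNIV cls E) = E" by (rule f_inv_into_f)
  then show ?case using insert.hyps t
    by (intro exI[of _ "smul6 (c E) (inv_into UNIV cls E) + t"]) (simp add: cls_add cls_smul rat_coords_add rat_coords_smul)
qed

text \<open>The maximum in \<open>group_rank\<close> has a meaning only over a finite set of
  cardinalities. A rational dependence cleared of denominators would be an integral one, so the
  dimension six is a bound.\<close>

lemma int_independent_card: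
  assumes B: "finite B" "B \<subseteq> H2 \<Lambda>" "int_independent B"
  shows "card B \<le> CARD(bool \<times> 3)"
proof -
  let ?rh = "\<lambda>E. rat_coords (inv_into UNIV cls E)"
  have cinv: "cls (inv_into UNIV cls E) = E" if "E \<in> H2 \<Lambda>" for E
    using that unfolding range_cls[symmetric] by (rule f_inv_into_f)
  have inj: "inj_on ?rh B"
  proof (rule inj_onI)
    fix E F assume EF: "E \<in> B" "F \<in> B" "?rh E = ?rh F"
    have "rat_coords (inv_into UNIV cls E + smul6 (-1) (inv_into UNIV cls F)) = 0"
      unfolding rat_coords_add rat_coords_smul using EF(3) by (simp add: vec_eq_iff)
    then have "inv_into UNIV cls E = inv_into UNIV cls F" unfolding rat_coords_eq_0 by (simp add: smul6_minus smul6_one)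
    then show "E = F" using cinv EF B(2) by (metis subsetD)
  qed
  have "vec.independent (?rh ` B)"
  proof
    assume "vec.dependent (?rh ` B)"
    then obtain u where u: "\<exists>v\<in>?rh ` B. u v \<noteq> 0" "(\<Sum>v\<in>?rh ` B. u v *s v) = 0"
      using vec.dependent_finite[of "?rh ` B"] B(1) by auto
    obtain d :: int where d: "d > 0" "\<forall>E\<in>B. \<exists>k::int. of_int d * u (?rh E) = of_int k"
      using rat_common_denominator[OF B(1), of "\<lambda>E. u (?rh E)"] by blast
    from d(2) obtain c where c: "\<And>E. E \<in> B \<Longrightarrow> of_int d * u (?rh E) = of_int (c E)" by metis
    obtain t where t: "(\<Sum>E\<in>B. of_int (c E) *\<^sub>R E) = cls t"
        "rat_coords t = (\<Sum>E\<in>B. of_int (c E) *s ?rh E)"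
      using sum_cls[OF B(1,2)] by blast
    have "rat_coords t = (\<Sum>E\<in>B. of_int d *s (u (?rh E) *s ?rh E))"
      unfolding t(2) by (rule sum.cong) (simp_all add: c[symmetric] vec.scale_scale)
    also have "\<dots> = of_int d *s (\<Sum>v\<in>?rh ` B. u v *s v)"
      by (simp add: sum.reindex[OF inj] vec.scale_sum_right)
    finally have "t = 0" using u(2) rat_coords_eq_0 by simp
    then have "\<forall>E\<in>B. c E = 0" using B(3) t(1) by (auto simp: int_independent_def cls_zero)
    moreover obtain E where "E \<in> B" "u (?rh E) \<noteq> 0" using u(1) by blast
    ultimately show False using c[of E] d(1) by simp
  qed
  then have "card (?rh ` B) \<le> vec.dim (UNIV :: (rat^(bool \<times> 3)) set)"
    using vec.independent_card_le_dim[of "?rh ` B" UNIV] by simp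
  then show ?thesis by (simp add: card_image[OF inj] vec.dim_UNIV card_cart_basis)
qed

text \<open>The maximum 2 is attained by a pair of classes, and any third class makes the triple
  dependent, necessarily with a nonzero coefficient at the new class.\<close>

lemma picard_number_2:
  assumes "picard_number \<Lambda> = 2"
  obtains t u where "t \<in> NS6" "u \<in> NS6" "\<And>k l. smul6 k t + smul6 l u = 0 \<Longrightarrow> k = 0 \<and> l = 0"
    "\<And>z. z \<in> NS6 \<Longrightarrow> \<exists>m i j. m \<noteq> 0 \<and> smul6 m z = smul6 i t + smul6 j u"
proof -
  define R where "R = {card B | B. B \<subseteq> NS \<Lambda> \<and> finite B \<and> int_independent B}"
  have sub: "NS \<Lambda> \<subseteq> H2 \<Lambda>" by (auto simp: NS_eq)
  have "R \<subseteq> {..CARD(bool \<times> 3)}" using int_independent_card sub by (auto simp: R_def)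
  then have fin: "finite R" by (rule finite_subset) simp
  have "0 \<in> R" unfolding R_def by (auto intro!: exI[of _ "{}"] simp: int_independent_def)
  have max: "Max R = 2" using assms by (simp add: picard_number_def group_rank_def R_def)
  have "2 \<in> R" using Max_in[OF fin] \<open>0 \<in> R\<close> max by auto
  then obtain B where B: "B \<subseteq> NS \<Lambda>" "card B = 2" "int_independent B" by (auto simp: R_def)
  then obtain E F where EF: "B = {E, F}" "E \<noteq> F" by (auto simp: card_2_iff)
  obtain t u where tu: "t \<in> NS6" "u \<in> NS6" "E = cls t" "F = cls u" using B(1) EF unfolding NS_cls by auto
  have indep: "k = 0 \<and> l = 0" if "smul6 k t + smul6 l u = 0" for k l
  proof -
    have "cls (smul6 k t + smul6 l u) = 0" using that cls_zero by simp
    then have "of_int k *\<^sub>R E + of_int l *\<^sub>R F = 0" by (simp add: cls_add cls_smul tu)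
    then have "(\<Sum>x\<in>B. of_int ((\<lambda>x. if x = E then k else l) x) *\<^sub>R x) = 0" using EF by simp
    then have "\<forall>x\<in>B. (\<lambda>x. if x = E then k else l) x = 0"
      using B(3)[unfolded int_independent_def, rule_format, of "\<lambda>x. if x = E then k else l"] by blast
    then show ?thesis using EF by auto
  qed
  have "\<exists>m i j. m \<noteq> 0 \<and> smul6 m z = smul6 i t + smul6 j u" if z: "z \<in> NS6" for z
  proof (cases "z = t \<or> z = u")
    case True
    then show ?thesis
    proof
      assume "z = t" then show ?thesis
        by (intro exI[of _ 1] exI[of _ 1] exI[of _ 0]) (cases t, cases u, simp)
    next
      assume "z = u" then show ?thesis
        by (intro exI[of _ 1] exI[of _ 0] exI[of _ 1]) (cases t, cases u, simp)
    qed
  next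
    case False
    let ?C = "{cls z, E, F}"
    have ne: "cls z \<noteq> E" "cls z \<noteq> F" using False by (simp_all add: tu cls_inj)
    have "?C \<subseteq> NS \<Lambda>" using z tu by (auto simp: NS_cls)
    moreover have "3 \<notin> R" using Max_ge[OF fin, of 3] max by auto
    moreover have "card ?C = 3" using ne EF(2) by simp
    ultimately have "\<not> int_independent ?C" unfolding R_def by force
    then obtain c where c: "(\<Sum>x\<in>?C. of_int (c x) *\<^sub>R x) = 0" "\<exists>x\<in>?C. c x \<noteq> 0"
      unfolding int_independent_def by blast
    have "cls (smul6 (c (cls z)) z + (smul6 (c E) t + smul6 (c F) u)) = 0"
      using c(1) ne EF(2) by (simp add: cls_add cls_smul tu)
    then have s0: "smul6 (c (cls z)) z + (smul6 (c E) t + smul6 (c F) u) = 0"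
      using cls_inj[of _ 0] cls_zero by metis
    have "c (cls z) \<noteq> 0"
    proof
      assume c0: "c (cls z) = 0"
      then have "smul6 (c E) t + smul6 (c F) u = 0" using s0 smul6_eq_0[of 0 z] by simp
      from indep[OF this] c(2) c0 show False by auto
    qed
    moreover have "smul6 (c (cls z)) z = smul6 (- c E) t + smul6 (- c F) u"
      using s0 by (simp add: smul6_minus eq_neg_iff_add_eq_0 algebra_simps)
    ultimately show ?thesis by blast
  qed
  with tu indep that show ?thesis by blast
qed

end

section \<open>Saturated sublattices of rank 2 in \<open>U\<^sup>3\<close>\<close>

definition isometry6 :: "(int6 \<Rightarrow> int6) \<Rightarrow> bool" where
  "isometry6 \<phi> \<longleftrightarrow> bij \<phi> \<and> (\<forall>t u. \<phi> (t + u) = \<phi> t + \<phi> u) \<and> (\<forall>k t. \<phi> (smul6 k t) = smul6 k (\<phi> t))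
     \<and> (\<forall>t u. pair6 (\<phi> t) (\<phi> u) = pair6 t u)"

lemma isometry6I:
  assumes "\<And>t. \<psi> (\<phi> t) = t" "\<And>t. \<phi> (\<psi> t) = t"
    "\<And>t u. \<phi> (t + u) = \<phi> t + \<phi> u" "\<And>k t. \<phi> (smul6 k t) = smul6 k (\<phi> t)"
    "\<And>t u. pair6 (\<phi> t) (\<phi> u) = pair6 t u"
  shows "isometry6 \<phi>"
proof -
  have "bij \<phi>" by (rule o_bij[of \<psi>]) (rule ext, simp only: comp_def id_def assms(1,2))+
  then show ?thesis unfolding isometry6_def by (intro conjI allI assms)
qed

lemma isometry6_comp: "isometry6 \<phi> \<Longrightarrow> isometry6 \<psi> \<Longrightarrow> isometry6 (\<lambda>t. \<psi> (\<phi> t))"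
  unfolding isometry6_def using bij_comp[of \<phi> \<psi>] by (simp add: comp_def)

lemma isometry6_id: "isometry6 (\<lambda>t. t)"
  unfolding isometry6_def by (simp add: bij_id[unfolded id_def])

definition primitive6 :: "int6 \<Rightarrow> bool" where
  "primitive6 t \<longleftrightarrow> (\<forall>k u. t = smul6 k u \<longrightarrow> is_unit k)"

lemma primitive6_isometry:
  assumes \<phi>: "isometry6 \<phi>" and t: "primitive6 t"
  shows "primitive6 (\<phi> t)"
  unfolding primitive6_def
proof (intro allI impI)
  fix k u assume u: "\<phi> t = smul6 k u"
  have b: "bij \<phi>" using \<phi> by (simp add: isometry6_def)
  obtain v where "u = \<phi> v" using b by (metis bij_pointE)
  then have "\<phi> t = \<phi> (smul6 k v)" using u \<phi> by (simp add: isometry6_def)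
  then have "t = smul6 k v" using b by (meson bij_is_inj injD)
  then show "is_unit k" using t unfolding primitive6_def by blast
qed

lemma primitive6_exists:
  assumes "t \<noteq> 0"
  obtains g u where "t = smul6 g u" "primitive6 u" "g \<noteq> 0"
proof -
  obtain x y p q r s where t: "t = (x, y, p, q, r, s)" by (cases t)
  define g where "g = Gcd {x, y, p, q, r, s}"
  have dv: "g dvd x" "g dvd y" "g dvd p" "g dvd q" "g dvd r" "g dvd s" unfolding g_def by (rule Gcd_dvd, simp)+
  have g0: "g \<noteq> 0" using assms by (auto simp: g_def t zero_prod_def)
  define u where "u = (x div g, y div g, p div g, q div g, r div g, s div g)"
  have tu: "t = smul6 g u" using dv by (simp add: t u_def)
  have "is_unit k" if "u = smul6 k v" for k v
  proof -
    have "t = smul6 (g * k) v" using tu that by (simp add: smul6_assoc)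
    then have "g * k dvd c" if "c \<in> {x, y, p, q, r, s}" for c using that t by (cases v) auto
    then have "g * k dvd g" using Gcd_greatest[of "{x, y, p, q, r, s}" "g * k"] unfolding g_def by blast
    then show ?thesis using g0 by simp
  qed
  then have "primitive6 u" by (simp add: primitive6_def)
  with tu g0 that show ?thesis by blast
qed

text \<open>On the last four coordinates, read as a 2 by 2 matrix, row and column operations of
  determinant 1 are isometries. Because the first hyperbolic plane stays fixed pointwise, a vector
  already normalized there survives them.\<close>

definition reachable6 :: "int6 \<Rightarrow> int6 \<Rightarrow> bool" where
  "reachable6 v w \<longleftrightarrow> (\<exists>\<phi>. isometry6 \<phi> \<and> (\<forall>x y. \<phi> (x, y, 0, 0, 0, 0) = (x, y, 0, 0, 0, 0)) \<and> \<phi> v = w)"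

lemma reachable6E:
  assumes "reachable6 v w"
  obtains \<phi> where "isometry6 \<phi>" "\<forall>x y. \<phi> (x, y, 0, 0, 0, 0) = (x, y, 0, 0, 0, 0)" "\<phi> v = w"
  using assms unfolding reachable6_def by (elim exE conjE) (rule that)

lemma reachable6_refl: "reachable6 v v"
  unfolding reachable6_def using isometry6_id by blast

lemma reachable6_trans: "reachable6 u v \<Longrightarrow> reachable6 v w \<Longrightarrow> reachable6 u w"
  unfolding reachable6_def
proof (elim exE conjE)
  fix \<phi> \<psi> assume "isometry6 \<phi>" "\<forall>x y. \<phi> (x, y, 0, 0, 0, 0) = (x, y, 0, 0, 0, 0)" "\<phi> u = v"
    "isometry6 \<psi>" "\<forall>x y. \<psi> (x, y, 0, 0, 0, 0) = (x, y, 0, 0, 0, 0)" "\<psi> v = w"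
  then have "isometry6 (\<lambda>t. \<psi> (\<phi> t)) \<and> (\<forall>x y. \<psi> (\<phi> (x, y, 0, 0, 0, 0)) = (x, y, 0, 0, 0, 0)) \<and> \<psi> (\<phi> u) = w"
    by (simp add: isometry6_comp)
  then show "\<exists>\<phi>. isometry6 \<phi> \<and> (\<forall>x y. \<phi> (x, y, 0, 0, 0, 0) = (x, y, 0, 0, 0, 0)) \<and> \<phi> u = w"
    by (rule exI[of _ "\<lambda>t. \<psi> (\<phi> t)"])
qed

lemma reachable6_row: "reachable6 (x, y, p, q, r, s) (x, y, p + k * r, q + k * s, r, s)"
  unfolding reachable6_def
proof (intro exI[of _ "\<lambda>(x, y, p, q, r, s). (x, y, p + k * r, q + k * s, r, s)"] conjI)
  show "isometry6 (\<lambda>(x, y, p, q, r, s). (x, y, p + k * r, q + k * s, r, s))"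
    by (rule isometry6I[of "\<lambda>(x, y, p, q, r, s). (x, y, p - k * r, q - k * s, r, s)"])
       (simp_all only: split_paired_all, simp_all add: algebra_simps)
qed simp_all

lemma reachable6_col: "reachable6 (x, y, p, q, r, s) (x, y, p, q + k * p, r, s + k * r)"
  unfolding reachable6_def
proof (intro exI[of _ "\<lambda>(x, y, p, q, r, s). (x, y, p, q + k * p, r, s + k * r)"] conjI)
  show "isometry6 (\<lambda>(x, y, p, q, r, s). (x, y, p, q + k * p, r, s + k * r))"
    by (rule isometry6I[of "\<lambda>(x, y, p, q, r, s). (x, y, p, q - k * p, r, s - k * r)"])
       (simp_all only: split_paired_all, simp_all add: algebra_simps)
qed simp_all

lemma reachable6_row': "reachable6 (x, y, p, q, r, s) (x, y, p, q, r + k * p, s + k * q)"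
  unfolding reachable6_def
proof (intro exI[of _ "\<lambda>(x, y, p, q, r, s). (x, y, p, q, r + k * p, s + k * q)"] conjI)
  show "isometry6 (\<lambda>(x, y, p, q, r, s). (x, y, p, q, r + k * p, s + k * q))"
    by (rule isometry6I[of "\<lambda>(x, y, p, q, r, s). (x, y, p, q, r - k * p, s - k * q)"])
       (simp_all only: split_paired_all, simp_all add: algebra_simps)
qed simp_all

lemma reachable6_swap_cols: "reachable6 (x, y, p, q, r, s) (x, y, q, - p, s, - r)"
  unfolding reachable6_def
proof (intro exI[of _ "\<lambda>(x, y, p, q, r, s). (x, y, q, - p, s, - r)"] conjI)
  show "isometry6 (\<lambda>(x, y, p, q, r, s). (x, y, q, - p, s, - r))"
    by (rule isometry6I[of "\<lambda>(x, y, p, q, r, s). (x, y, - q, p, - s, r)"])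
       (simp_all only: split_paired_all, simp_all add: algebra_simps)
qed simp_all

lemma reachable6_swap_rows: "reachable6 (x, y, p, q, r, s) (x, y, r, s, - p, - q)"
  unfolding reachable6_def
proof (intro exI[of _ "\<lambda>(x, y, p, q, r, s). (x, y, r, s, - p, - q)"] conjI)
  show "isometry6 (\<lambda>(x, y, p, q, r, s). (x, y, r, s, - p, - q))"
    by (rule isometry6I[of "\<lambda>(x, y, p, q, r, s). (x, y, - r, - s, p, q)"])
       (simp_all only: split_paired_all, simp_all add: algebra_simps)
qed simp_all

text \<open>Euclid's algorithm on the corner entry \<open>p\<close>: an entry not divisible by
  \<open>p\<close> yields, through its remainder and a swap, a nonzero corner of smaller absolute
  value.\<close>

lemma reachable6_smith_nonzero:
  assumes "p \<noteq> 0"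
  shows "\<exists>d e. reachable6 (x, y, p, q, r, s) (x, y, d, 0, 0, e) \<and> d dvd e"
  using assms
proof (induction "nat \<bar>p\<bar>" arbitrary: p q r s rule: less_induct)
  case less
  have smaller: "nat \<bar>q mod p\<bar> < nat \<bar>p\<bar>" for q
    using abs_mod_less[OF less.prems, of q] by simp
  have col: ?case if r: "reachable6 (x, y, p, q, r, s) (x, y, p, q', r', s')" and n: "\<not> p dvd q'" for q' r' s'
  proof -
    have "reachable6 (x, y, p, q', r', s') (x, y, p, q' mod p, r', s' + (- (q' div p)) * r')"
      using reachable6_col[of x y p q' r' s' "- (q' div p)"] by (simp add: minus_div_mult_eq_mod[symmetric])
    moreover have "reachable6 (x, y, p, q' mod p, r', s' + (- (q' div p)) * r') (x, y, q' mod p, - p, s' + (- (q' div p)) * r', - r')"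
      by (rule reachable6_swap_cols)
    moreover have "q' mod p \<noteq> 0" using n by (simp add: dvd_eq_mod_eq_0)
    ultimately show ?thesis using less.hyps[OF smaller[of q']] r by (meson reachable6_trans)
  qed
  show ?case
  proof (cases "p dvd q \<and> p dvd r")
    case False
    then consider "\<not> p dvd q" | "\<not> p dvd r" by blast
    then show ?thesis
    proof cases
      case 1
      then show ?thesis by (rule col[OF reachable6_refl])
    next
      case 2
      have "reachable6 (x, y, p, q, r, s) (x, y, p, q, r mod p, s + (- (r div p)) * q)"
        using reachable6_row'[of x y p q r s "- (r div p)"] by (simp add: minus_div_mult_eq_mod[symmetric])
      moreover have "reachable6 (x, y, p, q, r mod p, s + (- (r div p)) * q) (x, y, r mod p, s + (- (r div p)) * q, - p, - q)"
        by (rule reachable6_swap_rows)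
      moreover have "r mod p \<noteq> 0" using 2 by (simp add: dvd_eq_mod_eq_0)
      ultimately show ?thesis using less.hyps[OF smaller[of r]] by (meson reachable6_trans)
    qed
  next
    case True
    then obtain i j where ij: "q = p * i" "r = p * j" by (auto elim!: dvdE)
    define e where "e = s - i * r"
    have "reachable6 (x, y, p, q, r, s) (x, y, p, 0, r, e)"
      using reachable6_col[of x y p q r s "- i"] by (simp add: ij e_def algebra_simps)
    moreover have "reachable6 (x, y, p, 0, r, e) (x, y, p, 0, 0, e)"
      using reachable6_row'[of x y p 0 r e "- j"] by (simp add: ij algebra_simps)
    ultimately have diag: "reachable6 (x, y, p, q, r, s) (x, y, p, 0, 0, e)" by (rule reachable6_trans)
    show ?thesis
    proof (cases "p dvd e")
      case True
      with diag show ?thesis by blast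
    next
      case False
      \<comment> \<open>Adding the second row to the first brings \<open>e\<close> next to
        \<open>p\<close>, where \<open>col\<close> takes over.\<close>
      have "reachable6 (x, y, p, 0, 0, e) (x, y, p, e, 0, e)"
        using reachable6_row[of x y p 0 0 e 1] by simp
      from col[OF reachable6_trans[OF diag this] False] show ?thesis .
    qed
  qed
qed

lemma reachable6_smith: "\<exists>d e. reachable6 (x, y, p, q, r, s) (x, y, d, 0, 0, e) \<and> d dvd e"
proof -
  consider "p \<noteq> 0" | "q \<noteq> 0" | "r \<noteq> 0" | "p = 0" "q = 0" "r = 0" "s \<noteq> 0" | "p = 0" "q = 0" "r = 0" "s = 0"
    by blast
  then show ?thesis
  proof cases
    case 2
    then show ?thesis using reachable6_smith_nonzero reachable6_trans[OF reachable6_swap_cols] by meson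
  next
    case 3
    then show ?thesis using reachable6_smith_nonzero reachable6_trans[OF reachable6_swap_rows] by meson
  next
    case 4
    have "reachable6 (x, y, p, q, r, s) (x, y, 0, s, 0, s)" using 4 reachable6_row[of x y p q r s 1] by simp
    moreover have "reachable6 (x, y, 0, s, 0, s) (x, y, s, 0, s, 0)" using reachable6_swap_cols[of x y 0 s 0 s] by simp
    ultimately show ?thesis using reachable6_smith_nonzero[OF 4(4)] by (meson reachable6_trans)
  next
    case 5
    then show ?thesis using reachable6_refl by (intro exI[of _ 0]) auto
  qed (rule reachable6_smith_nonzero)
qed

text \<open>Isometries preserve primitivity, so the first elementary divisor \<open>d\<close> is a
  unit. Coprimality concerns only the four matrix entries; hence the reduction is done with the
  first plane set to 0 and carried over by additivity.\<close>

lemma reachable6_unit_smith: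
  assumes "\<And>k. k dvd p \<Longrightarrow> k dvd q \<Longrightarrow> k dvd r \<Longrightarrow> k dvd s \<Longrightarrow> is_unit k"
  shows "\<exists>e. reachable6 (x, y, p, q, r, s) (x, y, 1, 0, 0, e)"
proof -
  obtain d e where de: "reachable6 (0, 0, p, q, r, s) (0, 0, d, 0, 0, e)" "d dvd e" using reachable6_smith by blast
  then obtain \<phi> where \<phi>: "isometry6 \<phi>" "\<forall>x y. \<phi> (x, y, 0, 0, 0, 0) = (x, y, 0, 0, 0, 0)" "\<phi> (0, 0, p, q, r, s) = (0, 0, d, 0, 0, e)"
    unfolding reachable6_def by blast
  have "primitive6 (0, 0, p, q, r, s)"
    unfolding primitive6_def using assms by auto
  then have "primitive6 (0, 0, d, 0, 0, e)" using primitive6_isometry[OF \<phi>(1)] \<phi>(3) by metis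
  moreover obtain f where "e = d * f" using de(2) by (elim dvdE)
  then have "(0, 0, d, 0, 0, e) = smul6 d (0, 0, 1, 0, 0, f)" by simp
  ultimately have "is_unit d" unfolding primitive6_def by blast
  then have d: "d = 1 \<or> d = -1" by auto
  have "\<phi> (x, y, p, q, r, s) = \<phi> ((x, y, 0, 0, 0, 0) + (0, 0, p, q, r, s))" by simp
  also have "\<dots> = (x, y, d, 0, 0, e)"
    using \<phi> unfolding isometry6_def by (simp del: add_Pair) simp
  finally have 1: "reachable6 (x, y, p, q, r, s) (x, y, d, 0, 0, e)" unfolding reachable6_def using \<phi> by blast
  \<comment> \<open>Two column swaps change the sign of the matrix, which settles
    \<open>d = -1\<close>.\<close>
  have "reachable6 (x, y, d, 0, 0, e) (x, y, 0, - d, e, 0)" using reachable6_swap_cols[of x y d 0 0 e] by simp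
  moreover have "reachable6 (x, y, 0, - d, e, 0) (x, y, - d, 0, 0, - e)" using reachable6_swap_cols[of x y 0 "- d" e 0] by simp
  ultimately have "reachable6 (x, y, p, q, r, s) (x, y, - d, 0, 0, - e)" using 1 by (meson reachable6_trans)
  with 1 d show ?thesis by auto
qed

section \<open>Splitting \<open>U^3\<close> along a saturated sublattice of rank two\<close>

definition admissible6 :: "int6 set \<Rightarrow> bool" where
  "admissible6 S \<longleftrightarrow> (\<forall>t\<in>S. \<forall>u\<in>S. t + u \<in> S) \<and> (\<forall>k t. smul6 k t \<in> S \<longleftrightarrow> k = 0 \<or> t \<in> S)
     \<and> (\<exists>t\<in>S. \<exists>u\<in>S. (\<forall>k l. smul6 k t + smul6 l u = 0 \<longrightarrow> k = 0 \<and> l = 0)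
          \<and> (\<forall>z\<in>S. \<exists>m i j. m \<noteq> 0 \<and> smul6 m z = smul6 i t + smul6 j u))"

text \<open>\<open>e1, e2\<close> is an isotropic pair dual to \<open>n1, n2\<close>, and
  \<open>g, h\<close> span a hyperbolic plane orthogonal to all four. In such a frame the orthogonal
  complement of \<open>n1, n2\<close> is visible: it is spanned by \<open>g\<close>,
  \<open>h\<close> and by \<open>n1, n2\<close> corrected along \<open>e1, e2\<close>.\<close>

definition gram6 :: "int6 \<Rightarrow> int6 \<Rightarrow> int6 \<Rightarrow> int6 \<Rightarrow> int6 \<Rightarrow> int6 \<Rightarrow> bool" where
  "gram6 n1 n2 e1 e2 g h \<longleftrightarrow>
     pair6 e1 e1 = 0 \<and> pair6 e2 e2 = 0 \<and> pair6 e1 e2 = 0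
     \<and> pair6 e1 n1 = 1 \<and> pair6 e1 n2 = 0 \<and> pair6 e2 n1 = 0 \<and> pair6 e2 n2 = 1
     \<and> pair6 g g = 0 \<and> pair6 h h = 0 \<and> pair6 g h = 1
     \<and> pair6 g n1 = 0 \<and> pair6 g n2 = 0 \<and> pair6 g e1 = 0 \<and> pair6 g e2 = 0
     \<and> pair6 h n1 = 0 \<and> pair6 h n2 = 0 \<and> pair6 h e1 = 0 \<and> pair6 h e2 = 0"

definition gen6 :: "int6 \<Rightarrow> int6 \<Rightarrow> int6 \<Rightarrow> int6 \<Rightarrow> int6 \<Rightarrow> int6 \<Rightarrow> bool" where
  "gen6 n1 n2 e1 e2 g h \<longleftrightarrow> (\<forall>t. \<exists>x1 x2 y1 y2 u v.
     t = smul6 x1 e1 + smul6 x2 e2 + smul6 y1 n1 + smul6 y2 n2 + smul6 u g + smul6 v h)"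

definition split6 :: "int6 set \<Rightarrow> bool" where
  "split6 S \<longleftrightarrow> (\<exists>n1 n2 e1 e2 g h. S = {smul6 i n1 + smul6 j n2 | i j. True}
     \<and> gram6 n1 n2 e1 e2 g h \<and> gen6 n1 n2 e1 e2 g h)"

lemma admissible6_rank:
  assumes "admissible6 S"
  obtains t u where "t \<in> S" "u \<in> S" "\<And>k l. smul6 k t + smul6 l u = 0 \<Longrightarrow> k = 0 \<and> l = 0"
    "\<And>z. z \<in> S \<Longrightarrow> \<exists>m i j. m \<noteq> 0 \<and> smul6 m z = smul6 i t + smul6 j u"
proof -
  from assms have "\<exists>t\<in>S. \<exists>u\<in>S. (\<forall>k l. smul6 k t + smul6 l u = 0 \<longrightarrow> k = 0 \<and> l = 0)
          \<and> (\<forall>z\<in>S. \<exists>m i j. m \<noteq> 0 \<and> smul6 m z = smul6 i t + smul6 j u)"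
    unfolding admissible6_def by (elim conjE)
  then obtain t where t: "t \<in> S" "\<exists>u\<in>S. (\<forall>k l. smul6 k t + smul6 l u = 0 \<longrightarrow> k = 0 \<and> l = 0)
          \<and> (\<forall>z\<in>S. \<exists>m i j. m \<noteq> 0 \<and> smul6 m z = smul6 i t + smul6 j u)"
    by (rule bexE)
  from t(2) obtain u where u: "u \<in> S" "(\<forall>k l. smul6 k t + smul6 l u = 0 \<longrightarrow> k = 0 \<and> l = 0)
          \<and> (\<forall>z\<in>S. \<exists>m i j. m \<noteq> 0 \<and> smul6 m z = smul6 i t + smul6 j u)"
    by (rule bexE)
  show thesis
    using that[OF t(1) u(1)] u(2) by simp
qed

lemma admissible6_isometry:
  assumes \<phi>: "isometry6 \<phi>" and S: "admissible6 S"
  shows "admissible6 (\<phi> ` S)"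
proof -
  have b: "bij \<phi>" and add: "\<And>t u. \<phi> (t + u) = \<phi> t + \<phi> u" and sm: "\<And>k t. \<phi> (smul6 k t) = smul6 k (\<phi> t)"
    using \<phi> by (simp_all add: isometry6_def)
  have mem: "\<phi> t \<in> \<phi> ` S \<longleftrightarrow> t \<in> S" for t using b by (simp add: bij_is_inj inj_image_mem_iff)
  have z: "\<phi> t = 0 \<longleftrightarrow> t = 0" for t
  proof -
    have "\<phi> 0 = 0" using add[of 0 0] by simp
    then show ?thesis using b by (metis bij_is_inj injD)
  qed
  have eq: "\<phi> t = \<phi> u \<longleftrightarrow> t = u" for t u using b by (meson bij_is_inj injD)
  have sur: "\<exists>u. t = \<phi> u" for t using b by (metis bij_pointE)
  obtain t u where tu: "t \<in> S" "u \<in> S" "\<And>k l. smul6 k t + smul6 l u = 0 \<Longrightarrow> k = 0 \<and> l = 0"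
    "\<And>z. z \<in> S \<Longrightarrow> \<exists>m i j. m \<noteq> 0 \<and> smul6 m z = smul6 i t + smul6 j u"
    by (rule admissible6_rank[OF S]) (rule that, assumption+)
  have "smul6 k t \<in> S \<longleftrightarrow> k = 0 \<or> t \<in> S" for k t using S by (simp add: admissible6_def)
  then have 1: "smul6 k w \<in> \<phi> ` S \<longleftrightarrow> k = 0 \<or> w \<in> \<phi> ` S" for k w
    using sur[of w] by (metis sm mem)
  have "v + w \<in> S" if "v \<in> S" "w \<in> S" for v w using S that by (simp add: admissible6_def)
  then have 2: "v + w \<in> \<phi> ` S" if "v \<in> \<phi> ` S" "w \<in> \<phi> ` S" for v w
    using that sur[of v] sur[of w] by (metis add mem)
  have 3: "k = 0 \<and> l = 0" if "smul6 k (\<phi> t) + smul6 l (\<phi> u) = 0" for k l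
    using that tu(3)[of k l] unfolding sm[symmetric] add[symmetric] z by blast
  have 4: "\<exists>m i j. m \<noteq> 0 \<and> smul6 m w = smul6 i (\<phi> t) + smul6 j (\<phi> u)" if "w \<in> \<phi> ` S" for w
  proof -
    from that obtain v where "v \<in> S" "w = \<phi> v" by blast
    with tu(4)[of v] show ?thesis unfolding \<open>w = \<phi> v\<close> sm[symmetric] add[symmetric] eq by blast
  qed
  have "\<phi> t \<in> \<phi> ` S" "\<phi> u \<in> \<phi> ` S" using tu(1,2) by blast+
  then show ?thesis unfolding admissible6_def
    by (intro conjI ballI allI bexI[of _ "\<phi> t"] bexI[of _ "\<phi> u"] impI 1 2 4)
       (use 3 in blast)+
qed

lemma split6_isometry:
  assumes \<phi>: "isometry6 \<phi>" and S: "split6 (\<phi> ` S)"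
  shows "split6 S"
proof -
  have b: "bij \<phi>" and add: "\<And>t u. \<phi> (t + u) = \<phi> t + \<phi> u" and sm: "\<And>k t. \<phi> (smul6 k t) = smul6 k (\<phi> t)"
    and pr: "\<And>t u. pair6 (\<phi> t) (\<phi> u) = pair6 t u"
    using \<phi> by (simp_all add: isometry6_def)
  have mem: "\<phi> t \<in> \<phi> ` S \<longleftrightarrow> t \<in> S" for t using b by (simp add: bij_is_inj inj_image_mem_iff)
  have eq: "\<phi> t = \<phi> u \<longleftrightarrow> t = u" for t u using b by (meson bij_is_inj injD)
  have sur: "\<exists>u. t = \<phi> u" for t using b by (metis bij_pointE)
  obtain n1 n2 e1 e2 g h where S1: "\<phi> ` S = {smul6 i n1 + smul6 j n2 | i j. True}"
    and gram: "gram6 n1 n2 e1 e2 g h" and gen: "gen6 n1 n2 e1 e2 g h"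
    using S unfolding split6_def by blast
  obtain n1' n2' e1' e2' g' h' where v: "n1 = \<phi> n1'" "n2 = \<phi> n2'" "e1 = \<phi> e1'" "e2 = \<phi> e2'" "g = \<phi> g'" "h = \<phi> h'"
    using sur by metis
  have S': "S = {smul6 i n1' + smul6 j n2' | i j. True}"
  proof (rule Set.set_eqI)
    fix t
    have "t \<in> S \<longleftrightarrow> (\<exists>i j. \<phi> t = smul6 i n1 + smul6 j n2)" unfolding mem[of t, symmetric] S1 by blast
    also have "\<dots> \<longleftrightarrow> (\<exists>i j. t = smul6 i n1' + smul6 j n2')"
      unfolding v sm[symmetric] add[symmetric] eq ..
    finally show "t \<in> S \<longleftrightarrow> t \<in> {smul6 i n1' + smul6 j n2' | i j. True}" by simp
  qed
  have "gen6 n1' n2' e1' e2' g' h'"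
    using gen unfolding gen6_def v sm[symmetric] add[symmetric]
    by (intro allI) (metis eq)
  moreover have "gram6 n1' n2' e1' e2' g' h'"
    using gram unfolding gram6_def v pr .
  ultimately show ?thesis using S' unfolding split6_def by blast
qed

lemma admissible6_primitive:
  assumes "admissible6 S"
  obtains t where "t \<in> S" "primitive6 t"
proof -
  obtain t u where t: "t \<in> S" "\<And>k l. smul6 k t + smul6 l u = 0 \<Longrightarrow> k = 0 \<and> l = 0"
    using admissible6_rank[OF assms] by metis
  have "t \<noteq> 0"
  proof
    assume "t = 0"
    then have "smul6 1 t + smul6 0 u = 0" by (simp add: smul6_0 smul6_one)
    then show False using t(2)[of 1 0] by simp
  qed
  then obtain g v where "t = smul6 g v" "primitive6 v" "g \<noteq> 0" by (rule primitive6_exists)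
  moreover from this have "v \<in> S" using t(1) assms by (simp add: admissible6_def)
  ultimately show ?thesis using that by blast
qed

text \<open>The three hyperbolic planes of \<open>U\<^sup>3\<close> may be permuted.\<close>

lemma isometry6_perm1: "isometry6 (\<lambda>(x, y, p, q, r, s). (q, - r, p, x, - y, s))"
  by (rule isometry6I[of "\<lambda>(x, y, p, q, r, s). (q, - r, p, x, - y, s)"])
     (simp_all only: split_paired_all, simp_all add: algebra_simps)

lemma isometry6_perm2: "isometry6 (\<lambda>(x, y, p, q, r, s). (p, s, x, q, r, y))"
  by (rule isometry6I[of "\<lambda>(x, y, p, q, r, s). (p, s, x, q, r, y)"])
     (simp_all only: split_paired_all, simp_all add: algebra_simps)

text \<open>The Eichler transvection along the isotropic vector \<open>(0,0,0,1,0,0)\<close> with the vector \<open>(1,-a,0,0,0,0)\<close>.\<close>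

lemma isometry6_eichler: "isometry6 (\<lambda>(x, y, p, q, r, s). (x - r, y + a * r, p, q - y + a * x - a * r, r, s))"
  by (rule isometry6I[of "\<lambda>(x, y, p, q, r, s). (x + r, y - a * r, p, q + y - a * x - a * r, r, s)"])
     (simp_all only: split_paired_all, simp_all add: algebra_simps)

text \<open>A first Smith reduction clears \<open>q\<close> and \<open>r\<close>; exchanging this
  freed plane with \<open>x, y\<close> puts all remaining entries into the matrix, where they are
  coprime as a whole. A second reduction then produces the entry 1.\<close>

lemma primitive6_normal_form:
  assumes "primitive6 t"
  shows "\<exists>\<phi> a. isometry6 \<phi> \<and> \<phi> t = (1, a, 0, 0, 0, 0)"
proof -
  obtain x y p q r s where t: "t = (x, y, p, q, r, s)" by (cases t)
  obtain d e where "reachable6 t (x, y, d, 0, 0, e)" using reachable6_smith unfolding t by blast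
  then obtain \<phi>1 where 1: "isometry6 \<phi>1" "\<phi>1 t = (x, y, d, 0, 0, e)" unfolding reachable6_def by blast
  define \<phi>2 where "\<phi>2 = (\<lambda>t. (\<lambda>(x, y, p, q, r, s). (q, - r, p, x, - y, s)) (\<phi>1 t))"
  have 2: "isometry6 \<phi>2" "\<phi>2 t = (0, 0, d, x, - y, e)"
    unfolding \<phi>2_def using 1(2) by (auto intro: isometry6_comp[OF 1(1) isometry6_perm1])
  have prim: "primitive6 (0, 0, d, x, - y, e)" using primitive6_isometry[OF 2(1) assms] 2(2) by metis
  have "is_unit k" if "k dvd d" "k dvd x" "k dvd - y" "k dvd e" for k
  proof -
    have "(0, 0, d, x, - y, e) = smul6 k (0, 0, d div k, x div k, - y div k, e div k)" using that by simp
    then show ?thesis using prim unfolding primitive6_def by blast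
  qed
  then obtain a where "reachable6 (0, 0, d, x, - y, e) (0, 0, 1, 0, 0, a)" using reachable6_unit_smith by blast
  then obtain \<phi>3 where 3: "isometry6 \<phi>3" "\<phi>3 (0, 0, d, x, - y, e) = (0, 0, 1, 0, 0, a)" unfolding reachable6_def by blast
  have "isometry6 (\<lambda>t. (\<lambda>(x, y, p, q, r, s). (p, s, x, q, r, y)) (\<phi>3 (\<phi>2 t)))"
    by (intro isometry6_comp[OF isometry6_comp[OF 2(1) 3(1)] isometry6_perm2])
  moreover have "(\<lambda>(x, y, p, q, r, s). (p, s, x, q, r, y)) (\<phi>3 (\<phi>2 t)) = (1, a, 0, 0, 0, 0)"
    by (simp add: 2(2) 3(2))
  ultimately show ?thesis by blast
qed

text \<open>Subtracting multiples of \<open>(1, a, 0, 0, 0, 0)\<close> projects \<open>S\<close>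
  onto its vectors of first coordinate 0. These form a saturated group of rank one, hence are the
  multiples of one primitive vector.\<close>

lemma admissible6_second_vector:
  assumes S: "admissible6 S" and n1: "(1, a, 0, 0, 0, 0) \<in> S"
  obtains B p q r s where "(0, B, p, q, r, s) \<in> S" "primitive6 (0, B, p, q, r, s)"
    "S = {smul6 i (1, a, 0, 0, 0, 0) + smul6 j (0, B, p, q, r, s) | i j. True}"
proof -
  let ?n = "(1, a, 0, 0, 0, 0) :: int6"
  have add: "t + u \<in> S" if "t \<in> S" "u \<in> S" for t u using S that by (simp add: admissible6_def)
  have sat: "smul6 k t \<in> S \<longleftrightarrow> k = 0 \<or> t \<in> S" for k t using S by (simp add: admissible6_def)
  obtain t u where tu: "t \<in> S" "u \<in> S" "\<And>k l. smul6 k t + smul6 l u = 0 \<Longrightarrow> k = 0 \<and> l = 0"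
    "\<And>z. z \<in> S \<Longrightarrow> \<exists>m i j. m \<noteq> 0 \<and> smul6 m z = smul6 i t + smul6 j u"
    by (rule admissible6_rank[OF S]) (rule that, assumption+)
  define red where "red = (\<lambda>v::int6. v + smul6 (- fst v) ?n)"
  have redS: "red v \<in> S" if "v \<in> S" for v
    unfolding red_def using that n1 by (intro add) (simp_all only: sat simp_thms)
  have red0: "fst (red v) = 0" for v unfolding red_def by (cases v) simp
  have red: "v \<in> S \<Longrightarrow> red v \<in> S" "fst (red v) = 0" for v using redS red0 by blast+
  have dec: "v = smul6 (fst v) ?n + red v" for v unfolding red_def by (cases v) simp
  have red_add: "red (v + w) = red v + red w" and red_smul: "red (smul6 k v) = smul6 k (red v)" for v w k
    unfolding red_def by (cases v, cases w, simp add: algebra_simps, cases v, simp add: algebra_simps)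
  have "red t \<noteq> 0 \<or> red u \<noteq> 0"
  proof (rule ccontr)
    assume "\<not> ?thesis"
    then have t: "t = smul6 (fst t) ?n" and u: "u = smul6 (fst u) ?n"
      using dec[of t] dec[of u] by simp_all
    have "smul6 (fst u) t + smul6 (- fst t) u = smul6 (fst u * fst t + - fst t * fst u) ?n"
      using arg_cong[OF t, of "smul6 (fst u)"] arg_cong[OF u, of "smul6 (- fst t)"]
      by (simp only: smul6_assoc smul6_add)
    then have "smul6 (fst u) t + smul6 (- fst t) u = 0" by (simp add: smul6_0 zero_prod_def)
    then have "fst t = 0" using tu(3) by fastforce
    with t have "t = 0" by (metis smul6_0)
    then have "smul6 1 t + smul6 0 u = 0" by (simp add: smul6_0 smul6_one)
    then show False using tu(3)[of 1 0] by simp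
  qed
  then obtain v where v: "v \<in> S" "fst v = 0" "v \<noteq> 0" using red tu(1,2) by blast
  obtain g w where w: "v = smul6 g w" "primitive6 w" "g \<noteq> 0" using primitive6_exists[OF v(3)] .
  have wS: "w \<in> S" using v(1) w(1,3) sat by simp
  have "fst w = 0" using v(2) w(1,3) by (cases w) simp
  then obtain B p q r s where w': "w = (0, B, p, q, r, s)" by (cases w) auto
  have dep: "\<exists>m j. m \<noteq> 0 \<and> smul6 m z = smul6 j w" if z: "z \<in> S" "fst z = 0" for z
  proof -
    \<comment> \<open>Projecting the relation for \<open>?n\<close> gives a dependence between
      \<open>red t\<close> and \<open>red u\<close>; with \<open>i0 \<noteq> 0\<close> it eliminates
      \<open>red t\<close>.\<close>
    have step: "\<exists>c d. c \<noteq> 0 \<and> smul6 c z = smul6 d (red u)"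
      if "z \<in> S" "fst z = 0" "m0 \<noteq> 0" "smul6 m0 ?n = smul6 i0 t + smul6 j0 u" "i0 \<noteq> 0"
        and "\<And>z. z \<in> S \<Longrightarrow> \<exists>m i j. m \<noteq> 0 \<and> smul6 m z = smul6 i t + smul6 j u" for z t u m0 i0 j0
    proof -
      from that(6)[OF that(1)] obtain m i j where m: "m \<noteq> 0" "smul6 m z = smul6 i t + smul6 j u" by blast
      have rz: "red z = z" and rn: "red ?n = 0" using dec[of z] that(2) by (simp_all add: smul6_0 red_def zero_prod_def)
      have 1: "smul6 m z = smul6 i (red t) + smul6 j (red u)"
        using arg_cong[OF m(2), of red] by (simp only: red_add red_smul rz)
      have "0 = smul6 i0 (red t) + smul6 j0 (red u)"
        using arg_cong[OF that(4), of red] by (simp only: red_add red_smul rn) (metis smul6_eq_0)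
      then have 2: "smul6 i0 (red t) = smul6 (- j0) (red u)"
        by (simp add: smul6_minus eq_neg_iff_add_eq_0)
      have "smul6 (i0 * m) z = smul6 i (smul6 i0 (red t)) + smul6 (i0 * j) (red u)"
        using arg_cong[OF 1, of "smul6 i0"] by (simp add: smul6_add smul6_assoc mult.commute)
      also have "\<dots> = smul6 (i * - j0 + i0 * j) (red u)"
        unfolding 2 by (simp only: smul6_add smul6_assoc)
      also have "i * - j0 + i0 * j = i0 * j - i * j0" by simp
      finally show ?thesis using m(1) that(5) by (intro exI[of _ "i0 * m"] exI[of _ "i0 * j - i * j0"]) simp
    qed
    obtain m0 i0 j0 where m0: "m0 \<noteq> 0" "smul6 m0 ?n = smul6 i0 t + smul6 j0 u" using tu(4)[OF n1] by blast
    have "i0 \<noteq> 0 \<or> j0 \<noteq> 0"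
    proof (rule ccontr)
      assume "\<not> ?thesis"
      then have "i0 = 0" "j0 = 0" by auto
      then have "smul6 m0 ?n = 0" unfolding m0(2) by (simp only: smul6_0) simp
      then show False using m0(1) by (simp add: zero_prod_def)
    qed
    then obtain x0 where x0: "\<And>z. z \<in> S \<Longrightarrow> fst z = 0 \<Longrightarrow> \<exists>c d. c \<noteq> 0 \<and> smul6 c z = smul6 d x0"
    proof
      assume "i0 \<noteq> 0"
      then show ?thesis using that[of "red u"] step[OF _ _ m0 _ tu(4)] by blast
    next
      assume "j0 \<noteq> 0"
      moreover have "smul6 m0 ?n = smul6 j0 u + smul6 i0 t" using m0(2) by (simp add: add.commute)
      moreover have "\<exists>m i j. m \<noteq> 0 \<and> smul6 m z = smul6 i u + smul6 j t" if "z \<in> S" for z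
        using tu(4)[OF that] by (metis add.commute)
      ultimately show ?thesis using that[of "red t"] step[OF _ _ m0(1), where t=u and u=t] by blast
    qed
    obtain c d where cd: "c \<noteq> 0" "smul6 c z = smul6 d x0" using x0 z by blast
    obtain c' d' where cd': "c' \<noteq> 0" "smul6 c' w = smul6 d' x0" using x0[OF wS \<open>fst w = 0\<close>] by blast
    have "w \<noteq> 0" using v(3) w(1) by (auto simp: smul6_eq_0)
    then have "d' \<noteq> 0" using cd' by (auto simp: smul6_0 smul6_eq_0)
    have "smul6 (d' * c) z = smul6 d (smul6 d' x0)"
      using arg_cong[OF cd(2), of "smul6 d'"] by (simp add: smul6_assoc mult.commute)
    also have "\<dots> = smul6 (d * c') w" unfolding cd'(2)[symmetric] by (simp add: smul6_assoc)
    finally show ?thesis using \<open>d' \<noteq> 0\<close> cd(1) by (intro exI[of _ "d' * c"] exI[of _ "d * c'"]) simp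
  qed
  have "S = {smul6 i ?n + smul6 j w | i j. True}"
  proof (intro equalityI subsetI)
    fix z assume z: "z \<in> S"
    obtain m j where mj: "m \<noteq> 0" "smul6 m (red z) = smul6 j w" using dep[OF red(1)[OF z] red(2)] by blast
    \<comment> \<open>Bezout for the coprime \<open>m div c\<close> and \<open>j div c\<close>
      writes \<open>w\<close> as \<open>m div c\<close> times an integral vector; primitivity of
      \<open>w\<close> makes this factor a unit.\<close>
    have "m dvd j"
    proof -
      define c where "c = gcd m j"
      have c: "c \<noteq> 0" "m = c * (m div c)" "j = c * (j div c)" using mj(1) by (auto simp: c_def)
      have "smul6 c (smul6 (m div c) (red z)) = smul6 c (smul6 (j div c) w)"
        unfolding smul6_assoc using c(2,3) mj(2) by simp
      then have "smul6 c (smul6 (m div c) (red z) + - smul6 (j div c) w) = 0"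
        by (simp only: smul6_add smul6_minus) simp
      then have eq: "smul6 (m div c) (red z) = smul6 (j div c) w" using c(1) by (simp add: smul6_eq_0)
      have "coprime (m div c) (j div c)" unfolding c_def by (rule div_gcd_coprime) (use mj(1) in auto)
      then obtain k l where kl: "k * (m div c) + l * (j div c) = 1" by (metis coprime_iff_gcd_eq_1 bezout_int)
      have "w = smul6 (k * (m div c) + l * (j div c)) w" by (simp add: kl smul6_one)
      also have "\<dots> = smul6 (m div c) (smul6 k w) + smul6 l (smul6 (j div c) w)"
        by (simp add: smul6_add smul6_assoc mult.commute)
      also have "\<dots> = smul6 (m div c) (smul6 k w + smul6 l (red z))"
        unfolding eq[symmetric] by (simp add: smul6_add smul6_assoc mult.commute)
      finally have "is_unit (m div c)" using w(2) unfolding primitive6_def by blast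
      then have "m dvd c" using c(2) by (metis dvd_mult_unit_iff' dvd_refl mult.commute)
      then show ?thesis unfolding c_def by (meson dvd_trans gcd_dvd2)
    qed
    then obtain l where "j = m * l" by (elim dvdE)
    then have "smul6 m (red z + - smul6 l w) = 0"
      using mj(2) by (simp add: smul6_add smul6_minus smul6_assoc del: add_uminus_conv_diff)
    then have "red z = smul6 l w" using mj(1) by (simp add: smul6_eq_0)
    moreover have "z = smul6 (fst z) ?n + red z" unfolding red_def by (cases z) simp
    ultimately show "z \<in> {smul6 i ?n + smul6 j w | i j. True}" by auto
  next
    fix z assume "z \<in> {smul6 i ?n + smul6 j w | i j. True}"
    then show "z \<in> S" using add sat n1 wS by blast
  qed
  with wS w(2) that show ?thesis unfolding w' by blast
qed

lemma image_setcompr2: "f ` {g i j | i j. True} = {f (g i j) | i j. True}"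
  by blast

text \<open>The 1 in the slot \<open>x\<close> of the first vector is dual to the slot
  \<open>y\<close>, the 1 in the slot \<open>p\<close> of the second to the slot \<open>s\<close>.
  The slots \<open>q\<close> and \<open>r\<close> carry the remaining plane; the entry -1 offsets
  the minus sign at \<open>q r\<close> in \<open>pair6\<close>.\<close>

lemma split6_normal:
  assumes "S = {smul6 i (1, a, 0, 0, 0, 0) + smul6 j (0, B, 1, 0, 0, d) | i j. True}"
  shows "split6 S"
  unfolding split6_def
proof (rule exI[of _ "(1, a, 0, 0, 0, 0)"], rule exI[of _ "(0, B, 1, 0, 0, d)"], rule exI[of _ "(0, 1, 0, 0, 0, 0)"],
    rule exI[of _ "(0, 0, 0, 0, 0, 1)"], rule exI[of _ "(0, 0, 0, 1, 0, 0)"], rule exI[of _ "(0, 0, 0, 0, - 1, 0)"],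
    intro conjI)
  show "gen6 (1, a, 0, 0, 0, 0) (0, B, 1, 0, 0, d) (0, 1, 0, 0, 0, 0) (0, 0, 0, 0, 0, 1) (0, 0, 0, 1, 0, 0) (0, 0, 0, 0, - 1, 0)"
    unfolding gen6_def
  proof
  fix t :: int6
  obtain x y p q r s where "t = (x, y, p, q, r, s)" by (cases t)
  then have "t = smul6 (y - a * x - B * p) (0, 1, 0, 0, 0, 0) + smul6 (s - d * p) (0, 0, 0, 0, 0, 1)
      + smul6 x (1, a, 0, 0, 0, 0) + smul6 p (0, B, 1, 0, 0, d) + smul6 q (0, 0, 0, 1, 0, 0)
      + smul6 (- r) (0, 0, 0, 0, - 1, 0)" by (simp add: algebra_simps)
  then show "\<exists>x1 x2 y1 y2 u v. t = smul6 x1 (0, 1, 0, 0, 0, 0) + smul6 x2 (0, 0, 0, 0, 0, 1)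
      + smul6 y1 (1, a, 0, 0, 0, 0) + smul6 y2 (0, B, 1, 0, 0, d) + smul6 u (0, 0, 0, 1, 0, 0)
      + smul6 v (0, 0, 0, 0, - 1, 0)" by blast
  qed
qed (use assms in \<open>simp_all add: gram6_def\<close>)

theorem admissible6_split6:
  assumes S: "admissible6 S"
  shows "split6 S"
proof -
  obtain t where t: "t \<in> S" "primitive6 t" using admissible6_primitive[OF S] .
  obtain \<phi>1 a where 1: "isometry6 \<phi>1" "\<phi>1 t = (1, a, 0, 0, 0, 0)"
    using primitive6_normal_form[OF t(2)] by (elim exE conjE)
  let ?n = "(1, a, 0, 0, 0, 0) :: int6"
  have S1: "admissible6 (\<phi>1 ` S)" "?n \<in> \<phi>1 ` S" using admissible6_isometry[OF 1(1) S] t(1) 1(2) by (simp, metis image_eqI)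
  obtain B p q r s where n2: "(0, B, p, q, r, s) \<in> \<phi>1 ` S" "primitive6 (0, B, p, q, r, s)"
    "\<phi>1 ` S = {smul6 i ?n + smul6 j (0, B, p, q, r, s) | i j. True}"
    by (rule admissible6_second_vector[OF S1])
  obtain d e where de: "reachable6 (0, B, p, q, r, s) (0, B, d, 0, 0, e)"
    using reachable6_smith[of 0 B p q r s] by (elim exE conjE)
  from de obtain \<phi>2 where 2: "isometry6 \<phi>2" "\<forall>x y. \<phi>2 (x, y, 0, 0, 0, 0) = (x, y, 0, 0, 0, 0)" "\<phi>2 (0, B, p, q, r, s) = (0, B, d, 0, 0, e)"
    by (rule reachable6E)
  have prim: "primitive6 (0, B, d, 0, 0, e)" using primitive6_isometry[OF 2(1) n2(2)] unfolding 2(3) .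
  \<comment> \<open>The corner \<open>d\<close> need not be a unit, since only \<open>B\<close>,
    \<open>d\<close>, \<open>e\<close> together are coprime. The transvection \<open>\<phi>3\<close>
    below fixes \<open>(1, a, 0, 0, 0, 0)\<close> and copies \<open>- B\<close> into the slot
    \<open>q\<close>; after that the matrix entries themselves are coprime.\<close>
  have unit: "is_unit k" if "k dvd d" "k dvd - B" "k dvd 0" "k dvd e" for k
  proof -
    have "(0, B, d, 0, 0, e) = smul6 k (0, B div k, d div k, 0, 0, e div k)" using that by simp
    then show ?thesis using prim unfolding primitive6_def by blast
  qed
  have "\<exists>c. reachable6 (0, B, d, - B, 0, e) (0, B, 1, 0, 0, c)"
    by (rule reachable6_unit_smith) (rule unit)
  then obtain c where "reachable6 (0, B, d, - B, 0, e) (0, B, 1, 0, 0, c)" by (elim exE)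
  then obtain \<phi>4 where 4: "isometry6 \<phi>4" "\<forall>x y. \<phi>4 (x, y, 0, 0, 0, 0) = (x, y, 0, 0, 0, 0)" "\<phi>4 (0, B, d, - B, 0, e) = (0, B, 1, 0, 0, c)"
    by (rule reachable6E)
  define \<phi>3 where "\<phi>3 = (\<lambda>(x, y, p, q, r, s). (x - r, y + a * r, p, q - y + a * x - a * r, r, s) :: int6)"
  define \<phi> where "\<phi> = (\<lambda>t. \<phi>4 (\<phi>3 (\<phi>2 (\<phi>1 t))))"
  have 3: "isometry6 \<phi>3" unfolding \<phi>3_def by (rule isometry6_eichler)
  have iso: "isometry6 \<phi>" unfolding \<phi>_def
    by (intro isometry6_comp[OF isometry6_comp[OF isometry6_comp[OF 1(1) 2(1)] 3] 4(1)])
  define \<psi> where "\<psi> = (\<lambda>t. \<phi>4 (\<phi>3 (\<phi>2 t)))"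
  have \<psi>: "isometry6 \<psi>" unfolding \<psi>_def
    by (intro isometry6_comp[OF isometry6_comp[OF 2(1) 3] 4(1)])
  have \<psi>n: "\<psi> ?n = ?n" "\<psi> (0, B, p, q, r, s) = (0, B, 1, 0, 0, c)"
    by (simp_all add: \<psi>_def 2 4 \<phi>3_def)
  have lin: "\<psi> (smul6 i v + smul6 j w) = smul6 i (\<psi> v) + smul6 j (\<psi> w)" for i j v w
    using \<psi> by (simp only: isometry6_def)
  have "\<phi> ` S = \<psi> ` (\<phi>1 ` S)" unfolding \<phi>_def \<psi>_def by (simp only: image_image)
  also have "\<dots> = {\<psi> (smul6 i ?n + smul6 j (0, B, p, q, r, s)) | i j. True}"
    unfolding n2(3) by (rule image_setcompr2)
  also have "\<dots> = {smul6 i (\<psi> ?n) + smul6 j (\<psi> (0, B, p, q, r, s)) | i j. True}"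
    unfolding lin ..
  finally show ?thesis
    unfolding \<psi>n by (rule split6_isometry[OF iso split6_normal])
qed

section \<open>Reduction to isometries of \<open>U \<oplus> N\<close>\<close>

type_synonym int4 = "int \<times> int \<times> int \<times> int"

text \<open>The lattice \<open>U \<oplus> N\<close>, where \<open>N\<close> has Gram matrix \<open>(2A, B; B, 2C)\<close>.\<close>

fun pair4 :: "int \<Rightarrow> int \<Rightarrow> int \<Rightarrow> int4 \<Rightarrow> int4 \<Rightarrow> int" where
  "pair4 A B C (r, s, x, y) (r', s', x', y') =
     r * s' + s * r' + 2 * A * x * x' + B * (x * y' + y * x') + 2 * C * y * y'"

definition iso4 :: "int \<Rightarrow> int \<Rightarrow> int \<Rightarrow> int \<Rightarrow> int \<Rightarrow> int \<Rightarrow> bool" where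
  "iso4 A B C A' B' C' \<longleftrightarrow> (\<exists>\<phi>. bij \<phi> \<and> (\<forall>t u. \<phi> (t + u) = \<phi> t + \<phi> u) \<and>
     (\<forall>t u. pair4 A' B' C' (\<phi> t) (\<phi> u) = pair4 A B C t u))"

definition param4 :: "('a::ab_group_add \<Rightarrow> 'a \<Rightarrow> real) \<Rightarrow> 'a set \<Rightarrow> int \<Rightarrow> int \<Rightarrow> int \<Rightarrow> (int4 \<Rightarrow> 'a) \<Rightarrow> bool" where
  "param4 b M A B C \<alpha> \<longleftrightarrow> bij_betw \<alpha> UNIV M \<and> (\<forall>t u. \<alpha> (t + u) = \<alpha> t + \<alpha> u) \<and>
     (\<forall>t u. b (\<alpha> t) (\<alpha> u) = of_int (pair4 A B C t u))"

lemma lattice_isometric_iff_iso4: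
  assumes \<alpha>: "param4 b M A B C \<alpha>" and \<beta>: "param4 b' M' A' B' C' \<beta>"
  shows "lattice_isometric b M b' M' \<longleftrightarrow> iso4 A B C A' B' C'"
proof
  have a: "bij_betw \<alpha> UNIV M" "\<And>t u. \<alpha> (t + u) = \<alpha> t + \<alpha> u" "\<And>t u. b (\<alpha> t) (\<alpha> u) = of_int (pair4 A B C t u)"
    and b: "bij_betw \<beta> UNIV M'" "\<And>t u. \<beta> (t + u) = \<beta> t + \<beta> u" "\<And>t u. b' (\<beta> t) (\<beta> u) = of_int (pair4 A' B' C' t u)"
    using \<alpha> \<beta> by (simp_all add: param4_def)
  have aM: "\<alpha> t \<in> M" for t
    using a(1) by (simp add: bij_betw_apply)
  have binj: "\<beta> t = \<beta> u \<longleftrightarrow> t = u" for t u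
    using inj_eq[OF bij_betw_imp_inj_on[OF b(1)]] by blast
  {
    assume "lattice_isometric b M b' M'"
    then obtain \<phi> where \<phi>: "bij_betw \<phi> M M'" "\<forall>x\<in>M. \<forall>y\<in>M. \<phi> (x + y) = \<phi> x + \<phi> y"
      "\<forall>x\<in>M. \<forall>y\<in>M. b' (\<phi> x) (\<phi> y) = b x y"
      unfolding lattice_isometric_def by (elim exE conjE)
    define \<psi> where "\<psi> = inv_into UNIV \<beta> \<circ> \<phi> \<circ> \<alpha>"
    have bpsi: "\<beta> (\<psi> t) = \<phi> (\<alpha> t)" for t
    proof -
      have "\<phi> (\<alpha> t) \<in> range \<beta>"
        using bij_betw_apply[OF \<phi>(1) aM] by (simp only: bij_betw_imp_surj_on[OF b(1)])
      then show ?thesis unfolding \<psi>_def by (simp add: f_inv_into_f)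
    qed
    have "bij \<psi>" unfolding \<psi>_def
      using bij_betw_trans[OF bij_betw_trans[OF a(1) \<phi>(1)] bij_betw_inv_into[OF b(1)]] by (simp add: comp_assoc)
    moreover have "\<psi> (t + u) = \<psi> t + \<psi> u" for t u
      unfolding binj[symmetric] b(2) bpsi a(2) by (rule \<phi>(2)[rule_format, OF aM aM])
    moreover have "pair4 A' B' C' (\<psi> t) (\<psi> u) = pair4 A B C t u" for t u
    proof -
      have "real_of_int (pair4 A' B' C' (\<psi> t) (\<psi> u)) = of_int (pair4 A B C t u)"
        unfolding a(3)[symmetric] b(3)[symmetric] bpsi by (rule \<phi>(3)[rule_format, OF aM aM])
      then show ?thesis by (simp only: of_int_eq_iff)
    qed
    ultimately show "iso4 A B C A' B' C'" unfolding iso4_def by (intro exI[of _ \<psi>] conjI allI)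
  next
    assume "iso4 A B C A' B' C'"
    then obtain \<psi> where \<psi>: "bij \<psi>" "\<forall>t u. \<psi> (t + u) = \<psi> t + \<psi> u"
      "\<forall>t u. pair4 A' B' C' (\<psi> t) (\<psi> u) = pair4 A B C t u" unfolding iso4_def by (elim exE conjE)
    define \<phi> where "\<phi> = \<beta> \<circ> \<psi> \<circ> inv_into UNIV \<alpha>"
    have phi: "\<phi> (\<alpha> t) = \<beta> (\<psi> t)" for t
      unfolding \<phi>_def using a(1) by (simp add: bij_betw_def inv_into_f_f)
    have "bij_betw \<phi> M M'" unfolding \<phi>_def
      using bij_betw_trans[OF bij_betw_inv_into[OF a(1)] bij_betw_trans[OF \<psi>(1) b(1)]] by (simp add: comp_assoc)
    moreover have "\<phi> (x + y) = \<phi> x + \<phi> y \<and> b' (\<phi> x) (\<phi> y) = b x y" if "x \<in> M" "y \<in> M" for x y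
    proof -
      have "x \<in> range \<alpha>" "y \<in> range \<alpha>" using that by (simp_all only: bij_betw_imp_surj_on[OF a(1)])
      then obtain t u where "x = \<alpha> t" "y = \<alpha> u" by (elim imageE)
      then show ?thesis using \<psi>(2,3) by (simp add: a(2)[symmetric] phi b(2)[symmetric] b(3) a(3))
    qed
    ultimately show "lattice_isometric b M b' M'" unfolding lattice_isometric_def
      by (intro exI[of _ \<phi>]) blast
  }
qed

text \<open>Negating the first basis vector reverses the sign of the determinant and keeps the
  lattice. This provides the witness for \<open>SOME\<close> in \<open>cup\<close>.\<close>

lemma oriented_basis_exists:
  assumes "complex_lattice \<Lambda>"
  shows "\<exists>b. oriented_basis \<Lambda> b"
proof -
  obtain b where b: "period_basis \<Lambda> b" using assms by (auto simp: complex_lattice_def)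
  show ?thesis
  proof (cases "period_det b > 0")
    case True
    then show ?thesis using b by (auto simp: oriented_basis_def)
  next
    case False
    define b' where "b' = (\<chi> i. if i = 1 then - b$1 else b$i)"
    let ?R = "\<lambda>b::(complex^2)^4. (\<chi> i. real_coords (b$i)) :: real^4^4"
    have neg: "real_coords (- v) = - real_coords v" for v
      using real_coords_linear(2)[of "-1" v] by simp
    have pd: "period_det b = det (?R b)" for b by (simp add: period_det_def real_coords_def)
    have "?R b' = (\<chi> i. if i = 1 then (-1) *s ?R b $ 1 else ?R b $ i)"
      by (simp add: vec_eq_iff b'_def neg)
    moreover have "?R b = (\<chi> i. if i = 1 then ?R b $ 1 else ?R b $ i)"
      by (simp add: vec_eq_iff)
    ultimately have "period_det b' = - period_det b"
      unfolding pd using det_row_mul[of 1 "-1" "\<lambda>i. ?R b $ 1" "\<lambda>i. ?R b $ i"] by simp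
    then have pos: "period_det b' > 0" using False b by (auto simp: period_basis_def)
    have "\<Lambda> = range (\<lambda>n::int^4. \<Sum>i\<in>UNIV. of_int (n$i) *\<^sub>R b'$i)"
    proof -
      let ?s = "\<lambda>n::int^4. (\<chi> i. if i = 1 then - n$1 else n$i) :: int^4"
      have eq: "(\<Sum>i\<in>UNIV. of_int (?s n$i) *\<^sub>R b'$i) = (\<Sum>i\<in>UNIV. of_int (n$i) *\<^sub>R b$i)" for n
        by (rule sum.cong) (auto simp: b'_def)
      have ss: "?s (?s n) = n" for n by (simp add: vec_eq_iff)
      have "range (\<lambda>n::int^4. \<Sum>i\<in>UNIV. of_int (n$i) *\<^sub>R b'$i) = range (\<lambda>n::int^4. \<Sum>i\<in>UNIV. of_int (n$i) *\<^sub>R b$i)"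
      proof (intro equalityI subsetI)
        fix v assume "v \<in> range (\<lambda>n::int^4. \<Sum>i\<in>UNIV. of_int (n$i) *\<^sub>R b'$i)"
        then obtain n :: "int^4" where "v = (\<Sum>i\<in>UNIV. of_int (n$i) *\<^sub>R b'$i)" by blast
        then have "v = (\<Sum>i\<in>UNIV. of_int (?s n$i) *\<^sub>R b$i)" using eq[of "?s n"] unfolding ss by simp
        then show "v \<in> range (\<lambda>n::int^4. \<Sum>i\<in>UNIV. of_int (n$i) *\<^sub>R b$i)" by (rule range_eqI)
      next
        fix v assume "v \<in> range (\<lambda>n::int^4. \<Sum>i\<in>UNIV. of_int (n$i) *\<^sub>R b$i)"
        then obtain n :: "int^4" where "v = (\<Sum>i\<in>UNIV. of_int (n$i) *\<^sub>R b$i)" by blast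
        then have "v = (\<Sum>i\<in>UNIV. of_int (?s n$i) *\<^sub>R b'$i)" using eq[of n] by simp
        then show "v \<in> range (\<lambda>n::int^4. \<Sum>i\<in>UNIV. of_int (n$i) *\<^sub>R b'$i)" by (rule range_eqI)
      qed
      then show ?thesis using b by (simp add: period_basis_def)
    qed
    then have "oriented_basis \<Lambda> b'" using pos by (simp add: oriented_basis_def period_basis_def)
    then show ?thesis by blast
  qed
qed

text \<open>The bridge from geometry to arithmetic: the splitting of \<open>U^3\<close> along
  \<open>NS6\<close> displays \<open>T(X)\<close> and the Mukai lattice in the coordinates of
  \<open>pair4\<close>, and the Hodge index theorem gives the sign of the discriminant.\<close>

theorem NS_lattice:
  assumes ab: "abelian_surface \<Lambda>" and \<rho>: "picard_number \<Lambda> = 2"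
  obtains n1 n2 A B C where
    "NS \<Lambda> = {of_int i *\<^sub>R n1 + of_int j *\<^sub>R n2 | i j :: int. True}"
    "cup \<Lambda> n1 n1 = of_int (2 * A)" "cup \<Lambda> n1 n2 = of_int B" "cup \<Lambda> n2 n2 = of_int (2 * C)"
    "B\<^sup>2 - 4 * A * C > 0" "self_mirror \<Lambda> \<longleftrightarrow> iso4 (- A) (- B) (- C) A B C"
proof -
  define b where "b = (SOME b. oriented_basis \<Lambda> b)"
  have "oriented_basis \<Lambda> b" unfolding b_def
    by (rule someI_ex[OF oriented_basis_exists]) (use ab in \<open>simp add: abelian_surface_def\<close>)
  then interpret period_lattice \<Lambda> b
    by unfold_locales (simp add: oriented_basis_def)
  have cup: "cup \<Lambda> E F = wedge E F b" for E F by (simp add: cup_def b_def)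
  have cup_cls: "cup \<Lambda> (cls t) (cls u) = of_int (pair6 t u)" for t u unfolding cup by (rule wedge_cls)
  obtain E where E: "E \<in> NS \<Lambda>" "\<And>v. v \<noteq> 0 \<Longrightarrow> val E (\<i> *s v) v > 0"
    using ab unfolding abelian_surface_def by blast
  obtain t u where tu: "t \<in> NS6" "u \<in> NS6" "\<And>k l. smul6 k t + smul6 l u = 0 \<Longrightarrow> k = 0 \<and> l = 0"
    "\<And>z. z \<in> NS6 \<Longrightarrow> \<exists>m i j. m \<noteq> 0 \<and> smul6 m z = smul6 i t + smul6 j u"
    by (rule picard_number_2[OF \<rho>]) (rule that, assumption+)
  have "admissible6 NS6"
    unfolding admissible6_def
  proof (intro conjI ballI allI)
    show "\<exists>t\<in>NS6. \<exists>u\<in>NS6. (\<forall>k l. smul6 k t + smul6 l u = 0 \<longrightarrow> k = 0 \<and> l = 0)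
          \<and> (\<forall>z\<in>NS6. \<exists>m i j. m \<noteq> 0 \<and> smul6 m z = smul6 i t + smul6 j u)"
      by (rule bexI[OF _ tu(1)], rule bexI[OF _ tu(2)], intro conjI allI impI ballI) (rule tu(3)[THEN conjunct1] tu(3)[THEN conjunct2] tu(4), assumption)+
  qed (simp_all add: NS6_add NS6_saturated)
  then have "split6 NS6" by (rule admissible6_split6)
  then obtain n1 n2 e1 e2 g h where N: "NS6 = {smul6 i n1 + smul6 j n2 | i j. True}"
    and gram: "gram6 n1 n2 e1 e2 g h" and gen: "gen6 n1 n2 e1 e2 g h"
    unfolding split6_def by (elim exE conjE) (rule that)
  note gr = gram[unfolded gram6_def]
  obtain A where A: "pair6 n1 n1 = 2 * A" using pair6_even[of n1] by (elim evenE)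
  obtain C where C: "pair6 n2 n2 = 2 * C" using pair6_even[of n2] by (elim evenE)
  define B where "B = pair6 n1 n2"
  note bil = pair6_add pair6_smul pair6_minus
  have sy: "pair6 n1 e1 = 1" "pair6 n2 e1 = 0" "pair6 n1 e2 = 0" "pair6 n2 e2 = 1" "pair6 e2 e1 = 0"
     "pair6 n2 n1 = B" "pair6 n1 g = 0" "pair6 n2 g = 0" "pair6 e1 g = 0" "pair6 e2 g = 0"
     "pair6 n1 h = 0" "pair6 n2 h = 0" "pair6 e1 h = 0" "pair6 e2 h = 0" "pair6 h g = 1"
    using gr B_def by (simp_all only: pair6_sym[of n1 e1] pair6_sym[of n2 e1] pair6_sym[of n1 e2] pair6_sym[of n2 e2]
      pair6_sym[of e2 e1] pair6_sym[of n2 n1] pair6_sym[of n1 g] pair6_sym[of n2 g] pair6_sym[of e1 g] pair6_sym[of e2 g]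
      pair6_sym[of n1 h] pair6_sym[of n2 h] pair6_sym[of e1 h] pair6_sym[of e2 h] pair6_sym[of h g])
  have nN: "n1 \<in> NS6" "n2 \<in> NS6"
  proof -
    have "n1 = smul6 1 n1 + smul6 0 n2" "n2 = smul6 0 n1 + smul6 1 n2" by (simp_all add: smul6_0 smul6_one)
    then show "n1 \<in> NS6" "n2 \<in> NS6" unfolding N by blast+
  qed
  have indep: "k = 0 \<and> l = 0" if "smul6 k n1 + smul6 l n2 = 0" for k l
  proof -
    have "pair6 (smul6 k n1 + smul6 l n2) e1 = k" "pair6 (smul6 k n1 + smul6 l n2) e2 = l"
      by (simp_all add: bil sy)
    moreover have "pair6 0 v = 0" for v by (cases v) (simp add: zero_prod_def)
    ultimately show ?thesis unfolding that by simp
  qed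
  have D: "B\<^sup>2 - 4 * A * C > 0"
  proof -
    have "\<exists>m i j. m \<noteq> 0 \<and> smul6 m z = smul6 i n1 + smul6 j n2" if "z \<in> NS6" for z
    proof -
      from that obtain i j where "z = smul6 i n1 + smul6 j n2" unfolding N by blast
      then have "smul6 1 z = smul6 i n1 + smul6 j n2" by (simp add: smul6_one)
      then show ?thesis by (intro exI[of _ 1] exI[of _ i] exI[of _ j]) simp
    qed
    from NS6_hodge_index[OF E nN indep this] show ?thesis by (simp add: A C B_def)
  qed
  \<comment> \<open>\<open>n1, n2\<close> corrected along the dual pair so as to become orthogonal
    to \<open>n1, n2\<close>. The corrected vectors have the negative Gram matrix, so together with
    \<open>g, h\<close> they exhibit \<open>T(X)\<close> as \<open>U + N(-1)\<close>.\<close>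
  define t1 where "t1 = n1 + (smul6 (- 2 * A) e1 + smul6 (- B) e2)"
  define t2 where "t2 = n2 + (smul6 (- B) e1 + smul6 (- 2 * C) e2)"
  define \<alpha>' where "\<alpha>' = (\<lambda>(r, s, x, y). smul6 r g + smul6 s h + smul6 x t1 + smul6 y t2)"
  have tt: "pair6 t1 t1 = - 2 * A" "pair6 t1 t2 = - B" "pair6 t2 t1 = - B" "pair6 t2 t2 = - 2 * C"
    "pair6 g t1 = 0" "pair6 g t2 = 0" "pair6 h t1 = 0" "pair6 h t2 = 0"
    "pair6 t1 g = 0" "pair6 t2 g = 0" "pair6 t1 h = 0" "pair6 t2 h = 0"
    "pair6 t1 n1 = 0" "pair6 t1 n2 = 0" "pair6 t2 n1 = 0" "pair6 t2 n2 = 0"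
    "pair6 t1 e1 = 1" "pair6 t1 e2 = 0" "pair6 t2 e1 = 0" "pair6 t2 e2 = 1"
    unfolding t1_def t2_def by (simp_all only: bil sy gr A C B_def[symmetric], (simp_all)?)
  have \<alpha>'_pair: "pair6 (\<alpha>' t) (\<alpha>' u) = pair4 (- A) (- B) (- C) t u" for t u
    by (cases t, cases u, simp only: \<alpha>'_def prod.case bil tt gr sy pair4.simps) (simp add: algebra_simps)
  have \<alpha>'_add: "\<alpha>' (t + u) = \<alpha>' t + \<alpha>' u" for t u
    by (cases t, cases u, simp only: \<alpha>'_def prod.case add_Pair smul6_add; simp add: ac_simps)
  have \<alpha>'_coord: "pair6 (\<alpha>' (r, s, x, y)) h = r" "pair6 (\<alpha>' (r, s, x, y)) g = s"
     "pair6 (\<alpha>' (r, s, x, y)) e1 = x" "pair6 (\<alpha>' (r, s, x, y)) e2 = y"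
     "pair6 (\<alpha>' (r, s, x, y)) n1 = 0" "pair6 (\<alpha>' (r, s, x, y)) n2 = 0" for r s x y
    unfolding \<alpha>'_def by (simp_all only: prod.case bil tt gr sy, (simp_all)?)
  have \<alpha>'_inj: "\<alpha>' t = \<alpha>' u \<longleftrightarrow> t = u" for t u
    by (cases t, cases u) (metis \<alpha>'_coord(1-4))
  have T: "transcendental_lattice \<Lambda> = (\<lambda>t. cls (\<alpha>' t)) ` UNIV"
  proof (intro equalityI subsetI)
    fix E assume "E \<in> transcendental_lattice \<Lambda>"
    then have E: "E \<in> H2 \<Lambda>" "\<And>D. D \<in> NS \<Lambda> \<Longrightarrow> cup \<Lambda> E D = 0" by (auto simp: transcendental_lattice_def)
    obtain t where t: "E = cls t" using H2_cls[OF E(1)] .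
    have pn: "pair6 t n1 = 0" "pair6 t n2 = 0"
      using E(2)[of "cls n1"] E(2)[of "cls n2"] nN unfolding NS_cls t cup_cls by simp_all
    obtain x1 x2 y1 y2 u v where tx: "t = smul6 x1 e1 + smul6 x2 e2 + smul6 y1 n1 + smul6 y2 n2 + smul6 u g + smul6 v h"
      using gen unfolding gen6_def by (elim allE[of _ t] exE) (rule that)
    have x: "x1 = y1 * (- 2 * A) + y2 * (- B)" "x2 = y1 * (- B) + y2 * (- 2 * C)"
      using pn unfolding tx by (simp_all only: bil sy gr A C B_def[symmetric], (simp_all)?)
    have "t = \<alpha>' (u, v, y1, y2)"
      unfolding tx x \<alpha>'_def t1_def t2_def prod.case by (simp only: smul6_add smul6_assoc ac_simps)
    then show "E \<in> (\<lambda>t. cls (\<alpha>' t)) ` UNIV" unfolding t by blast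
  next
    fix E assume "E \<in> (\<lambda>t. cls (\<alpha>' t)) ` UNIV"
    then obtain t where t: "E = cls (\<alpha>' t)" by blast
    have "cup \<Lambda> E D = 0" if D: "D \<in> NS \<Lambda>" for D
    proof -
      obtain i j where "D = cls (smul6 i n1 + smul6 j n2)" using D unfolding NS_cls N by blast
      moreover obtain r s x y where "t = (r, s, x, y)" by (cases t)
      ultimately show ?thesis unfolding t by (simp add: cup_cls bil \<alpha>'_coord)
    qed
    then show "E \<in> transcendental_lattice \<Lambda>" unfolding transcendental_lattice_def using cls_H2 t by blast
  qed
  have pa: "param4 (cup \<Lambda>) (transcendental_lattice \<Lambda>) (- A) (- B) (- C) (\<lambda>t. cls (\<alpha>' t))"
    unfolding param4_def
  proof (intro conjI allI)
    show "bij_betw (\<lambda>t. cls (\<alpha>' t)) UNIV (transcendental_lattice \<Lambda>)"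
      unfolding bij_betw_def inj_on_def by (simp only: T cls_inj \<alpha>'_inj simp_thms ball_simps)
    show "cls (\<alpha>' (t + u)) = cls (\<alpha>' t) + cls (\<alpha>' u)" for t u by (simp only: \<alpha>'_add cls_add)
    show "cup \<Lambda> (cls (\<alpha>' t)) (cls (\<alpha>' u)) = of_int (pair4 (- A) (- B) (- C) t u)" for t u
      by (simp only: cup_cls \<alpha>'_pair)
  qed
  \<comment> \<open>The sign at \<open>r\<close> turns \<open>-rs' - sr'\<close> of the Mukai
    pairing into the hyperbolic plane of \<open>pair4\<close>.\<close>
  define \<beta> where "\<beta> = (\<lambda>(r, s, x, y). (- r :: int, cls (smul6 x n1 + smul6 y n2), s :: int))"
  have lin_inj: "x = x' \<and> y = y'" if "smul6 x n1 + smul6 y n2 = smul6 x' n1 + smul6 y' n2" for x y x' y'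
  proof -
    have "pair6 (smul6 x n1 + smul6 y n2) e1 = pair6 (smul6 x' n1 + smul6 y' n2) e1"
      "pair6 (smul6 x n1 + smul6 y n2) e2 = pair6 (smul6 x' n1 + smul6 y' n2) e2" by (simp_all only: that)
    then show ?thesis by (simp add: bil sy)
  qed
  have pb: "param4 (mukai_pairing \<Lambda>) (mukai_lattice \<Lambda>) A B C \<beta>"
    unfolding param4_def
  proof (intro conjI allI)
    show "bij_betw \<beta> UNIV (mukai_lattice \<Lambda>)"
    proof (rule bij_betwI')
      fix t u :: int4
      show "\<beta> t = \<beta> u \<longleftrightarrow> t = u"
        by (cases t, cases u) (auto simp: \<beta>_def cls_inj dest: lin_inj)
      show "\<beta> t \<in> mukai_lattice \<Lambda>"
        by (cases t) (auto simp: \<beta>_def mukai_lattice_def NS_cls N)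
    next
      fix z assume "z \<in> mukai_lattice \<Lambda>"
      then obtain r E s where z: "z = (r, E, s)" "E \<in> NS \<Lambda>" unfolding mukai_lattice_def by blast
      obtain i j where "E = cls (smul6 i n1 + smul6 j n2)" using z(2) unfolding NS_cls N by blast
      then have "z = \<beta> (- r, s, i, j)" unfolding z(1) by (simp add: \<beta>_def)
      then show "\<exists>t\<in>UNIV. z = \<beta> t" by blast
    qed
    show "\<beta> (t + u) = \<beta> t + \<beta> u" for t u
      by (cases t, cases u) (simp add: \<beta>_def cls_add[symmetric] cls_inj smul6_add ac_simps)
    show "mukai_pairing \<Lambda> (\<beta> t) (\<beta> u) = of_int (pair4 A B C t u)" for t u
      by (cases t, cases u)
         (simp only: \<beta>_def mukai_pairing_def prod.case cup_cls bil sy A C B_def[symmetric] pair4.simps,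
          simp add: algebra_simps)
  qed
  have sm: "self_mirror \<Lambda> \<longleftrightarrow> iso4 (- A) (- B) (- C) A B C"
    unfolding self_mirror_def by (rule lattice_isometric_iff_iso4[OF pa pb])
  have NSset: "NS \<Lambda> = {of_int i *\<^sub>R cls n1 + of_int j *\<^sub>R cls n2 | i j :: int. True}"
    unfolding NS_cls N image_setcompr2 cls_add cls_smul ..
  show ?thesis
    by (rule that[OF NSset _ _ _ D sm]) (simp_all only: cup_cls A C B_def)
qed

section \<open>Isometries between lattices \<open>U + N\<close>\<close>

lemma iso4I:
  assumes "\<And>t. \<psi> (\<phi> t) = t" "\<And>t. \<phi> (\<psi> t) = t" "\<And>t u. \<phi> (t + u) = \<phi> t + \<phi> u"
    "\<And>t u. pair4 A' B' C' (\<phi> t) (\<phi> u) = pair4 A B C t u"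
  shows "iso4 A B C A' B' C'"
proof -
  have "bij \<phi>" by (rule o_bij[of \<psi>]) (rule ext, simp only: comp_def id_def assms(1,2))+
  then show ?thesis unfolding iso4_def by (intro exI[of _ \<phi>] conjI allI assms)
qed

lemma iso4_trans:
  assumes "iso4 A B C A' B' C'" "iso4 A' B' C' A'' B'' C''"
  shows "iso4 A B C A'' B'' C''"
proof -
  obtain \<phi> where \<phi>: "bij \<phi>" "\<forall>t u. \<phi> (t + u) = \<phi> t + \<phi> u" "\<forall>t u. pair4 A' B' C' (\<phi> t) (\<phi> u) = pair4 A B C t u"
    using assms(1) unfolding iso4_def by (elim exE conjE)
  obtain \<psi> where \<psi>: "bij \<psi>" "\<forall>t u. \<psi> (t + u) = \<psi> t + \<psi> u" "\<forall>t u. pair4 A'' B'' C'' (\<psi> t) (\<psi> u) = pair4 A' B' C' t u"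
    using assms(2) unfolding iso4_def by (elim exE conjE)
  show ?thesis unfolding iso4_def
    by (intro exI[of _ "\<psi> \<circ> \<phi>"] conjI allI bij_comp \<phi>(1) \<psi>(1)) (simp_all add: \<phi>(2,3) \<psi>(2,3))
qed

lemma iso4_change_of_basis:
  assumes "p * v - q * u = (1::int)"
  shows "iso4 (A * p^2 + B * p * q + C * q^2) (2 * A * p * u + B * (p * v + q * u) + 2 * C * q * v)
     (A * u^2 + B * u * v + C * v^2) A B C"
proof (rule iso4I[of "\<lambda>(r, s, x, y). (r, s, v * x - u * y, p * y - q * x)" "\<lambda>(r, s, x, y). (r, s, p * x + u * y, q * x + v * y)"])
  have e: "v * (p * x + u * y) - u * (q * x + v * y) = x" "p * (q * x + v * y) - q * (p * x + u * y) = y"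
    "p * (v * x - u * y) + u * (p * y - q * x) = x" "q * (v * x - u * y) + v * (p * y - q * x) = y" for x y
  proof -
    have "v * (p * x + u * y) - u * (q * x + v * y) = (p * v - q * u) * x"
     "p * (q * x + v * y) - q * (p * x + u * y) = (p * v - q * u) * y"
    "p * (v * x - u * y) + u * (p * y - q * x) = (p * v - q * u) * x"
    "q * (v * x - u * y) + v * (p * y - q * x) = (p * v - q * u) * y" by (simp_all add: algebra_simps)
    then show "v * (p * x + u * y) - u * (q * x + v * y) = x" "p * (q * x + v * y) - q * (p * x + u * y) = y"
    "p * (v * x - u * y) + u * (p * y - q * x) = x" "q * (v * x - u * y) + v * (p * y - q * x) = y"
      by (simp_all add: assms)
  qed
  fix t t' :: int4
  show "(\<lambda>(r, s, x, y). (r, s, v * x - u * y, p * y - q * x)) ((\<lambda>(r, s, x, y). (r, s, p * x + u * y, q * x + v * y)) t) = t"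
    "(\<lambda>(r, s, x, y). (r, s, p * x + u * y, q * x + v * y)) ((\<lambda>(r, s, x, y). (r, s, v * x - u * y, p * y - q * x)) t) = t"
    by (cases t; simp add: e)+
  show "(\<lambda>(r, s, x, y). (r, s, p * x + u * y, q * x + v * y)) (t + t') =
     (\<lambda>(r, s, x, y). (r, s, p * x + u * y, q * x + v * y)) t + (\<lambda>(r, s, x, y). (r, s, p * x + u * y, q * x + v * y)) t'"
    by (cases t; cases t') (simp add: algebra_simps)
  show "pair4 A B C ((\<lambda>(r, s, x, y). (r, s, p * x + u * y, q * x + v * y)) t) ((\<lambda>(r, s, x, y). (r, s, p * x + u * y, q * x + v * y)) t')
     = pair4 (A * p^2 + B * p * q + C * q^2) (2 * A * p * u + B * (p * v + q * u) + 2 * C * q * v)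
     (A * u^2 + B * u * v + C * v^2) t t'"
    by (cases t; cases t') (simp add: algebra_simps power2_eq_square)
qed

lemma iso4_sym:
  assumes "iso4 A B C A' B' C'"
  shows "iso4 A' B' C' A B C"
proof -
  obtain \<phi> where \<phi>: "bij \<phi>" "\<forall>t u. \<phi> (t + u) = \<phi> t + \<phi> u" "\<forall>t u. pair4 A' B' C' (\<phi> t) (\<phi> u) = pair4 A B C t u"
    using assms unfolding iso4_def by (elim exE conjE)
  let ?\<psi> = "inv_into UNIV \<phi>"
  have i: "?\<psi> (\<phi> t) = t" "\<phi> (?\<psi> t) = t" for t
    using \<phi>(1) by (simp_all add: bij_is_inj bij_is_surj surj_f_inv_f)
  show ?thesis
  proof (rule iso4I[of \<phi> ?\<psi>])
    show "?\<psi> (t + u) = ?\<psi> t + ?\<psi> u" for t u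
      using \<phi>(2) i by metis
    show "pair4 A B C (?\<psi> t) (?\<psi> u) = pair4 A' B' C' t u" for t u
      using \<phi>(3) i by metis
  qed (rule i)+
qed

text \<open>With \<open>J\<close> the multiplication by \<open>\<surd>D\<close> on \<open>N\<close>, the matrix \<open>M = (\<alpha> \<beta>; \<gamma> \<delta>) = (t + kJ)/2\<close> satisfies
  \<open>f(Mv) = - s\<^sup>2 f(v)\<close>, so that \<open>s\<^sup>-\<^sup>1 M\<close> maps \<open>N(-1)\<close> isometrically into \<open>N \<otimes> \<rat>\<close>. The lattice
  \<open>e\<^sup>\<bottom>/e\<close> for the isotropic vector \<open>e = (s, msa, Me\<^sub>1)\<close> is its image.\<close>

lemma iso4_anti_isometry:
  fixes a b c m s t k :: int
  assumes rep: "t^2 + 4 * s^2 = k^2 * (b^2 - 4 * a * c)" and s0: "s \<noteq> 0"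
    and cop: "coprime s m" "coprime s t" "coprime s k" "coprime s a"
    and nondeg: "m * (b^2 - 4 * a * c) \<noteq> 0"
  shows "iso4 (- (m * a)) (- (m * b)) (- (m * c)) (m * a) (m * b) (m * c)"
proof -
  \<comment> \<open>The diagonal entries \<open>(t - kb)/2\<close> and \<open>(t + kb)/2\<close> of
    \<open>M\<close> have to be integers.\<close>
  have par: "even (t - k * b)"
  proof -
    have "even (t^2) \<longleftrightarrow> even ((k * b)^2)"
      using arg_cong[OF rep, of even] by (simp add: power_mult_distrib)
    then show ?thesis by simp
  qed
  then obtain \<alpha> where \<alpha>: "t - k * b = 2 * \<alpha>" by (elim evenE)
  define \<gamma> where "\<gamma> = k * a" define \<beta> where "\<beta> = - (k * c)" define \<delta> where "\<delta> = \<alpha> + k * b"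
  have t: "t = \<alpha> + \<delta>" using \<alpha> by (simp add: \<delta>_def)
  have kb: "k * b = \<delta> - \<alpha>" by (simp add: \<delta>_def)
  have det: "\<beta> * \<gamma> = \<alpha> * \<delta> + s^2"
  proof -
    have t': "t = 2 * \<alpha> + k * b" using \<alpha> by simp
    have "4 * (\<alpha> * \<delta> + s^2) = t^2 + 4 * s^2 - (k * b)^2"
      unfolding t' \<delta>_def by (simp add: algebra_simps power2_eq_square)
    also have "\<dots> = 4 * (\<beta> * \<gamma>)"
      unfolding rep \<beta>_def \<gamma>_def by (simp add: algebra_simps power2_eq_square)
    finally have "4 * (\<beta> * \<gamma>) = 4 * (\<alpha> * \<delta> + s^2)" by (rule sym)
    then show ?thesis by simp
  qed
  have cg: "coprime \<gamma> s" using cop by (simp add: \<gamma>_def coprime_commute)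
  \<comment> \<open>\<open>(- k', 1)\<close> is a kernel vector of \<open>M\<close> modulo
    \<open>s\<close>, and \<open>(\<mu>, \<nu>)\<close> will be \<open>M (- k', 1)\<close> divided
    by \<open>s\<close>. Such a \<open>k'\<close> exists because \<open>\<gamma>\<close> is prime to
    \<open>s\<close>.\<close>
  obtain k' \<nu> where \<nu>: "\<delta> - \<gamma> * k' = s * \<nu>"
  proof -
    obtain x y where "x * \<gamma> + y * s = 1" using cg by (metis bezout_int coprime_iff_gcd_eq_1)
    moreover have "\<delta> - \<gamma> * (x * \<delta>) - s * (y * \<delta>) = \<delta> * (1 - (x * \<gamma> + y * s))" by (simp add: algebra_simps)
    ultimately have "\<delta> - \<gamma> * (x * \<delta>) = s * (y * \<delta>)" by simp
    then show ?thesis by (rule that)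
  qed
  have "s dvd \<gamma> * (\<beta> - \<alpha> * k')"
  proof -
    have "\<gamma> * (\<beta> - \<alpha> * k') = \<beta> * \<gamma> - \<alpha> * \<delta> + \<alpha> * (\<delta> - \<gamma> * k')" by (simp add: algebra_simps)
    also have "\<dots> = s * (\<alpha> * \<nu> + s)" unfolding det \<nu> by (simp add: algebra_simps power2_eq_square)
    finally have "\<gamma> * (\<beta> - \<alpha> * k') = s * (\<alpha> * \<nu> + s)" .
    then show ?thesis by simp
  qed
  then have "s dvd \<beta> - \<alpha> * k'" using cg by (simp add: coprime_dvd_mult_right_iff coprime_commute)
  then obtain \<mu> where \<mu>: "\<beta> - \<alpha> * k' = s * \<mu>" by (elim dvdE)
  let ?P = "pair4 (m * a) (m * b) (m * c)"
  \<comment> \<open>Rationally, a class of the complement of \<open>e\<close> modulo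
    \<open>e\<close> has a representative with first coordinate 0, on which the form is that of
    \<open>N\<close>. In this way \<open>v1\<close> corresponds to \<open>s^-1 M e_1\<close>,
    \<open>w2\<close> to \<open>s^-1 M (e_2 - k' e_1)\<close>, and the later
    \<open>v2 = w2 + k' v1\<close> to \<open>s^-1 M e_2\<close>.\<close>
  define e where "e = (s, m * s * a, \<alpha>, \<gamma>)"
  define v1 where "v1 = (- 1 :: int, m * a, 0 :: int, 0 :: int)"
  define w2 where "w2 = (0 :: int, m * (b - 2 * a * k'), \<mu>, \<nu>)"
  have kk: "k \<noteq> 0"
  proof
    assume "k = 0"
    then have "t^2 + 4 * s^2 = 0" using rep by simp
    then have "s^2 = 0" using zero_le_power2[of t] zero_le_power2[of s] by linarith
    then show False using s0 by simp
  qed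
  note cancel = mult_left_cancel[OF kk, THEN iffD1]
  note s_cancel = mult_left_cancel[OF s0, THEN iffD1]
  have f1: "a * \<alpha>^2 + b * \<alpha> * \<gamma> + c * \<gamma>^2 = - (s^2 * a)"
  proof -
    have "a * \<alpha>^2 + b * \<alpha> * \<gamma> + c * \<gamma>^2 = a * (\<alpha>^2 + \<alpha> * (k * b) + c * k * \<gamma>)"
      unfolding \<gamma>_def by (simp add: algebra_simps power2_eq_square)
    also have "\<dots> = a * (\<alpha> * \<delta> - \<beta> * \<gamma>)" unfolding kb \<beta>_def by (simp add: algebra_simps power2_eq_square)
    finally show ?thesis unfolding det by simp
  qed
  have ee: "?P e e = 0"
  proof -
    have "?P e e = 2 * m * (s^2 * a + (a * \<alpha>^2 + b * \<alpha> * \<gamma> + c * \<gamma>^2))"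
      unfolding e_def by (simp add: algebra_simps power2_eq_square)
    then show ?thesis unfolding f1 by simp
  qed
  have ev1: "?P e v1 = 0" "?P v1 v1 = - 2 * (m * a)" by (simp_all add: e_def v1_def)
  \<comment> \<open>The factor \<open>k\<close> turns the coefficients \<open>a, b, c\<close> into
    entries of \<open>M\<close>, so that \<open>det\<close> can be applied; it is cancelled
    afterwards.\<close>
  have kform: "k * ?P e (x, z, n1, n2) = k * (s * z + m * s * a * x) - m * (t * (\<alpha> * n2 - \<gamma> * n1) + 2 * s^2 * n2)" for x z n1 n2
  proof -
    have "k * ?P e (x, z, n1, n2) = k * (s * z + m * s * a * x)
       + m * (\<alpha> * (2 * (k * a) * n1 + (k * b) * n2) + \<gamma> * ((k * b) * n1 + 2 * (k * c) * n2))"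
      unfolding e_def by (simp add: algebra_simps)
    also have "\<dots> = k * (s * z + m * s * a * x)
       + m * (\<alpha> * (2 * \<gamma> * n1 + (\<delta> - \<alpha>) * n2) + \<gamma> * ((\<delta> - \<alpha>) * n1 - 2 * \<beta> * n2))"
      unfolding kb by (simp add: \<gamma>_def \<beta>_def)
    also have "\<dots> = k * (s * z + m * s * a * x) + m * (\<gamma> * t * n1 + (\<alpha> * \<delta> - \<alpha>^2 - 2 * (\<beta> * \<gamma>)) * n2)"
      unfolding t by (simp add: algebra_simps power2_eq_square)
    also have "\<dots> = k * (s * z + m * s * a * x) - m * (t * (\<alpha> * n2 - \<gamma> * n1) + 2 * s^2 * n2)"
      unfolding det unfolding t by (simp add: algebra_simps power2_eq_square)
    finally show ?thesis .
  qed
  have om: "\<alpha> * \<nu> - \<gamma> * \<mu> = - s"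
  proof -
    have "s * (\<alpha> * \<nu> - \<gamma> * \<mu>) = \<alpha> * (s * \<nu>) - \<gamma> * (s * \<mu>)" by (simp add: algebra_simps)
    also have "\<dots> = \<alpha> * \<delta> - \<beta> * \<gamma>" unfolding \<mu>[symmetric] \<nu>[symmetric] by (simp add: algebra_simps)
    also have "\<dots> = s * (- s)" unfolding det by (simp add: power2_eq_square)
    finally have "s * (\<alpha> * \<nu> - \<gamma> * \<mu>) = s * (- s)" .
    then show ?thesis by (rule s_cancel)
  qed
  have ew2: "?P e w2 = 0"
  proof -
    have "k * ?P e w2 = k * (s * (m * (b - 2 * a * k'))) - m * (t * (- s) + 2 * s^2 * \<nu>)"
      unfolding w2_def kform om by simp
    also have "\<dots> = m * s * ((k * b) - 2 * \<gamma> * k' + t - 2 * (s * \<nu>))"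
      unfolding \<gamma>_def by (simp add: algebra_simps power2_eq_square)
    also have "\<dots> = k * 0" unfolding kb t \<nu>[symmetric] by simp
    finally show ?thesis by (rule cancel)
  qed
  have v1w2: "?P v1 w2 = - (m * (b - 2 * a * k'))" by (simp add: v1_def w2_def)
  have f2: "a * \<mu>^2 + b * \<mu> * \<nu> + c * \<nu>^2 = - (c - b * k' + a * k'^2)"
  proof -
    have "s^2 * k * (a * \<mu>^2 + b * \<mu> * \<nu> + c * \<nu>^2) = \<gamma> * (s * \<mu>)^2 + (\<delta> - \<alpha>) * (s * \<mu>) * (s * \<nu>) - \<beta> * (s * \<nu>)^2"
      unfolding \<gamma>_def \<beta>_def kb[symmetric] by (simp add: algebra_simps power2_eq_square)
    also have "\<dots> = (\<alpha> * \<delta> - \<beta> * \<gamma>) * (- \<beta> - (\<delta> - \<alpha>) * k' + \<gamma> * k'^2)"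
      unfolding \<mu>[symmetric] \<nu>[symmetric] by (simp add: algebra_simps power2_eq_square)
    also have "\<dots> = s^2 * k * (- (c - b * k' + a * k'^2))"
      unfolding det unfolding kb[symmetric] unfolding \<beta>_def \<gamma>_def by (simp add: algebra_simps)
    finally show ?thesis using kk s0 by simp
  qed
  have w2w2: "?P w2 w2 = - 2 * m * (c - b * k' + a * k'^2)"
  proof -
    have "?P w2 w2 = 2 * m * (a * \<mu>^2 + b * \<mu> * \<nu> + c * \<nu>^2)"
      unfolding w2_def by (simp add: algebra_simps power2_eq_square)
    then show ?thesis unfolding f2 by (simp add: algebra_simps)
  qed
  define v2 where "v2 = (- k', m * (b - 2 * a * k') + k' * (m * a), \<mu>, \<nu>)"
  have v2: "?P e v2 = 0" "?P v1 v2 = - (m * b)" "?P v2 v2 = - 2 * (m * c)"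
  proof -
    have lin: "?P x v2 = ?P x w2 + k' * ?P x v1" for x
      by (cases x) (simp add: v2_def w2_def v1_def algebra_simps)
    have sym: "?P x y = ?P y x" for x y by (cases x; cases y) (simp add: algebra_simps)
    show "?P e v2 = 0" by (simp only: lin ew2 ev1)
    show "?P v1 v2 = - (m * b)" by (simp only: lin v1w2 ev1) (simp add: algebra_simps)
    show "?P v2 v2 = - 2 * (m * c)"
      unfolding lin[of v2] sym[of v2] lin v1w2 w2w2 ev1 sym[of w2 v1]
      by (simp add: algebra_simps power2_eq_square)
  qed
  have copr: "coprime \<alpha> \<gamma>"
  proof (rule coprimeI)
    fix d assume d: "d dvd \<alpha>" "d dvd \<gamma>"
    have "s^2 = \<beta> * \<gamma> - \<alpha> * \<delta>" using det by simp
    then have "d dvd s^2" using d by simp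
    moreover have "coprime d (s^2)" using coprime_divisors[OF d(2) dvd_refl cg] by simp
    ultimately show "is_unit d" by (metis coprime_common_divisor dvd_refl)
  qed
  \<comment> \<open>The vectors \<open>e\<close>, \<open>v1\<close>, \<open>v2\<close> span the
    complement of \<open>e\<close>. Since \<open>s\<close> is prime to \<open>m t\<close>, it
    divides \<open>\<alpha> n2 - \<gamma> n1\<close>, which determines the coefficient of
    \<open>v2\<close>; coprimality of \<open>\<alpha>\<close> and \<open>\<gamma>\<close> yields
    that of \<open>e\<close>, and the rest is a multiple of \<open>v1\<close>.\<close>
  have perp: "\<exists>i j l. Y = (i * s - j - l * k', i * (m * s * a) + j * (m * a) + l * (m * (b - 2 * a * k') + k' * (m * a)), i * \<alpha> + l * \<mu>, i * \<gamma> + l * \<nu>)"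
    if Y: "?P e Y = 0" for Y
  proof -
    obtain x z n1 n2 where Ye: "Y = (x, z, n1, n2)" by (cases Y)
    have k0: "k * (s * z + m * s * a * x) = m * (t * (\<alpha> * n2 - \<gamma> * n1) + 2 * s^2 * n2)"
      using kform[of x z n1 n2] Y unfolding Ye by simp
    have "s dvd m * t * (\<alpha> * n2 - \<gamma> * n1)"
    proof -
      have "m * t * (\<alpha> * n2 - \<gamma> * n1) = s * (k * (z + m * a * x) - 2 * m * s * n2)"
        using k0 by (simp add: algebra_simps power2_eq_square)
      then show ?thesis by simp
    qed
    then have "s dvd \<alpha> * n2 - \<gamma> * n1" using cop(1,2) by (simp add: coprime_dvd_mult_right_iff)
    then obtain l' where l': "\<alpha> * n2 - \<gamma> * n1 = s * l'" by (elim dvdE)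
    define l where "l = - l'"
    have "\<alpha> * (n2 - l * \<nu>) - \<gamma> * (n1 - l * \<mu>) = (\<alpha> * n2 - \<gamma> * n1) - l * (\<alpha> * \<nu> - \<gamma> * \<mu>)"
      by (simp add: algebra_simps)
    then have o: "\<alpha> * (n2 - l * \<nu>) = \<gamma> * (n1 - l * \<mu>)" unfolding l' om l_def by simp
    then have "\<alpha> dvd \<gamma> * (n1 - l * \<mu>)" by (metis dvd_triv_left)
    then have "\<alpha> dvd n1 - l * \<mu>" using copr by (simp add: coprime_dvd_mult_right_iff)
    have "\<exists>i. n1 - l * \<mu> = i * \<alpha> \<and> n2 - l * \<nu> = i * \<gamma>"
    proof (cases "\<alpha> = 0")
      case True
      then have g: "\<gamma> = 1 \<or> \<gamma> = -1" using copr by auto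
      then have "n1 - l * \<mu> = 0" using o True by auto
      moreover have "n2 - l * \<nu> = ((n2 - l * \<nu>) * \<gamma>) * \<gamma>" using g by auto
      ultimately show ?thesis using True by (intro exI[of _ "(n2 - l * \<nu>) * \<gamma>"]) simp
    next
      case False
      obtain i where i: "n1 - l * \<mu> = \<alpha> * i" using \<open>\<alpha> dvd n1 - l * \<mu>\<close> by (elim dvdE)
      then have "\<alpha> * (n2 - l * \<nu>) = \<alpha> * (i * \<gamma>)" using o by (simp add: algebra_simps)
      then have "n2 - l * \<nu> = i * \<gamma>" using False by simp
      with i show ?thesis by (intro exI[of _ i]) simp
    qed
    then obtain i where i: "n1 = i * \<alpha> + l * \<mu>" "n2 = i * \<gamma> + l * \<nu>" by (metis diff_eq_eq)
    define x' where "x' = x - i * s + l * k'"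
    define z' where "z' = z - i * (m * s * a) - l * (m * (b - 2 * a * k') + k' * (m * a))"
    have "?P e (x', z', 0, 0) = ?P e Y - i * ?P e e - l * ?P e v2"
      unfolding Ye i x'_def z'_def e_def v2_def by (simp add: algebra_simps)
    then have "?P e (x', z', 0, 0) = 0" using Y ee v2(1) by simp
    then have "s * (z' + m * a * x') = s * 0" unfolding e_def by (simp add: algebra_simps)
    then have "z' + m * a * x' = 0" by (rule s_cancel)
    then have "z' = - x' * (m * a)" by (simp add: algebra_simps)
    then have "Y = (i * s - (- x') - l * k', i * (m * s * a) + (- x') * (m * a) + l * (m * (b - 2 * a * k') + k' * (m * a)), i * \<alpha> + l * \<mu>, i * \<gamma> + l * \<nu>)"
      unfolding Ye i z'_def x'_def by simp
    then show ?thesis by blast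
  qed
  text \<open>A vector \<open>g\<close> with \<open>e \<cdot> g = 1\<close> splits off a hyperbolic plane.\<close>
  have "\<exists>g. ?P e g = 1"
  proof -
    obtain n2 n1 where n: "n2 * \<alpha> + n1 * \<gamma> = 1" using copr by (metis bezout_int coprime_iff_gcd_eq_1)
    \<comment> \<open>Modulo \<open>s\<close> the product \<open>k h\<close> is
      \<open>- m t\<close>, so \<open>h\<close> is prime to \<open>s\<close>. Both \<open>s\<close>
      and \<open>h\<close> are values of the pairing with \<open>e\<close>, hence so is 1.\<close>
    define h where "h = ?P e (0, 0, - n1, n2)"
    have kh: "k * h = - m * (t + 2 * s^2 * n2)"
    proof -
      have n': "\<alpha> * n2 - \<gamma> * - n1 = 1" using n by (simp add: mult.commute)
      show ?thesis unfolding h_def kform n' by simp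
    qed
    have "coprime s h"
    proof (rule coprimeI)
      fix d assume d: "d dvd s" "d dvd h"
      then have "d dvd k * h" by simp
      also have "k * h = - (m * t + s * (2 * m * s * n2))" unfolding kh by (simp add: algebra_simps power2_eq_square)
      finally have "d dvd m * t + s * (2 * m * s * n2)" by (simp only: dvd_minus_iff)
      then have "d dvd m * t" using d(1) by (simp add: dvd_add_left_iff)
      moreover have "coprime d (m * t)"
        using coprime_divisors[OF d(1) dvd_refl cop(1)] coprime_divisors[OF d(1) dvd_refl cop(2)] by simp
      ultimately show "is_unit d" by (metis coprime_common_divisor dvd_refl)
    qed
    then obtain u v where uv: "u * s + v * h = 1" by (metis bezout_int coprime_iff_gcd_eq_1)
    have "?P e (0, u, - v * n1, v * n2) = u * s + v * h" unfolding h_def e_def by (simp add: algebra_simps)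
    then show ?thesis using uv by metis
  qed
  then obtain g where g: "?P e g = 1" by blast
  have padd: "?P (x + y) z = ?P x z + ?P y z" "?P z (x + y) = ?P z x + ?P z y" for x y z
    by (cases x; cases y; cases z; simp add: algebra_simps)+
  have psym: "?P x y = ?P y x" for x y by (cases x; cases y) (simp add: algebra_simps)
  define sm where "sm = (\<lambda>(i::int) (x::int4). case x of (p, q, r, s) \<Rightarrow> (i * p, i * q, i * r, i * s))"
  have psm: "?P (sm i x) y = i * ?P x y" "?P y (sm i x) = i * ?P y x" for i x y
    by (cases x; cases y; simp add: sm_def algebra_simps)+
  have sma: "sm (i + j) x = sm i x + sm j x" "sm i (x + y) = sm i x + sm i y" "sm i (sm j x) = sm (i * j) x" for i j x y
    by (cases x; cases y; simp add: sm_def algebra_simps)+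
  have "even (?P g g)" by (cases g) simp
  then obtain G where G: "?P g g = 2 * G" by (elim evenE)
  define f where "f = g + sm (- G) e"
  have ef: "?P e f = 1" "?P f f = 0" "?P f e = 1"
    using g G ee psym[of g e] psym[of f e] unfolding f_def by (simp_all only: padd psm, (simp_all)?)
  define u1 where "u1 = v1 + sm (- ?P v1 f) e"
  define u2 where "u2 = v2 + sm (- ?P v2 f) e"
  have uu: "?P e u1 = 0" "?P e u2 = 0" "?P f u1 = 0" "?P f u2 = 0" "?P u1 u1 = - 2 * (m * a)"
     "?P u1 u2 = - (m * b)" "?P u2 u1 = - (m * b)" "?P u2 u2 = - 2 * (m * c)" "?P u1 e = 0" "?P u2 e = 0" "?P u1 f = 0" "?P u2 f = 0"
    using ee ef ev1 v2 psym[of f v1] psym[of f v2] psym[of v1 e] psym[of v2 e] psym[of v2 v1] unfolding u1_def u2_def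
    by (simp_all only: padd psm, (simp_all)?)
  define \<phi> where "\<phi> = (\<lambda>(p, q, x, y). sm p e + sm q f + sm x u1 + sm y u2)"
  have \<phi>_pair: "?P (\<phi> T) (\<phi> U) = pair4 (- (m * a)) (- (m * b)) (- (m * c)) T U" for T U
    by (cases T; cases U) (simp only: \<phi>_def prod.case padd psm ee ef uu pair4.simps, (simp add: algebra_simps)?)
  have \<phi>_add: "\<phi> (T + U) = \<phi> T + \<phi> U" for T U
    by (cases T; cases U) (simp only: \<phi>_def prod.case add_Pair sma ac_simps)
  have \<phi>_inj: "inj \<phi>"
  proof (rule injI)
    fix T U assume eq: "\<phi> T = \<phi> U"
    obtain p q x y where T: "T = (p, q, x, y)" by (cases T)
    obtain p' q' x' y' where U: "U = (p', q', x', y')" by (cases U)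
    have al: "pair4 (- (m * a)) (- (m * b)) (- (m * c)) T V = pair4 (- (m * a)) (- (m * b)) (- (m * c)) U V" for V
      unfolding \<phi>_pair[symmetric] eq ..
    have pq: "p = p'" "q = q'" using al[of "(0, 1, 0, 0)"] al[of "(1, 0, 0, 0)"] by (simp_all add: T U)
    have "m * (2 * a * (x - x') + b * (y - y')) = 0" "m * (b * (x - x') + 2 * c * (y - y')) = 0"
      using al[of "(0, 0, 1, 0)"] al[of "(0, 0, 0, 1)"] by (simp_all add: T U algebra_simps)
    moreover have "m * (b^2 - 4 * a * c) * (x - x') = b * (m * (b * (x - x') + 2 * c * (y - y'))) - 2 * c * (m * (2 * a * (x - x') + b * (y - y')))"
      "m * (b^2 - 4 * a * c) * (y - y') = b * (m * (2 * a * (x - x') + b * (y - y'))) - 2 * a * (m * (b * (x - x') + 2 * c * (y - y')))"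
      by (simp_all add: algebra_simps power2_eq_square)
    ultimately have "m * (b^2 - 4 * a * c) * (x - x') = 0" "m * (b^2 - 4 * a * c) * (y - y') = 0" by (simp_all only: mult_zero_right diff_self)
    then have "x = x'" "y = y'" using nondeg by simp_all
    with pq show "T = U" by (simp add: T U)
  qed
  have \<phi>_surj: "\<exists>T. X = \<phi> T" for X
  proof -
    define Y where "Y = X + sm (- ?P e X) f"
    have "?P e Y = 0" unfolding Y_def by (simp only: padd psm ef, (simp)?)
    then obtain i j l where Y: "Y = (i * s - j - l * k', i * (m * s * a) + j * (m * a) + l * (m * (b - 2 * a * k') + k' * (m * a)), i * \<alpha> + l * \<mu>, i * \<gamma> + l * \<nu>)"
      using perp by blast
    have "Y = sm i e + (sm j v1 + sm l v2)" unfolding Y by (simp add: sm_def e_def v1_def v2_def algebra_simps)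
    also have "\<dots> = sm (i + j * ?P v1 f + l * ?P v2 f) e + sm j u1 + sm l u2"
      unfolding u1_def u2_def sma by (cases e; cases v1; cases v2) (simp add: sm_def algebra_simps)
    finally have Y2: "Y = sm (i + j * ?P v1 f + l * ?P v2 f) e + sm j u1 + sm l u2" .
    have "X = Y + sm (?P e X) f" unfolding Y_def by (cases X; cases f) (simp add: sm_def)
    also have "\<dots> = \<phi> (i + j * ?P v1 f + l * ?P v2 f, ?P e X, j, l)"
      unfolding Y2 \<phi>_def prod.case by (simp only: ac_simps)
    finally show ?thesis by blast
  qed
  have "bij \<phi>" using \<phi>_inj \<phi>_surj by (simp add: bij_def surj_def)
  then show ?thesis unfolding iso4_def using \<phi>_add \<phi>_pair by (intro exI[of _ \<phi>] conjI allI)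
qed

section \<open>Binary quadratic forms and sums of two squares\<close>

lemma coprime_int_primeI:
  fixes a b :: int
  assumes "\<And>p. prime p \<Longrightarrow> p dvd a \<Longrightarrow> p dvd b \<Longrightarrow> False" "b \<noteq> 0"
  shows "coprime a b"
proof (rule ccontr)
  assume "\<not> coprime a b"
  then have "\<not> is_unit (gcd a b)" by (simp add: coprime_iff_gcd_eq_1)
  moreover have "gcd a b \<noteq> 0" using assms(2) by simp
  ultimately obtain p where "p dvd gcd a b" "prime p" using prime_divisor_exists by blast
  then show False using assms(1)[of p] by simp
qed

lemma prime_dvd_prod_prime_factors:
  fixes n p :: int
  assumes "prime p" "n \<noteq> 0"
  shows "p dvd \<Prod>{q \<in> prime_factors n. P q} \<longleftrightarrow> p dvd n \<and> P p"
proof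
  assume "p dvd \<Prod>{q \<in> prime_factors n. P q}"
  then obtain q where q: "q \<in> prime_factors n" "P q" "p dvd q"
    using prime_dvd_prod_iff[of "{q \<in> prime_factors n. P q}" p "\<lambda>x. x"] assms(1) by auto
  then have "prime q" by (auto simp: prime_factors_dvd)
  then have "p = q" using primes_dvd_imp_eq[OF assms(1)] q(3) by blast
  then show "p dvd n \<and> P p" using q by (auto simp: prime_factors_dvd)
next
  assume "p dvd n \<and> P p"
  then have "p \<in> {q \<in> prime_factors n. P q}" using assms by (simp add: prime_factors_dvd)
  then show "p dvd \<Prod>{q \<in> prime_factors n. P q}"
    using dvd_prod_eqI[of "{q \<in> prime_factors n. P q}" p p "\<lambda>x. x"] by simp
qed

text \<open>The primes of \<open>n\<close> are sorted by the coefficient that they miss: those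
  missing \<open>a\<close> divide \<open>q\<close> only, those dividing \<open>a\<close> but not
  \<open>c\<close> divide \<open>p\<close> only, those dividing both divide neither \<open>p\<close>
  nor \<open>q\<close>. In each case just one of the three terms of the value is a unit modulo the
  prime, and the others vanish.\<close>

lemma primitive_form_represents_coprime:
  fixes a b c n :: int
  assumes prim: "\<And>d. d dvd a \<Longrightarrow> d dvd b \<Longrightarrow> d dvd c \<Longrightarrow> is_unit d" and n: "n \<noteq> 0"
  obtains p q u v where "p * v - q * u = 1" "coprime (a * p^2 + b * p * q + c * q^2) n"
proof -
  define q where "q = \<Prod>{r \<in> prime_factors n. \<not> r dvd a}"
  define p where "p = \<Prod>{r \<in> prime_factors n. r dvd a \<and> \<not> r dvd c}"
  have dq: "r dvd q \<longleftrightarrow> r dvd n \<and> \<not> r dvd a" and dp: "r dvd p \<longleftrightarrow> r dvd n \<and> r dvd a \<and> \<not> r dvd c"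
    if "prime r" for r using prime_dvd_prod_prime_factors[OF that n] by (simp_all add: q_def p_def)
  have q0: "q \<noteq> 0" by (auto simp: q_def prime_factors_dvd)
  have "coprime p q"
  proof (rule coprime_int_primeI[OF _ q0])
    show False if "prime r" "r dvd p" "r dvd q" for r using dp[OF that(1)] dq[OF that(1)] that(2,3) by blast
  qed
  then obtain v u' where vu: "v * p + u' * q = 1" by (metis bezout_int coprime_iff_gcd_eq_1)
  have "coprime (a * p^2 + b * p * q + c * q^2) n"
  proof (rule coprime_int_primeI[OF _ n])
    fix r assume r: "prime r" "r dvd a * p^2 + b * p * q + c * q^2" "r dvd n"
    have pd: "r dvd x * y \<Longrightarrow> r dvd x \<or> r dvd y" "r dvd x^2 \<Longrightarrow> r dvd x" for x y
      using prime_dvd_mult_iff[OF r(1)] prime_dvd_power[OF r(1)] by blast+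
    consider "\<not> r dvd a" | "r dvd a" "\<not> r dvd c" | "r dvd a" "r dvd c" by blast
    then show False
    proof cases
      case 1
      then have "r dvd q" "\<not> r dvd p" using dq[OF r(1)] dp[OF r(1)] r(3) by auto
      moreover have "r dvd b * p * q + c * q^2" using \<open>r dvd q\<close> by (simp add: power2_eq_square)
      then have "r dvd a * p^2" using r(2) dvd_add_left_iff[of r "b * p * q + c * q^2" "a * p^2"] by (simp add: add.assoc)
      ultimately show False using 1 pd by blast
    next
      case 2
      then have "r dvd p" "\<not> r dvd q" using dq[OF r(1)] dp[OF r(1)] r(3) by auto
      moreover have "r dvd a * p^2 + b * p * q" using \<open>r dvd p\<close> by (simp add: power2_eq_square)
      then have "r dvd c * q^2" using r(2) dvd_add_right_iff[of r "a * p^2 + b * p * q"] by blast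
      ultimately show False using 2 pd by blast
    next
      case 3
      then have "\<not> r dvd b" using prim[of r] r(1) not_prime_unit by blast
      have "\<not> r dvd p" "\<not> r dvd q" using 3 dq[OF r(1)] dp[OF r(1)] by auto
      have "r dvd b * p * q + (a * p^2 + c * q^2)" using r(2) by (simp add: ac_simps)
      moreover have "r dvd a * p^2 + c * q^2" using 3 by simp
      ultimately have "r dvd b * p * q" using dvd_add_left_iff by blast
      then show False using \<open>\<not> r dvd b\<close> \<open>\<not> r dvd p\<close> \<open>\<not> r dvd q\<close> pd by blast
    qed
  qed
  moreover have "p * v - q * (- u') = 1" using vu by (simp add: mult.commute)
  ultimately show ?thesis using that by blast
qed

section \<open>Square roots of -1 and sums of two squares\<close>

lemma minus_one_square_mod_prime:
  fixes p :: nat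
  assumes p: "prime p" "odd p"
  shows "(\<exists>y::int. int p dvd y^2 + 1) \<longleftrightarrow> p mod 4 = 1"
proof -
  have p2: "2 < p" using p prime_ge_2_nat[OF p(1)] by (cases "p = 2") auto
  have QR: "QuadRes (int p) (-1) \<longleftrightarrow> (\<exists>y::int. int p dvd y^2 + 1)"
    by (simp add: QuadRes_def cong_iff_dvd_diff)
  have nz: "\<not> [-1 = 0] (mod int p)" using p2 by (simp add: cong_0_iff zdvd_not_zless)
  have L: "Legendre (-1) (int p) = (if QuadRes (int p) (-1) then 1 else -1)"
    using nz by (simp add: Legendre_def)
  have e: "[Legendre (-1) (int p) = (-1) ^ ((p - 1) div 2)] (mod int p)"
    using euler_criterion[OF p(1) p2] by simp
  have ne: "\<not> [1 = -1] (mod int p)" "\<not> [-1 = 1] (mod int p)"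
    using p2 by (auto simp: cong_iff_dvd_diff zdvd_not_zless)
  have par: "even ((p - 1) div 2) \<longleftrightarrow> p mod 4 = 1" using p(2) by presburger
  show ?thesis
  proof (cases "even ((p - 1) div 2)")
    case True
    then have "[Legendre (-1) (int p) = 1] (mod int p)" using e by simp
    then show ?thesis using L ne True par QR by (auto split: if_splits)
  next
    case False
    then have "[Legendre (-1) (int p) = -1] (mod int p)" using e by simp
    then show ?thesis using L ne False par QR by (auto split: if_splits)
  qed
qed

text \<open>The root is built up one prime factor at a time: by the Chinese remainder theorem for a
  new odd prime, by a Newton step for a repeated one. The prime 2 occurs at most once and is a
  matter of parity.\<close>

lemma minus_one_square_mod:
  fixes n :: nat
  assumes "n > 0" "\<not> 4 dvd n" "\<And>p. prime p \<Longrightarrow> p dvd n \<Longrightarrow> p mod 4 \<noteq> 3"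
  shows "\<exists>w::int. int n dvd w^2 + 1"
  using assms
proof (induction n rule: less_induct)
  case (less n)
  show ?case
  proof (cases "n = 1")
    case False
    then obtain p where p: "prime p" "p dvd n" using prime_factor_nat by blast
    then obtain n' where n: "n = p * n'" by (elim dvdE)
    have "n' < n" "n' > 0" using less.prems(1) prime_gt_1_nat[OF p(1)] n by auto
    moreover have "\<not> 4 dvd n'" using less.prems(2) unfolding n by (meson dvd_mult)
    moreover have "q mod 4 \<noteq> 3" if "prime q" "q dvd n'" for q using less.prems(3)[OF that(1)] that(2) n by simp
    ultimately obtain w :: int where w: "int n' dvd w^2 + 1" using less.IH by blast
    show ?thesis
    proof (cases "p = 2")
      case True
      have "odd n'" using less.prems(2) unfolding n True by auto
      \<comment> \<open>\<open>n'\<close> is odd, so adding it changes the parity of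
        \<open>w\<close> and keeps its class modulo \<open>n'\<close>.\<close>
      define x where "x = (if odd w then w else w + int n')"
      have "odd x" using \<open>odd n'\<close> by (simp add: x_def)
      have "int n' dvd x^2 + 1"
      proof -
        have "(w + int n')^2 + 1 = (w^2 + 1) + int n' * (2 * w + int n')" by (simp add: algebra_simps power2_eq_square)
        moreover have "int n' dvd (w^2 + 1) + int n' * (2 * w + int n')" by (rule dvd_add[OF w dvd_triv_left])
        ultimately show ?thesis using w unfolding x_def
          by (cases "odd w") (simp_all only: if_True if_False simp_thms)
      qed
      moreover have x2: "2 dvd x^2 + 1" using \<open>odd x\<close> by simp
      moreover have c2: "coprime (2::int) (int n')" using \<open>odd n'\<close> by simp
      ultimately have "2 * int n' dvd x^2 + 1" by (intro divides_mult)
      then show ?thesis unfolding n True by auto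
    next
      case False
      then have "odd p" using p(1) prime_odd_nat prime_ge_2_nat[OF p(1)] by (metis le_neq_implies_less)
      moreover have "p mod 4 \<noteq> 3" using less.prems(3) p by blast
      ultimately have "p mod 4 = 1" by presburger
      then obtain v :: int where v: "int p dvd v^2 + 1" using minus_one_square_mod_prime[OF p(1) \<open>odd p\<close>] by blast
      show ?thesis
      proof (cases "p dvd n'")
        case False
        then have cop: "coprime (int p) (int n')" using p(1) by (simp add: prime_imp_coprime)
        then obtain x where x: "[x = v] (mod int p)" "[x = w] (mod int n')"
          using binary_chinese_remainder_int by blast
        have "int p dvd x^2 + 1" using v x(1) by (meson cong_add_rcancel cong_dvd_iff cong_pow)
        moreover have "int n' dvd x^2 + 1" using w x(2) by (meson cong_add_rcancel cong_dvd_iff cong_pow)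
        ultimately have "int p * int n' dvd x^2 + 1" using cop by (rule divides_mult)
        then show ?thesis unfolding n by auto
      next
        case True
        obtain e where e: "w^2 + 1 = int n' * e" using w by (elim dvdE)
        have pn: "int p dvd int n'" using True by simp
        have "\<not> int p dvd w"
        proof
          assume "int p dvd w"
          then have "int p dvd w^2" by (simp add: power2_eq_square)
          moreover have "int p dvd w^2 + 1" using pn w by (rule dvd_trans)
          ultimately have "int p dvd 1" using dvd_add_right_iff by blast
          then show False using p(1) by auto
        qed
        moreover have "\<not> int p dvd 2" using \<open>odd p\<close> p(1) by (metis False int_dvd_int_iff of_nat_numeral primes_dvd_imp_eq two_is_prime_nat)
        ultimately have "\<not> int p dvd 2 * w" using p(1) prime_dvd_mult_iff[of "int p" 2 w] by (metis prime_int_nat_transfer prime_nat_int_transfer)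
        then have "coprime (int p) (2 * w)" using p(1) by (intro prime_imp_coprime) simp_all
        then obtain i j where ij: "i * int p + j * (2 * w) = 1" by (metis bezout_int coprime_iff_gcd_eq_1)
        \<comment> \<open>Newton step: \<open>j\<close> inverts the derivative \<open>2 * w\<close>
          modulo \<open>p\<close>.\<close>
        define z where "z = - (j * e)"
        have "e + 2 * w * z = e * (1 - j * (2 * w))" by (simp add: z_def algebra_simps)
        also have "1 - j * (2 * w) = i * int p" using ij by simp
        finally have "int p dvd e + 2 * w * z + int n' * z^2" using pn by simp
        then have "int n' * int p dvd int n' * (e + 2 * w * z + int n' * z^2)" by (rule mult_dvd_mono[OF dvd_refl])
        also have "int n' * (e + 2 * w * z + int n' * z^2) = (w + int n' * z)^2 + 1"
          using e by (simp add: algebra_simps power2_eq_square)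
        finally show ?thesis unfolding n by (intro exI[of _ "w + int n' * z"]) (simp add: mult.commute)
      qed
    qed
  qed simp
qed

text \<open>Reduction of the binary form \<open>(n, 2w, n')\<close> of discriminant \<open>-4\<close>.\<close>

lemma two_squares_descent:
  fixes n n' w :: int
  assumes "n * n' = w^2 + 1" "n > 0"
  shows "\<exists>u v x y. n = u^2 + v^2 \<and> n' = x^2 + y^2 \<and> w = u * x + v * y \<and> u * y - v * x = 1"
  using assms
proof (induction "nat \<bar>w\<bar>" arbitrary: n n' w rule: less_induct)
  case less
  have n'0: "n' > 0"
  proof -
    have "n * n' > 0" using less.prems(1) zero_le_power2[of w] by linarith
    then show ?thesis using less.prems(2) by (simp add: zero_less_mult_iff)
  qed
  have step: "\<exists>u v x y. n = u^2 + v^2 \<and> n' = x^2 + y^2 \<and> w = u * x + v * y \<and> u * y - v * x = 1"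
    if n: "n * n' = w^2 + 1" "0 < n" "n \<le> \<bar>w\<bar>" for n n'
  proof -
    \<comment> \<open>Passing from \<open>w\<close> to \<open>w - \<epsilon> * n\<close> is a
      unimodular substitution in the form \<open>(n, 2w, n')\<close>; the sign is the one that
      decreases \<open>|w|\<close>.\<close>
    define \<epsilon> where "\<epsilon> = sgn w"
    have w: "w \<noteq> 0" using n by auto
    then have e: "\<epsilon>^2 = 1" "\<epsilon> * w = \<bar>w\<bar>" "\<epsilon> = 1 \<or> \<epsilon> = -1" by (auto simp: \<epsilon>_def sgn_if)
    have small: "\<bar>w - \<epsilon> * n\<bar> < \<bar>w\<bar>"
    proof (cases "w > 0")
      case True
      then have "\<epsilon> = 1" by (simp add: \<epsilon>_def)
      then show ?thesis using True n(2,3) by simp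
    next
      case False
      then have "\<epsilon> = -1" using w by (simp add: \<epsilon>_def)
      then show ?thesis using False n(2,3) by simp
    qed
    have "n * (n' - 2 * \<epsilon> * w + n) = (w - \<epsilon> * n)^2 + 1"
    proof -
      have "(w - \<epsilon> * n)^2 + 1 = w^2 + 1 - 2 * \<epsilon> * w * n + \<epsilon>^2 * n^2" by (simp add: algebra_simps power2_eq_square)
      then show ?thesis using n(1) e(1) by (simp add: algebra_simps power2_eq_square)
    qed
    moreover have "nat \<bar>w - \<epsilon> * n\<bar> < nat \<bar>w\<bar>" using small by simp
    ultimately obtain u v x y where IH: "n = u^2 + v^2" "n' - 2 * \<epsilon> * w + n = x^2 + y^2" "w - \<epsilon> * n = u * x + v * y" "u * y - v * x = 1"
      using less.hyps[of "w - \<epsilon> * n" n "n' - 2 * \<epsilon> * w + n"] n(2) by blast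
    have w': "w = u * x + v * y + \<epsilon> * n" using IH(3) by simp
    have "n' = x^2 + y^2 + 2 * \<epsilon> * w - n" using IH(2) by simp
    also have "\<dots> = x^2 + y^2 + 2 * \<epsilon> * (u * x + v * y) + 2 * \<epsilon>^2 * n - n"
      unfolding w' by (simp add: algebra_simps power2_eq_square)
    also have "\<dots> = x^2 + y^2 + 2 * \<epsilon> * (u * x + v * y) + \<epsilon>^2 * (u^2 + v^2)" unfolding e(1) IH(1) by simp
    also have "\<dots> = (x + \<epsilon> * u)^2 + (y + \<epsilon> * v)^2" by (simp add: algebra_simps power2_eq_square)
    finally have "n' = (x + \<epsilon> * u)^2 + (y + \<epsilon> * v)^2" .
    moreover have "w = u * (x + \<epsilon> * u) + v * (y + \<epsilon> * v)" unfolding w' IH(1) by (simp add: algebra_simps power2_eq_square)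
    moreover have "u * (y + \<epsilon> * v) - v * (x + \<epsilon> * u) = 1" using IH(4) by (simp add: algebra_simps)
    ultimately show ?thesis using IH(1) by blast
  qed
  show ?case
  proof (cases "w = 0")
    case True
    then have "n * n' = 1" using less.prems(1) by simp
    then have "n = 1 \<and> n' = 1" using pos_zmult_eq_1_iff[OF less.prems(2)] by blast
    then show ?thesis using True
      by (intro exI[of _ 1] exI[of _ 0] exI[of _ 0] exI[of _ 1]) simp
  next
    case False
    \<comment> \<open>If both outer coefficients exceeded \<open>|w|\<close>, their product would be
      at least \<open>(|w| + 1)^2\<close>, which is more than \<open>w^2 + 1\<close>.\<close>
    consider "n \<le> \<bar>w\<bar>" | "n' \<le> \<bar>w\<bar>"
    proof (cases "n \<le> \<bar>w\<bar> \<or> n' \<le> \<bar>w\<bar>")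
      case False
      then have "(\<bar>w\<bar> + 1) * (\<bar>w\<bar> + 1) \<le> n * n'" by (intro mult_mono) auto
      also have "\<dots> = \<bar>w\<bar>^2 + 1" using less.prems(1) by simp
      finally have "2 * \<bar>w\<bar> \<le> 0" by (simp add: algebra_simps power2_eq_square)
      then show ?thesis using \<open>w \<noteq> 0\<close> by simp
    qed (use that in blast)
    then show ?thesis
    proof cases
      case 1
      then show ?thesis using step less.prems by blast
    next
      case 2
      have "n' * n = w^2 + 1" using less.prems(1) by (simp add: mult.commute)
      then obtain u v x y where "n' = u^2 + v^2" "n = x^2 + y^2" "w = u * x + v * y" "u * y - v * x = 1"
        using step[of n' n] n'0 2 by blast
      then show ?thesis by (intro exI[of _ y] exI[of _ x] exI[of _ v] exI[of _ u]) (simp add: algebra_simps)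
    qed
  qed
qed

text \<open>The descent returns a matrix of determinant 1 with first row \<open>(u, v)\<close>, and
  this is where coprimality comes from.\<close>

lemma primitive_two_squares:
  fixes n :: int
  assumes "n > 0" "\<not> 4 dvd n" "\<And>p. prime p \<Longrightarrow> int p dvd n \<Longrightarrow> p mod 4 \<noteq> 3"
  obtains u v where "n = u^2 + v^2" "coprime u v"
proof -
  have "int (nat n) = n" using assms(1) by simp
  obtain w :: int where "n dvd w^2 + 1"
    using minus_one_square_mod[of "nat n"] assms \<open>int (nat n) = n\<close>
    by (metis int_dvd_int_iff of_nat_numeral zero_less_nat_eq)
  then obtain n' where "n * n' = w^2 + 1" by (metis dvdE)
  then obtain u v x y where "n = u^2 + v^2" "u * y - v * x = 1" using two_squares_descent assms(1) by blast
  moreover have "coprime u v"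
  proof (rule coprimeI)
    fix d assume "d dvd u" "d dvd v"
    then have "d dvd u * y - v * x" by simp
    then show "is_unit d" using \<open>u * y - v * x = 1\<close> by simp
  qed
  ultimately show ?thesis using that by blast
qed

text \<open>The arithmetic condition on the discriminant of the primitive part of \<open>NS\<close> to which both sides
  of the theorem are equivalent.\<close>

definition good_disc :: "int \<Rightarrow> bool" where
  "good_disc D \<longleftrightarrow> (\<forall>p::nat. prime p \<longrightarrow> p mod 4 = 3 \<longrightarrow> \<not> int p dvd D) \<and> \<not> 16 dvd D"

text \<open>For odd \<open>D\<close> one of the two squares is even and supplies \<open>2s\<close>.
  For even \<open>D\<close> the number \<open>D/4\<close> is a sum of two coprime squares; an odd
  one of the two is chosen as \<open>s\<close>, so that it stays prime to \<open>t\<close>, which is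
  twice the other.\<close>

lemma good_disc_two_squares:
  fixes b e D :: int
  assumes D: "D = b^2 - 4 * e" "D > 0" and g: "good_disc D"
  obtains t s where "t^2 + 4 * s^2 = D" "coprime s t"
proof (cases "even b")
  case False
  have "odd D" using False by (simp add: D(1))
  have "\<not> 4 dvd D"
  proof
    assume "4 dvd D"
    then have "2 dvd D" by (rule dvd_trans[rotated]) simp
    then show False using \<open>odd D\<close> by simp
  qed
  then obtain u v where uv: "D = u^2 + v^2" "coprime u v"
    using primitive_two_squares[OF D(2)] g unfolding good_disc_def by blast
  have "odd (u^2 + v^2)" using \<open>odd D\<close> uv(1) by simp
  then consider "even u" "odd v" | "even v" "odd u" by auto
  then show ?thesis
  proof cases
    case 1
    then obtain s where s: "u = 2 * s" by (elim evenE)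
    have "coprime s v" using uv(2) unfolding s by simp
    then show ?thesis using uv(1) by (intro that[of v s]) (simp_all add: s power_mult_distrib)
  next
    case 2
    then obtain s where s: "v = 2 * s" by (elim evenE)
    have "coprime s u" using uv(2) unfolding s by (simp add: coprime_commute)
    then show ?thesis using uv(1) by (intro that[of u s]) (simp_all add: s power_mult_distrib)
  qed
next
  case True
  then obtain b' where b': "b = 2 * b'" by (elim evenE)
  define \<Delta> where "\<Delta> = b'^2 - e"
  have D4: "D = 4 * \<Delta>" by (simp add: D(1) b' \<Delta>_def power_mult_distrib)
  have "\<Delta> > 0" using D(2) D4 by simp
  moreover have "\<not> 4 dvd \<Delta>"
  proof
    assume "4 dvd \<Delta>"
    then have "4 * 4 dvd D" unfolding D4 by (rule mult_dvd_mono[OF dvd_refl])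
    then show False using g by (simp add: good_disc_def)
  qed
  moreover have "p mod 4 \<noteq> 3" if "prime p" "int p dvd \<Delta>" for p
    using g that unfolding good_disc_def D4 by (meson dvd_mult)
  ultimately obtain u v where uv: "\<Delta> = u^2 + v^2" "coprime u v" using primitive_two_squares by blast
  have "odd u \<or> odd v" using uv(2) by (meson coprime_common_divisor odd_one)
  then show ?thesis
  proof
    assume "odd u"
    have "coprime u (2 * v)" using uv(2) \<open>odd u\<close> by simp
    then show ?thesis using uv(1) D4 by (intro that[of "2 * v" u]) (simp_all add: power_mult_distrib)
  next
    assume "odd v"
    have "coprime v (2 * u)" using uv(2) \<open>odd v\<close> by (simp add: coprime_commute)
    then show ?thesis using uv(1) D4 by (intro that[of "2 * u" v]) (simp_all add: power_mult_distrib)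
  qed
qed

text \<open>Multiplying \<open>t\<^sub>0 + 2 s\<^sub>0 \<i>\<close> by the square of \<open>1 + y \<i>\<close> changes \<open>s\<^sub>0\<close> while multiplying the norm by a square.\<close>

lemma two_squares_coprime_scaled:
  fixes D n t0 s0 :: int
  assumes D: "t0^2 + 4 * s0^2 = D" "coprime s0 t0" "D > 0" and n: "n \<noteq> 0"
  obtains t s k where "t^2 + 4 * s^2 = k^2 * D" "s \<noteq> 0" "coprime s n" "coprime s t" "coprime s k"
proof -
  define N where "N = 2 * n * D"
  have N0: "N \<noteq> 0" using D(3) n by (simp add: N_def)
  \<comment> \<open>\<open>y\<close> collects the primes of \<open>N\<close> that miss
    \<open>s0\<close>. Modulo these the new \<open>s\<close> is \<open>s0\<close>, and modulo the
    other primes of \<open>N\<close> it is \<open>t0 * y\<close>; both are units there.\<close>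
  define y where "y = \<Prod>{r \<in> prime_factors N. \<not> r dvd s0}"
  have dy: "r dvd y \<longleftrightarrow> r dvd N \<and> \<not> r dvd s0" if "prime r" for r
    using prime_dvd_prod_prime_factors[OF that N0] by (simp add: y_def)
  define s where "s = t0 * y + s0 * (1 - y^2)"
  define t where "t = t0 * (1 - y^2) - 4 * s0 * y"
  define k where "k = 1 + y^2"
  have rep: "t^2 + 4 * s^2 = k^2 * D"
    unfolding D(1)[symmetric] s_def t_def k_def by (simp add: algebra_simps power2_eq_square)
  have sN: "coprime s N"
  proof (rule coprime_int_primeI[OF _ N0])
    fix r assume r: "prime r" "r dvd s" "r dvd N"
    show False
    proof (cases "r dvd s0")
      case False
      then have "r dvd y" using dy r by blast
      then have "r dvd y * (t0 - s0 * y)" by simp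
      moreover have "s = s0 + y * (t0 - s0 * y)" by (simp add: s_def algebra_simps power2_eq_square)
      ultimately show False using False r(2) by (simp add: dvd_add_left_iff)
    next
      case True
      then have "\<not> r dvd y" using dy r by blast
      have "r dvd t0 * y" using r(2) True unfolding s_def by (simp add: dvd_add_left_iff)
      then have "r dvd t0" using \<open>\<not> r dvd y\<close> prime_dvd_mult_iff[OF r(1)] by blast
      then have "is_unit r" using True D(2) by (metis coprime_common_divisor)
      then show False using r(1) not_prime_unit by blast
    qed
  qed
  have s0': "s \<noteq> 0"
  proof
    assume "s = 0"
    then have "is_unit N" using sN by simp
    then have "(2::int) dvd 1" by (rule dvd_trans[rotated]) (simp add: N_def)
    then show False by simp
  qed
  \<comment> \<open>Once the common factor of \<open>t\<close>, \<open>s\<close>, \<open>k\<close>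
    is removed, a prime of \<open>s\<close> dividing one of the other two would divide both, because
    \<open>s\<close> is prime to \<open>D\<close>.\<close>
  define g where "g = gcd t (gcd s k)"
  have g0: "g \<noteq> 0" using s0' by (simp add: g_def)
  have "g dvd t" "g dvd s" "g dvd k" unfolding g_def by (auto intro: dvd_trans[OF gcd_dvd2])
  then obtain t1 s1 k1 where 1: "t = g * t1" "s = g * s1" "k = g * k1" by (metis dvdE)
  have "gcd t1 (gcd s1 k1) = 1"
  proof -
    have "g = gcd (g * t1) (gcd (g * s1) (g * k1))" unfolding 1[symmetric] by (rule g_def)
    moreover have "g > 0" using g0 unfolding g_def by (simp add: order_less_le)
    ultimately have "g * gcd t1 (gcd s1 k1) = g * 1"
      using gcd_mult_distrib_int[of g s1 k1] gcd_mult_distrib_int[of g t1 "gcd s1 k1"] by simp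
    then show ?thesis using g0 by (simp only: mult_cancel_left) simp
  qed
  then have nocommon: "is_unit r" if "r dvd t1" "r dvd s1" "r dvd k1" for r
    using that by (metis gcd_greatest)
  have "g^2 * (t1^2 + 4 * s1^2) = g^2 * (k1^2 * D)" using rep unfolding 1 by (simp add: algebra_simps power2_eq_square)
  then have rep1: "t1^2 + 4 * s1^2 = k1^2 * D" using g0 by simp
  have s1: "s1 \<noteq> 0" using s0' 1 by auto
  have "s1 dvd s" using 1 by simp
  then have s1N: "coprime s1 N" using sN by (meson coprime_divisors dvd_refl)
  have sn: "coprime s1 n" and sD: "coprime s1 D" using s1N by (simp_all add: N_def)
  have sk: "coprime s1 k1"
  proof (subst coprime_commute, rule coprime_int_primeI[OF _ s1])
    fix r assume r: "prime r" "r dvd k1" "r dvd s1"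
    then have "r dvd k1^2 * D - 4 * s1^2" by (simp add: power2_eq_square)
    then have "r dvd t1^2" using rep1 by (simp add: eq_diff_eq[symmetric])
    then have "r dvd t1" using r(1) prime_dvd_power by blast
    then show False using nocommon r not_prime_unit by blast
  qed
  have st: "coprime s1 t1"
  proof (subst coprime_commute, rule coprime_int_primeI[OF _ s1])
    fix r assume r: "prime r" "r dvd t1" "r dvd s1"
    then have "r dvd t1^2 + 4 * s1^2" by (simp add: power2_eq_square)
    then have "r dvd k1^2 * D" using rep1 by simp
    moreover have "\<not> r dvd D" using sD r by (metis coprime_common_divisor not_prime_unit)
    ultimately have "r dvd k1" using r(1) prime_dvd_mult_iff prime_dvd_power by blast
    then show False using nocommon r not_prime_unit by blast
  qed
  show ?thesis by (rule that[OF rep1 s1 sn st sk])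
qed

theorem good_disc_imp_iso4:
  fixes a b c m :: int
  assumes prim: "\<And>d. d dvd a \<Longrightarrow> d dvd b \<Longrightarrow> d dvd c \<Longrightarrow> is_unit d" and m: "m \<noteq> 0"
    and D: "b^2 - 4 * a * c > 0" and g: "good_disc (b^2 - 4 * a * c)"
  shows "iso4 (- (m * a)) (- (m * b)) (- (m * c)) (m * a) (m * b) (m * c)"
proof -
  have "b^2 - 4 * a * c = b^2 - 4 * (a * c)" by simp
  from good_disc_two_squares[OF this D g]
  obtain t0 s0 where 0: "t0^2 + 4 * s0^2 = b^2 - 4 * a * c" "coprime s0 t0" .
  obtain t s k where r: "t^2 + 4 * s^2 = k^2 * (b^2 - 4 * a * c)" "s \<noteq> 0" "coprime s m" "coprime s t" "coprime s k"
    using two_squares_coprime_scaled[OF 0 D m] .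
  \<comment> \<open>The leading coefficient has to be prime to \<open>s\<close>, which is known only
    now; so the basis is changed after \<open>s\<close> has been chosen.\<close>
  obtain p q u v where pq: "p * v - q * u = 1" "coprime (a * p^2 + b * p * q + c * q^2) s"
    by (rule primitive_form_represents_coprime[OF prim r(2)])
  define a' where "a' = a * p^2 + b * p * q + c * q^2"
  define b' where "b' = 2 * a * p * u + b * (p * v + q * u) + 2 * c * q * v"
  define c' where "c' = a * u^2 + b * u * v + c * v^2"
  have "b'^2 - 4 * a' * c' = (p * v - q * u)^2 * (b^2 - 4 * a * c)"
    unfolding a'_def b'_def c'_def by (simp add: algebra_simps power2_eq_square)
  then have D': "b'^2 - 4 * a' * c' = b^2 - 4 * a * c" unfolding pq(1) by simp
  have iso: "iso4 (m * a') (m * b') (m * c') (m * a) (m * b) (m * c)" for m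
    using iso4_change_of_basis[OF pq(1), of "m * a" "m * b" "m * c"]
    unfolding a'_def b'_def c'_def by (simp add: algebra_simps)
  have "iso4 (- (m * a')) (- (m * b')) (- (m * c')) (m * a') (m * b') (m * c')"
  proof (rule iso4_anti_isometry[OF _ r(2-5)])
    show "t^2 + 4 * s^2 = k^2 * (b'^2 - 4 * a' * c')" using r(1) unfolding D' .
    show "coprime s a'" using pq(2) unfolding a'_def by (simp add: coprime_commute)
    show "m * (b'^2 - 4 * a' * c') \<noteq> 0" using m D unfolding D' by simp
  qed
  moreover have "iso4 (- (m * a)) (- (m * b)) (- (m * c)) (- (m * a')) (- (m * b')) (- (m * c'))"
    using iso4_sym[OF iso[of "- m"]] by simp
  ultimately show ?thesis by (rule iso4_trans[OF _ iso4_trans[OF _ iso], rotated])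
qed

text \<open>For \<open>Q\<close> a power of \<open>p\<close>, the vectors \<open>x\<close> with \<open>Q \<bar> x\<cdot>L\<close> are preserved by isometries.\<close>

lemma iso4_divisible_vector:
  assumes iso: "iso4 (- A) (- B) (- C) A B C"
    and w: "Q dvd 2 * A * x0 + B" "Q dvd B * x0 + 2 * C"
  obtains r s x y where "Q dvd r" "Q dvd s" "Q dvd 2 * A * x + B * y" "Q dvd B * x + 2 * C * y"
    "2 * r * s + 2 * (A * x^2 + B * x * y + C * y^2) = - 2 * (A * x0^2 + B * x0 + C)"
proof -
  obtain \<phi> where \<phi>: "bij \<phi>" "\<forall>t u. pair4 A B C (\<phi> t) (\<phi> u) = pair4 (- A) (- B) (- C) t u"
    using iso unfolding iso4_def by (elim exE conjE)
  define w0 where "w0 = (0 :: int, 0 :: int, x0, 1 :: int)"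
  have dv: "Q dvd pair4 (- A) (- B) (- C) w0 z" for z
  proof -
    obtain r s x y where z: "z = (r, s, x, y)" by (cases z)
    have "pair4 (- A) (- B) (- C) w0 z = - (x * (2 * A * x0 + B) + y * (B * x0 + 2 * C))"
      unfolding w0_def z by (simp add: algebra_simps)
    then show ?thesis using w by simp
  qed
  have dv': "Q dvd pair4 A B C (\<phi> w0) z" for z
  proof -
    obtain z' where "z = \<phi> z'" using \<phi>(1) by (metis bij_pointE)
    then show ?thesis using \<phi>(2) dv by simp
  qed
  obtain r s x y where e: "\<phi> w0 = (r, s, x, y)" by (cases "\<phi> w0")
  have "pair4 A B C (r, s, x, y) (r, s, x, y) = pair4 (- A) (- B) (- C) w0 w0"
    using \<phi>(2) e by metis
  then have val: "2 * r * s + 2 * (A * x^2 + B * x * y + C * y^2) = - 2 * (A * x0^2 + B * x0 + C)"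
    by (simp add: w0_def algebra_simps power2_eq_square)
  show ?thesis
  proof (rule that[OF _ _ _ _ val])
    show "Q dvd r" "Q dvd s" using dv'[of "(0, 1, 0, 0)"] dv'[of "(1, 0, 0, 0)"] by (simp_all add: e)
    show "Q dvd 2 * A * x + B * y" using dv'[of "(0, 0, 1, 0)"] by (simp add: e mult.commute)
    show "Q dvd B * x + 2 * C * y" using dv'[of "(0, 0, 0, 1)"] by (simp add: e mult.commute)
  qed
qed

section \<open>Necessity of the condition on the discriminant\<close>

lemma solve_linear_mod:
  fixes a b q :: int
  assumes "coprime a q"
  obtains x where "q dvd a * x + b"
proof -
  obtain u v where "u * a + v * q = 1" using assms by (metis bezout_int coprime_iff_gcd_eq_1)
  moreover have "a * (- b * u) + b = b * (1 - (u * a + v * q)) + q * (b * v)" by (simp add: algebra_simps)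
  ultimately have "a * (- b * u) + b = q * (b * v)" by simp
  then show ?thesis using that[of "- b * u"] by simp
qed

lemma prime_power_dvd_cancel:
  fixes p x y :: int
  assumes "prime p" "\<not> p dvd x" "p ^ (j + v) dvd p ^ j * x * y"
  shows "p ^ v dvd y"
proof -
  have "p ^ j * p ^ v dvd p ^ j * (x * y)" using assms(3) by (simp add: power_add mult.assoc)
  then have "p ^ v dvd x * y" using assms(1) by (simp add: dvd_mult_cancel_left)
  moreover have "coprime (p ^ v) x" using assms(1,2) by (simp add: prime_imp_coprime)
  ultimately show ?thesis by (simp add: coprime_dvd_mult_right_iff)
qed

text \<open>Let \<open>j\<close> and \<open>v\<close> be the exponents of \<open>p\<close> in
  \<open>m\<close> and \<open>D\<close>. The vector \<open>(x0, 1)\<close> of \<open>N\<close> with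
  \<open>2 a x0 + b\<close> divisible by \<open>p^v\<close> pairs with the lattice in multiples of
  \<open>p^(j+v)\<close>, and so does its image. The equality of their norms then makes
  \<open>m D (y^2 + 1)\<close> divisible by a higher power of \<open>p\<close> than
  \<open>m D\<close>, so -1 is a square modulo \<open>p\<close>.\<close>

lemma iso4_imp_not_3_mod_4:
  fixes a b c m :: int
  assumes iso: "iso4 (- (m * a)) (- (m * b)) (- (m * c)) (m * a) (m * b) (m * c)"
    and m: "m \<noteq> 0" and D0: "b^2 - 4 * a * c \<noteq> 0"
    and p: "prime p" "p mod 4 = 3" "\<not> int p dvd a"
  shows "\<not> int p dvd b^2 - 4 * a * c"
proof
  define P where "P = int p"
  define D where "D = b^2 - 4 * a * c"
  assume "int p dvd b^2 - 4 * a * c"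
  then have PD: "P dvd D" by (simp add: P_def D_def)
  have P: "prime P" using p(1) by (simp add: P_def)
  then have nu: "\<not> is_unit P" using not_prime_unit by blast
  have podd: "odd p" using p(2) by presburger
  have "\<not> P dvd 2"
  proof
    assume "P dvd 2"
    then have "p dvd 2" unfolding P_def by (metis int_dvd_int_iff of_nat_numeral)
    then show False using p(1) podd primes_dvd_imp_eq two_is_prime_nat by blast
  qed
  then have nP2a: "\<not> P dvd 2 * a" using p(3) prime_dvd_mult_iff[OF P] unfolding P_def by blast
  obtain m' where m': "m = P ^ multiplicity P m * m'" "\<not> P dvd m'" using multiplicity_decompose'[OF m nu] .
  obtain D' where D': "D = P ^ multiplicity P D * D'" "\<not> P dvd D'"
    using multiplicity_decompose'[OF D0 nu] unfolding D_def .
  define j where "j = multiplicity P m" define v where "v = multiplicity P D"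
  have v: "v > 0" using D' PD unfolding v_def by (cases "multiplicity P D") auto
  have "coprime (P ^ v) (2 * a)" using prime_imp_coprime[OF P nP2a] coprime_power_left_iff by blast
  then have cop: "coprime (2 * a) (P ^ v)" by (simp only: coprime_commute)
  obtain x0 where x0: "P ^ v dvd 2 * a * x0 + b" using solve_linear_mod[OF cop] .
  have m'': "m = P ^ j * m'" and D'': "D = P ^ v * D'" using m'(1) D'(1) by (simp_all add: j_def v_def)
  have "P ^ v dvd 2 * a * (b * x0 + 2 * c)"
  proof -
    have "2 * a * (b * x0 + 2 * c) = b * (2 * a * x0 + b) - D" by (simp add: D_def algebra_simps power2_eq_square)
    then show ?thesis using x0 D'' by simp
  qed
  then have x0': "P ^ v dvd b * x0 + 2 * c"
    using cop coprime_dvd_mult_right_iff[of "P ^ v" "2 * a"] coprime_commute by blast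
  have Q: "P ^ (j + v) dvd 2 * (m * a) * x0 + m * b" "P ^ (j + v) dvd (m * b) * x0 + 2 * (m * c)"
  proof -
    have "P ^ j * P ^ v dvd m * (2 * a * x0 + b)" "P ^ j * P ^ v dvd m * (b * x0 + 2 * c)"
      by (rule mult_dvd_mono[OF _ x0], simp add: m'') (rule mult_dvd_mono[OF _ x0'], simp add: m'')
    then show "P ^ (j + v) dvd 2 * (m * a) * x0 + m * b" "P ^ (j + v) dvd (m * b) * x0 + 2 * (m * c)"
      by (simp_all add: power_add algebra_simps)
  qed
  obtain r s x y where rs: "P ^ (j + v) dvd r" "P ^ (j + v) dvd s" "P ^ (j + v) dvd 2 * (m * a) * x + m * b * y"
      "P ^ (j + v) dvd m * b * x + 2 * (m * c) * y"
    and val: "2 * r * s + 2 * (m * a * x^2 + m * b * x * y + m * c * y^2) = - 2 * (m * a * x0^2 + m * b * x0 + m * c)"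
    by (rule iso4_divisible_vector[OF iso Q])
  have "P ^ (j + v) dvd P ^ j * m' * (2 * a * x + b * y)" using rs(3) unfolding m'' by (simp add: algebra_simps)
  then have "P ^ v dvd 2 * a * x + b * y" by (rule prime_power_dvd_cancel[OF P m'(2)])
  then obtain e where e: "2 * a * x + b * y = P ^ v * e" by (elim dvdE)
  obtain e0 where e0: "2 * a * x0 + b = P ^ v * e0" using x0 by (elim dvdE)
  obtain r1 s1 where r1: "r = P ^ (j + v) * r1" "s = P ^ (j + v) * s1" using rs(1,2) by (elim dvdE)
  \<comment> \<open>The equality of norms times \<open>2 * a\<close>, with both squares completed:
    apart from the terms in \<open>D\<close>, everything is divisible by
    \<open>P ^ (j + 2 * v)\<close>.\<close>
  have "4 * a * (r * s) + m * ((2 * a * x + b * y)^2 - D * y^2) = - (m * ((2 * a * x0 + b)^2 - D))"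
  proof -
    have "4 * a * (r * s) + m * ((2 * a * x + b * y)^2 - D * y^2) = 2 * a * (2 * r * s + 2 * (m * a * x^2 + m * b * x * y + m * c * y^2))"
      unfolding D_def by (simp add: algebra_simps power2_eq_square)
    also have "\<dots> = - (m * ((2 * a * x0 + b)^2 - D))"
      unfolding val D_def by (simp add: algebra_simps power2_eq_square)
    finally show ?thesis .
  qed
  then have "P ^ (j + v) * (m' * D' * (y^2 + 1)) = P ^ (j + v) * (4 * a * P ^ (j + v) * (r1 * s1) + m' * P ^ v * (e^2 + e0^2))"
    unfolding e e0 r1 D'' m'' by (simp add: power_add algebra_simps power2_eq_square)
  moreover have "P ^ (j + v) \<noteq> 0" using P by simp
  ultimately have eq: "m' * D' * (y^2 + 1) = 4 * a * P ^ (j + v) * (r1 * s1) + m' * P ^ v * (e^2 + e0^2)"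
    using mult_left_cancel by blast
  have Pv: "P dvd P ^ (j + v)" "P dvd P ^ v" using v by (simp_all add: dvd_power)
  have "P dvd m' * D' * (y^2 + 1)" unfolding eq by (intro dvd_add dvd_mult dvd_mult2 Pv)
  then have "P dvd y^2 + 1" using m'(2) D'(2) prime_dvd_mult_iff[OF P] by blast
  then have "p mod 4 = 1" using minus_one_square_mod_prime[OF p(1) podd] unfolding P_def by blast
  then show False using p(2) by simp
qed

text \<open>The same comparison at the prime 2. Here \<open>b\<close> is even, and the square is
  completed with \<open>b' = b/2\<close> and \<open>\<Delta> = D/4\<close>, whose exponent
  \<open>v\<close> is at least 2. This makes \<open>y^2 + 1\<close> divisible by 4, which is
  impossible.\<close>

lemma iso4_imp_not_16:
  fixes a b c m :: int
  assumes iso: "iso4 (- (m * a)) (- (m * b)) (- (m * c)) (m * a) (m * b) (m * c)"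
    and m: "m \<noteq> 0" and D0: "b^2 - 4 * a * c \<noteq> 0" and a: "odd a"
  shows "\<not> 16 dvd b^2 - 4 * a * c"
proof
  assume "16 dvd b^2 - 4 * a * c"
  then obtain f where f: "b^2 - 4 * a * c = 16 * f" by (elim dvdE)
  have "even (b^2)"
  proof -
    have "b^2 = 2 * (8 * f + 2 * a * c)" using f by simp
    then show ?thesis by simp
  qed
  then obtain b' where b': "b = 2 * b'" by (auto elim!: evenE)
  define \<Delta> where "\<Delta> = b'^2 - a * c"
  have \<Delta>: "\<Delta> = 4 * f" using f unfolding \<Delta>_def b' by (simp add: power_mult_distrib)
  have \<Delta>0: "\<Delta> \<noteq> 0" using D0 f \<Delta> by simp
  have P: "prime (2::int)" and nu: "\<not> is_unit (2::int)" by simp_all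
  obtain m' where m': "m = 2 ^ multiplicity 2 m * m'" "odd m'" using multiplicity_decompose'[OF m nu] .
  obtain D' where D': "\<Delta> = 2 ^ multiplicity 2 \<Delta> * D'" "odd D'" using multiplicity_decompose'[OF \<Delta>0 nu] .
  \<comment> \<open>\<open>Suc\<close> because the Gram matrix is \<open>2 * m\<close> times the
    integral matrix \<open>(a, b'; b', c)\<close>.\<close>
  define j where "j = Suc (multiplicity 2 m)" define v where "v = multiplicity 2 \<Delta>"
  have m'': "2 * m = 2 ^ j * m'" and D'': "\<Delta> = 2 ^ v * D'" using m'(1) D'(1) by (simp_all add: j_def v_def)
  have v: "v \<ge> 2"
    unfolding v_def using \<Delta>0 \<Delta> multiplicity_geI[of \<Delta> 2 2] by simp
  have cop: "coprime a (2 ^ v)" using a by simp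
  obtain x0 where x0: "2 ^ v dvd a * x0 + b'" using solve_linear_mod[OF cop] .
  have "2 ^ v dvd a * (b' * x0 + c)"
  proof -
    have "a * (b' * x0 + c) = b' * (a * x0 + b') - \<Delta>" by (simp add: \<Delta>_def algebra_simps power2_eq_square)
    then show ?thesis using x0 D'' by simp
  qed
  then have x0': "2 ^ v dvd b' * x0 + c"
    using cop coprime_dvd_mult_right_iff[of "2 ^ v" a] coprime_commute by blast
  have Q: "2 ^ (j + v) dvd 2 * (m * a) * x0 + m * b" "2 ^ (j + v) dvd (m * b) * x0 + 2 * (m * c)"
  proof -
    have "2 ^ j * 2 ^ v dvd (2 * m) * (a * x0 + b')" "2 ^ j * 2 ^ v dvd (2 * m) * (b' * x0 + c)"
      unfolding m'' by (rule mult_dvd_mono[OF _ x0], simp) (rule mult_dvd_mono[OF _ x0'], simp)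
    then show "2 ^ (j + v) dvd 2 * (m * a) * x0 + m * b" "2 ^ (j + v) dvd (m * b) * x0 + 2 * (m * c)"
      unfolding b' by (simp_all add: power_add algebra_simps)
  qed
  obtain r s x y where rs: "2 ^ (j + v) dvd r" "2 ^ (j + v) dvd s" "2 ^ (j + v) dvd 2 * (m * a) * x + m * b * y"
      "2 ^ (j + v) dvd m * b * x + 2 * (m * c) * y"
    and val: "2 * r * s + 2 * (m * a * x^2 + m * b * x * y + m * c * y^2) = - 2 * (m * a * x0^2 + m * b * x0 + m * c)"
    by (rule iso4_divisible_vector[OF iso Q])
  have "2 * (m * a) * x + m * b * y = 2 ^ j * m' * (a * x + b' * y)"
    unfolding m''[symmetric] b' by (simp add: algebra_simps)
  then have "2 ^ (j + v) dvd 2 ^ j * m' * (a * x + b' * y)" using rs(3) by simp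
  then have "2 ^ v dvd a * x + b' * y" by (rule prime_power_dvd_cancel[OF P m'(2)])
  then obtain e where e: "a * x + b' * y = 2 ^ v * e" by (elim dvdE)
  obtain e0 where e0: "a * x0 + b' = 2 ^ v * e0" using x0 by (elim dvdE)
  obtain r1 s1 where r1: "r = 2 ^ (j + v) * r1" "s = 2 ^ (j + v) * s1" using rs(1,2) by (elim dvdE)
  have "2 * a * (r * s) + (2 * m) * ((a * x + b' * y)^2 - \<Delta> * y^2) = - ((2 * m) * ((a * x0 + b')^2 - \<Delta>))"
  proof -
    have "2 * a * (r * s) + (2 * m) * ((a * x + b' * y)^2 - \<Delta> * y^2) = a * (2 * r * s + 2 * (m * a * x^2 + m * b * x * y + m * c * y^2))"
      unfolding \<Delta>_def b' by (simp add: algebra_simps power2_eq_square)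
    also have "\<dots> = - ((2 * m) * ((a * x0 + b')^2 - \<Delta>))"
      unfolding val unfolding \<Delta>_def b' by (simp add: algebra_simps power2_eq_square)
    finally show ?thesis .
  qed
  then have "2 ^ (j + v) * (m' * D' * (y^2 + 1)) = 2 ^ (j + v) * (2 * a * 2 ^ (j + v) * (r1 * s1) + m' * 2 ^ v * (e^2 + e0^2))"
    unfolding e e0 r1 D'' m'' by (simp add: power_add algebra_simps power2_eq_square)
  then have eq: "m' * D' * (y^2 + 1) = 2 * a * 2 ^ (j + v) * (r1 * s1) + m' * 2 ^ v * (e^2 + e0^2)" by simp
  have "(4::int) dvd 2 ^ (j + v)" "(4::int) dvd 2 ^ v"
    using v le_imp_power_dvd[of 2 "j + v" "2::int"] le_imp_power_dvd[of 2 v "2::int"] by simp_all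
  then have d4: "4 dvd m' * D' * (y^2 + 1)" unfolding eq by (intro dvd_add dvd_mult dvd_mult2) simp_all
  have "odd (m' * D')" using m'(2) D'(2) by simp
  then have "coprime (2^2) (m' * D')" by (simp only: coprime_power_left_iff coprime_left_2_iff_odd simp_thms)
  moreover have "(2::int)^2 = 4" by simp
  ultimately have "coprime 4 (m' * D')" by (simp only:)
  from d4 this have "4 dvd y^2 + 1" using coprime_dvd_mult_right_iff by blast
  then have 4: "(y^2 + 1) mod 4 = 0" by simp
  show False
  proof (cases "even y")
    case True
    then obtain z where "y = 2 * z" by (elim evenE)
    then have "y^2 + 1 = 1 + 4 * z^2" by (simp add: power_mult_distrib)
    then show False using 4 by simp
  next
    case False
    then obtain z where "y = 2 * z + 1" by (elim oddE)
    then have y: "y^2 + 1 = 2 + 4 * (z^2 + z)" by (simp add: algebra_simps power2_eq_square)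
    have "(2 + 4 * w) mod 4 = 2" for w :: int by simp
    then show False using 4 unfolding y by (metis zero_neq_numeral)
  qed
qed

section \<open>The discriminant group of a binary lattice\<close>

text \<open>Containing all \<open>p\<close>-power torsion, \<open>I\<close> contains every Sylow
  subgroup; being of \<open>p\<close>-power order, it is no larger than one, by Lagrange. So it is
  the only candidate for \<open>THE\<close>.\<close>

lemma sylow_subgroup_eq:
  fixes G :: "'g monoid" (structure)
  assumes G: "comm_group G" "finite (carrier G)" and p: "prime p"
    and I: "subgroup I G" "card I = p ^ K"
    and tors: "\<And>x n::nat. x \<in> carrier G \<Longrightarrow> x [^] (p ^ n) = \<one> \<Longrightarrow> x \<in> I"
  shows "sylow_subgroup p G = G\<lparr>carrier := I\<rparr>"
proof -
  interpret comm_group G by (rule G(1))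
  have o0: "order G \<noteq> 0" using G(2) by (simp add: order_gt_0_iff_finite)
  define e where "e = multiplicity p (order G)"
  have sub: "H \<subseteq> I" if H: "subgroup H G" "card H = p ^ e" for H
  proof
    fix x assume x: "x \<in> H"
    have xG: "x \<in> carrier G" using x subgroup.subset[OF H(1)] by blast
    interpret H: group "G\<lparr>carrier := H\<rparr>" by (rule subgroup.subgroup_is_group[OF H(1)]) unfold_locales
    have "x [^]\<^bsub>G\<lparr>carrier := H\<rparr>\<^esub> order (G\<lparr>carrier := H\<rparr>) = \<one>\<^bsub>G\<lparr>carrier := H\<rparr>\<^esub>"
      using x by (intro H.pow_order_eq_1) simp
    then have "x [^] (p ^ e) = \<one>"
      using H(2) by (simp add: order_def nat_pow_consistent[symmetric])
    then show "x \<in> I" using tors xG by blast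
  qed
  obtain r where r: "order G = p ^ e * r" using multiplicity_dvd[of p "order G"] unfolding e_def by (elim dvdE)
  obtain H where H: "subgroup H G" "card H = p ^ e"
    using sylow_thm[OF p _ r G(2)] is_group by blast
  have fI: "finite I" using subgroup.subset[OF I(1)] G(2) finite_subset by blast
  have "p ^ e \<le> p ^ K" using card_mono[OF fI sub[OF H]] H(2) I(2) by simp
  moreover have "p ^ K dvd order G" using lagrange[OF I(1)] I(2) by (metis dvd_triv_right)
  then have "K \<le> e" unfolding e_def using multiplicity_geI o0 p not_prime_unit by blast
  then have "p ^ K \<le> p ^ e" using p by (simp add: power_increasing prime_gt_0_nat Suc_leI)
  ultimately have Ke: "card I = p ^ e" using I(2) by simp
  have "(THE H. subgroup H G \<and> card H = p ^ multiplicity p (order G)) = I"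
  proof (rule the_equality)
    show "subgroup I G \<and> card I = p ^ multiplicity p (order G)" using I(1) Ke by (simp add: e_def)
    fix H assume "subgroup H G \<and> card H = p ^ multiplicity p (order G)"
    then have H: "subgroup H G" "card H = p ^ e" by (simp_all add: e_def)
    show "H = I" by (rule card_subset_eq[OF fI sub[OF H]]) (simp add: H(2) Ke)
  qed
  then show ?thesis by (simp add: sylow_subgroup_def)
qed

locale binary_lattice =
  fixes bl :: "'a::real_vector \<Rightarrow> 'a \<Rightarrow> real" and n1 n2 :: 'a and a b c m :: int and M :: "'a set"
  assumes bl_add: "bl (x + y) z = bl x z + bl y z" and bl_scale: "bl (t *\<^sub>R x) z = t * bl x z"
    and bl_sym: "bl x y = bl y x"
    and gram: "bl n1 n1 = of_int (2 * (m * a))" "bl n1 n2 = of_int (m * b)" "bl n2 n2 = of_int (2 * (m * c))"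
    and M_def: "M = {of_int i *\<^sub>R n1 + of_int j *\<^sub>R n2 | i j :: int. True}"
    and nondegenerate: "m \<noteq> 0" "b\<^sup>2 - 4 * a * c \<noteq> 0"
begin

definition D :: int where "D = b\<^sup>2 - 4 * a * c"

definition vec :: "real \<Rightarrow> real \<Rightarrow> 'a" where "vec \<xi> \<eta> = \<xi> *\<^sub>R n1 + \<eta> *\<^sub>R n2"

abbreviation dual where "dual \<equiv> dual_lattice bl M"

abbreviation AG :: "'a monoid" where "AG \<equiv> \<lparr>carrier = dual, monoid.mult = (+), one = 0\<rparr>"

abbreviation coset :: "'a \<Rightarrow> 'a set" where "coset x \<equiv> M #>\<^bsub>AG\<^esub> x"

lemma bl_add_right: "bl z (x + y) = bl z x + bl z y" and bl_scale_right: "bl z (t *\<^sub>R x) = t * bl z x"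
  using bl_add bl_scale bl_sym by metis+

lemma vec_add: "vec \<xi> \<eta> + vec \<xi>' \<eta>' = vec (\<xi> + \<xi>') (\<eta> + \<eta>')"
  and vec_scale: "t *\<^sub>R vec \<xi> \<eta> = vec (t * \<xi>) (t * \<eta>)"
  and vec_minus: "- vec \<xi> \<eta> = vec (- \<xi>) (- \<eta>)"
  and vec_diff: "vec \<xi> \<eta> - vec \<xi>' \<eta>' = vec (\<xi> - \<xi>') (\<eta> - \<eta>')"
  and vec_0: "vec 0 0 = 0"
  by (simp_all add: vec_def algebra_simps)

lemma bl_vec: "bl (vec \<xi> \<eta>) (vec \<xi>' \<eta>') =
    of_int m * (2 * of_int a * \<xi> * \<xi>' + of_int b * (\<xi> * \<eta>' + \<eta> * \<xi>') + 2 * of_int c * \<eta> * \<eta>')"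
  using gram bl_sym[of n2 n1] unfolding vec_def
  by (simp add: bl_add bl_add_right bl_scale bl_scale_right algebra_simps)

text \<open>Independence of \<open>n1\<close> and \<open>n2\<close> is read off from the nonzero
  Gram determinant.\<close>

lemma vec_inject: "vec \<xi> \<eta> = vec \<xi>' \<eta>' \<longleftrightarrow> \<xi> = \<xi>' \<and> \<eta> = \<eta>'"
proof
  assume e: "vec \<xi> \<eta> = vec \<xi>' \<eta>'"
  define x where "x = \<xi> - \<xi>'" define y where "y = \<eta> - \<eta>'"
  have "vec x y = vec 0 0" using e by (simp add: x_def y_def vec_diff[symmetric] vec_0)
  then have "bl (vec x y) (vec 1 0) = bl (vec 0 0) (vec 1 0)" "bl (vec x y) (vec 0 1) = bl (vec 0 0) (vec 0 1)" by simp_all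
  then have "of_int m * (2 * of_int a * x + of_int b * y) = 0" "of_int m * (of_int b * x + 2 * of_int c * y) = 0"
    by (simp_all only: bl_vec) (simp_all add: algebra_simps)
  then have z: "2 * of_int a * x + of_int b * y = 0" "of_int b * x + 2 * of_int c * y = 0"
    using nondegenerate(1) by simp_all
  have "of_int (b\<^sup>2 - 4 * a * c) * x = of_int b * (of_int b * x + 2 * of_int c * y) - 2 * of_int c * (2 * of_int a * x + of_int b * y)"
    "of_int (b\<^sup>2 - 4 * a * c) * y = of_int b * (2 * of_int a * x + of_int b * y) - 2 * of_int a * (of_int b * x + 2 * of_int c * y)"
    by (simp_all add: algebra_simps power2_eq_square)
  then have "of_int (b\<^sup>2 - 4 * a * c) * x = 0" "of_int (b\<^sup>2 - 4 * a * c) * y = 0" unfolding z by simp_all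
  then show "\<xi> = \<xi>' \<and> \<eta> = \<eta>'" using nondegenerate(2) by (simp add: x_def y_def del: of_int_diff of_int_mult)
qed simp

lemma M_vec: "M = {vec (of_int i) (of_int j) | i j. True}"
  by (simp add: M_def vec_def)

lemma vec_in_M: "vec \<xi> \<eta> \<in> M \<longleftrightarrow> \<xi> \<in> \<int> \<and> \<eta> \<in> \<int>"
  unfolding M_vec by (auto simp: vec_inject elim!: Ints_cases)

lemma M_add: "x \<in> M \<Longrightarrow> y \<in> M \<Longrightarrow> x + y \<in> M" and M_minus: "x \<in> M \<Longrightarrow> - x \<in> M" and M_0: "0 \<in> M"
proof -
  show "x \<in> M \<Longrightarrow> y \<in> M \<Longrightarrow> x + y \<in> M"
    unfolding M_vec by (auto simp: vec_add) (metis of_int_add)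
  show "x \<in> M \<Longrightarrow> - x \<in> M" unfolding M_vec by (auto simp: vec_minus) (metis of_int_minus)
  show "0 \<in> M" using vec_in_M[of 0 0] by (simp add: vec_0)
qed

lemma M_diff: "x \<in> M \<Longrightarrow> y \<in> M \<Longrightarrow> x - y \<in> M"
  using M_add[OF _ M_minus, of x y] by simp

lemma M_scale: "x \<in> M \<Longrightarrow> of_int k *\<^sub>R x \<in> M"
  unfolding M_vec by (auto simp: vec_scale) (metis of_int_mult)

lemma bl_M_Ints: "x \<in> M \<Longrightarrow> y \<in> M \<Longrightarrow> bl x y \<in> \<int>"
  unfolding M_vec by (auto simp: bl_vec intro!: Ints_mult Ints_add)

lemma M_even:
  assumes "x \<in> M"
  obtains k :: int where "bl x x = 2 * of_int k"
proof -
  from assms obtain i j :: int where "x = vec (of_int i) (of_int j)" unfolding M_vec by blast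
  then have "bl x x = 2 * of_int (m * (a * i * i + b * i * j + c * j * j))"
    by (simp add: bl_vec algebra_simps)
  then show ?thesis by (rule that)
qed

lemma dual_subset: "M \<subseteq> dual"
  unfolding dual_lattice_def using bl_M_Ints by (auto intro!: exI[of _ 1])

lemma dual_add: "x \<in> dual \<Longrightarrow> y \<in> dual \<Longrightarrow> x + y \<in> dual"
proof -
  assume x: "x \<in> dual" and y: "y \<in> dual"
  obtain n where n: "n > 0" "real n *\<^sub>R x \<in> M" using x by (auto simp: dual_lattice_def)
  obtain n' where n': "n' > 0" "real n' *\<^sub>R y \<in> M" using y by (auto simp: dual_lattice_def)
  have "real (n * n') *\<^sub>R (x + y) = of_int (int n') *\<^sub>R (real n *\<^sub>R x) + of_int (int n) *\<^sub>R (real n' *\<^sub>R y)"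
    by (simp add: algebra_simps)
  also have "\<dots> \<in> M" by (intro M_add M_scale n(2) n'(2))
  finally have "\<exists>k::nat. k > 0 \<and> real k *\<^sub>R (x + y) \<in> M" using n(1) n'(1) by (intro exI[of _ "n * n'"]) simp
  moreover have "\<forall>z\<in>M. bl (x + y) z \<in> \<int>" using x y by (auto simp: dual_lattice_def bl_add)
  ultimately show ?thesis by (simp add: dual_lattice_def)
qed

lemma dual_scale: "x \<in> dual \<Longrightarrow> of_int k *\<^sub>R x \<in> dual"
proof -
  assume x: "x \<in> dual"
  obtain n where n: "n > 0" "real n *\<^sub>R x \<in> M" using x by (auto simp: dual_lattice_def)
  have "real n *\<^sub>R (of_int k *\<^sub>R x) = of_int k *\<^sub>R (real n *\<^sub>R x)" by simp
  also have "\<dots> \<in> M" by (rule M_scale[OF n(2)])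
  finally show ?thesis using n(1) x by (auto simp: dual_lattice_def bl_scale)
qed

lemma dual_minus: "x \<in> dual \<Longrightarrow> - x \<in> dual"
  using dual_scale[of x "-1"] by simp

lemma dualE:
  assumes "x \<in> dual"
  obtains \<xi> \<eta> where "x = vec \<xi> \<eta>" "of_int m * (2 * of_int a * \<xi> + of_int b * \<eta>) \<in> \<int>"
    "of_int m * (of_int b * \<xi> + 2 * of_int c * \<eta>) \<in> \<int>"
proof -
  obtain n where n: "n > 0" "real n *\<^sub>R x \<in> M" and int: "\<And>y. y \<in> M \<Longrightarrow> bl x y \<in> \<int>"
    using assms by (auto simp: dual_lattice_def)
  obtain i j :: int where ij: "real n *\<^sub>R x = vec (of_int i) (of_int j)" using n(2) unfolding M_vec by blast
  have "x = (1 / real n) *\<^sub>R (real n *\<^sub>R x)" using n(1) by simp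
  then have x: "x = vec (of_int i / real n) (of_int j / real n)" unfolding ij by (simp add: vec_scale)
  have "bl x (vec 1 0) \<in> \<int>" "bl x (vec 0 1) \<in> \<int>"
    by (rule int, simp add: vec_in_M)+
  then show ?thesis
    by (intro that[OF x]) (simp_all add: x bl_vec algebra_simps)
qed

lemma dualI:
  assumes "of_int m * (2 * of_int a * \<xi> + of_int b * \<eta>) \<in> \<int>" "of_int m * (of_int b * \<xi> + 2 * of_int c * \<eta>) \<in> \<int>"
    "n > 0" "real n * \<xi> \<in> \<int>" "real n * \<eta> \<in> \<int>"
  shows "vec \<xi> \<eta> \<in> dual"
proof -
  have "bl (vec \<xi> \<eta>) (vec (of_int i) (of_int j)) \<in> \<int>" for i j
  proof -
    have "bl (vec \<xi> \<eta>) (vec (of_int i) (of_int j)) = of_int i * (of_int m * (2 * of_int a * \<xi> + of_int b * \<eta>))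
       + of_int j * (of_int m * (of_int b * \<xi> + 2 * of_int c * \<eta>))" by (simp add: bl_vec algebra_simps)
    then show ?thesis using assms(1,2) by simp
  qed
  moreover have "real n *\<^sub>R vec \<xi> \<eta> \<in> M" using assms(4,5) by (simp add: vec_scale vec_in_M)
  ultimately show ?thesis using assms(3) unfolding dual_lattice_def M_vec by blast
qed

lemma comm_group_AG: "comm_group AG"
proof (rule comm_groupI)
  show "\<exists>y\<in>carrier AG. y \<otimes>\<^bsub>AG\<^esub> x = \<one>\<^bsub>AG\<^esub>" if "x \<in> carrier AG" for x
    using that dual_minus by (intro bexI[of _ "- x"]) simp_all
qed (use dual_add dual_subset M_0 in \<open>auto simp: add_ac\<close>)

lemma subgroup_M: "subgroup M AG"
proof -
  interpret comm_group AG by (rule comm_group_AG)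
  have inv: "inv\<^bsub>AG\<^esub> x = - x" if "x \<in> M" for x
    using that dual_subset dual_minus by (intro inv_equality) auto
  show ?thesis
    by (rule subgroupI) (use dual_subset M_0 M_add M_minus inv in auto)
qed

lemma normal_M: "M \<lhd> AG"
proof -
  interpret comm_group AG by (rule comm_group_AG)
  show ?thesis by (rule subgroup_imp_normal[OF subgroup_M])
qed

lemma disc_group_eq: "disc_group bl M = AG Mod M"
  by (simp add: disc_group_def)

lemma comm_group_disc: "comm_group (disc_group bl M)"
proof -
  interpret comm_group AG by (rule comm_group_AG)
  show ?thesis unfolding disc_group_eq by (rule abelian_FactGroup[OF subgroup_M])
qed

lemma coset_iff: "z \<in> coset x \<longleftrightarrow> z - x \<in> M"
proof -
  have "z \<in> coset x \<longleftrightarrow> (\<exists>h\<in>M. z = h + x)" by (simp add: r_coset_def)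
  also have "\<dots> \<longleftrightarrow> z - x \<in> M" by (metis add_diff_cancel_right' diff_add_cancel)
  finally show ?thesis .
qed

lemma coset_eq: "coset x = coset y \<longleftrightarrow> x - y \<in> M"
proof
  assume "coset x = coset y"
  moreover have "x \<in> coset x" by (simp add: coset_iff M_0)
  ultimately show "x - y \<in> M" by (simp add: coset_iff)
next
  assume xy: "x - y \<in> M"
  have "z - x \<in> M \<longleftrightarrow> z - y \<in> M" for z
    using M_add[OF _ xy, of "z - x"] M_diff[OF _ xy, of "z - y"] by auto
  then show "coset x = coset y" by (simp only: set_eq_iff coset_iff) simp
qed

lemma carrier_disc: "carrier (disc_group bl M) = coset ` dual"
  unfolding disc_group_eq FactGroup_def RCOSETS_def by auto

lemma mult_disc: "x \<in> dual \<Longrightarrow> y \<in> dual \<Longrightarrow> coset x \<otimes>\<^bsub>disc_group bl M\<^esub> coset y = coset (x + y)"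
  using normal.rcos_sum[OF normal_M, of x y] unfolding disc_group_eq FactGroup_def by simp

lemma one_disc: "\<one>\<^bsub>disc_group bl M\<^esub> = M"
  unfolding disc_group_eq FactGroup_def by simp

lemma coset_0: "coset x = M \<longleftrightarrow> x \<in> M"
proof -
  have "M = coset 0" by (simp only: set_eq_iff coset_iff diff_0_right) simp
  then show ?thesis using coset_eq[of x 0] by simp
qed

lemma pow_disc: "x \<in> dual \<Longrightarrow> coset x [^]\<^bsub>disc_group bl M\<^esub> (n::nat) = coset (real n *\<^sub>R x)"
proof (induction n)
  case 0
  show ?case using coset_0[of 0] M_0 by (simp add: one_disc)
next
  case (Suc n)
  have "real n *\<^sub>R x \<in> dual" using dual_scale[OF Suc.prems, of "int n"] by simp
  then show ?case using Suc mult_disc[of "real n *\<^sub>R x" x] by (simp add: algebra_simps)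
qed

text \<open>Cramer's rule for the matrix \<open>(2a, b; b, 2c)\<close> of determinant
  \<open>- D\<close>.\<close>

lemma dual_denominators:
  fixes \<xi> \<eta> :: real
  assumes "of_int m * (2 * of_int a * \<xi> + of_int b * \<eta>) \<in> \<int>" "of_int m * (of_int b * \<xi> + 2 * of_int c * \<eta>) \<in> \<int>"
  shows "of_int (m * D) * \<xi> \<in> \<int>" "of_int (m * D) * \<eta> \<in> \<int>"
proof -
  have "of_int (m * D) * \<xi> = of_int b * (of_int m * (of_int b * \<xi> + 2 * of_int c * \<eta>)) - of_int (2 * c) * (of_int m * (2 * of_int a * \<xi> + of_int b * \<eta>))"
    "of_int (m * D) * \<eta> = of_int b * (of_int m * (2 * of_int a * \<xi> + of_int b * \<eta>)) - of_int (2 * a) * (of_int m * (of_int b * \<xi> + 2 * of_int c * \<eta>))"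
    by (simp_all add: D_def algebra_simps power2_eq_square)
  then show "of_int (m * D) * \<xi> \<in> \<int>" "of_int (m * D) * \<eta> \<in> \<int>" using assms by (simp_all del: of_int_mult)
qed

lemma finite_disc: "finite (carrier (disc_group bl M))"
proof -
  define N where "N = m * D"
  have N0: "N \<noteq> 0" using nondegenerate by (simp add: N_def D_def)
  have "coset x \<in> (\<lambda>(i, j). coset (vec (of_int i / of_int N) (of_int j / of_int N))) ` ({0..<\<bar>N\<bar>} \<times> {0..<\<bar>N\<bar>})"
    if x: "x \<in> dual" for x
  proof -
    obtain \<xi> \<eta> where x: "x = vec \<xi> \<eta>" "of_int m * (2 * of_int a * \<xi> + of_int b * \<eta>) \<in> \<int>"
      "of_int m * (of_int b * \<xi> + 2 * of_int c * \<eta>) \<in> \<int>" using dualE[OF x] .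
    from dual_denominators[OF x(2,3)]
    obtain i j where ij: "of_int N * \<xi> = of_int i" "of_int N * \<eta> = of_int j" unfolding N_def by (elim Ints_cases)
    define i' where "i' = i mod \<bar>N\<bar>" define j' where "j' = j mod \<bar>N\<bar>"
    have "N dvd i - i'" "N dvd j - j'" unfolding i'_def j'_def by (simp_all add: minus_mod_eq_mult_div)
    then obtain k l where kl: "i - i' = N * k" "j - j' = N * l" by (elim dvdE)
    have "\<xi> - of_int i' / of_int N = of_int k" "\<eta> - of_int j' / of_int N = of_int l"
    proof -
      have "of_int N * (\<xi> - of_int i' / of_int N) = of_int (i - i')" "of_int N * (\<eta> - of_int j' / of_int N) = of_int (j - j')"
        using N0 ij by (simp_all add: right_diff_distrib)
      then have "of_int N * (\<xi> - of_int i' / of_int N) = of_int N * of_int k" "of_int N * (\<eta> - of_int j' / of_int N) = of_int N * of_int l"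
        unfolding kl by simp_all
      then show "\<xi> - of_int i' / of_int N = of_int k" "\<eta> - of_int j' / of_int N = of_int l"
        using N0 by (simp_all only: mult_cancel_left) simp_all
    qed
    then have "coset x = coset (vec (of_int i' / of_int N) (of_int j' / of_int N))"
      unfolding x coset_eq by (simp add: vec_diff vec_in_M)
    moreover have "(i', j') \<in> {0..<\<bar>N\<bar>} \<times> {0..<\<bar>N\<bar>}" using N0 by (simp add: i'_def j'_def)
    ultimately show ?thesis by (intro image_eqI[of _ _ "(i', j')"]) simp_all
  qed
  then have "carrier (disc_group bl M) \<subseteq> (\<lambda>(i, j). coset (vec (of_int i / of_int N) (of_int j / of_int N))) ` ({0..<\<bar>N\<bar>} \<times> {0..<\<bar>N\<bar>})"
    unfolding carrier_disc by blast
  then show ?thesis by (rule finite_subset) simp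
qed

text \<open>On an even lattice the norms of \<open>x + h\<close> and \<open>x\<close> differ by
  \<open>2 (x, h) + (h, h)\<close>, an even integer, so the union in \<open>disc_form\<close>
  collapses to one coset.\<close>

lemma disc_form_coset:
  assumes "x \<in> dual"
  shows "disc_form bl (coset x) = mod_2Z (bl x x)"
proof -
  have mem: "x \<in> coset x" by (simp add: coset_iff M_0)
  have "mod_2Z (bl y y) = mod_2Z (bl x x)" if "y \<in> coset x" for y
  proof -
    define h where "h = y - x"
    have h: "h \<in> M" "y = h + x" using that unfolding coset_iff by (simp_all add: h_def)
    obtain k :: int where k: "bl h h = 2 * of_int k" using M_even[OF h(1)] .
    have "bl x h \<in> \<int>" using assms h(1) by (simp add: dual_lattice_def)
    then obtain l :: int where l: "bl x h = of_int l" by (elim Ints_cases)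
    have y: "bl y y = bl x x + 2 * of_int (k + l)"
      using bl_sym[of h x] unfolding h(2) by (simp add: bl_add bl_add_right k l)
    have "\<exists>n'. bl y y + 2 * of_int n = bl x x + 2 * of_int n'" "\<exists>n'. bl x x + 2 * of_int n = bl y y + 2 * of_int n'" for n :: int
      unfolding y by (intro exI[of _ "k + l + n"] exI[of _ "n - (k + l)"]; simp)+
    then show ?thesis unfolding mod_2Z_def by blast
  qed
  then show ?thesis unfolding disc_form_def using mem by blast
qed

text \<open>Reduces a Sylow subgroup together with its form to two dual vectors: once their orders
  modulo \<open>M\<close>, their independence and the exhaustion of the \<open>p\<close>-power
  torsion are known, \<open>(i, l) \<mapsto> i x1 + l x2\<close> is the isomorphism.\<close>

lemma sylow_iso:
  assumes p: "prime p" and x: "x1 \<in> dual" "x2 \<in> dual" "real (p ^ k1) *\<^sub>R x1 \<in> M" "real (p ^ k2) *\<^sub>R x2 \<in> M"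
    and indep: "\<And>i l :: int. of_int i *\<^sub>R x1 + of_int l *\<^sub>R x2 \<in> M \<Longrightarrow> int (p ^ k1) dvd i \<and> int (p ^ k2) dvd l"
    and tors: "\<And>x n. x \<in> dual \<Longrightarrow> real (p ^ n) *\<^sub>R x \<in> M \<Longrightarrow> \<exists>i l :: int. x - (of_int i *\<^sub>R x1 + of_int l *\<^sub>R x2) \<in> M"
  shows "\<exists>\<phi> \<in> iso (integer_mod_group (p ^ k1) \<times>\<times> integer_mod_group (p ^ k2)) (sylow_subgroup p (disc_group bl M)).
    \<forall>i l :: int. disc_form bl (\<phi> (i mod int (p ^ k1), l mod int (p ^ k2)))
       = mod_2Z (bl (of_int i *\<^sub>R x1 + of_int l *\<^sub>R x2) (of_int i *\<^sub>R x1 + of_int l *\<^sub>R x2))"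
proof -
  define P1 where "P1 = p ^ k1" define P2 where "P2 = p ^ k2"
  have pos: "P1 > 0" "P2 > 0" using prime_gt_0_nat[OF p] by (simp_all add: P1_def P2_def)
  define y where "y = (\<lambda>(i::int) (l::int). of_int i *\<^sub>R x1 + of_int l *\<^sub>R x2)"
  have yd: "y i l \<in> dual" for i l unfolding y_def by (intro dual_add dual_scale x)
  have ydiff: "y i l - y i' l' = y (i - i') (l - l')" for i l i' l' by (simp add: y_def algebra_simps)
  have yadd: "y i l + y i' l' = y (i + i') (l + l')" for i l i' l' by (simp add: y_def algebra_simps)
  have yM: "y i l \<in> M \<longleftrightarrow> int P1 dvd i \<and> int P2 dvd l" for i l
  proof
    assume "y i l \<in> M" then show "int P1 dvd i \<and> int P2 dvd l" using indep unfolding y_def P1_def P2_def by blast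
  next
    assume "int P1 dvd i \<and> int P2 dvd l"
    then obtain i' l' where e: "i = int P1 * i'" "l = int P2 * l'" by (elim conjE dvdE)
    have "y i l = of_int i' *\<^sub>R (real P1 *\<^sub>R x1) + of_int l' *\<^sub>R (real P2 *\<^sub>R x2)" by (simp add: y_def e algebra_simps)
    then show "y i l \<in> M" using M_add[OF M_scale[OF x(3), of i'] M_scale[OF x(4), of l']] by (simp add: P1_def P2_def)
  qed
  have ceq: "coset (y i l) = coset (y i' l') \<longleftrightarrow> int P1 dvd i - i' \<and> int P2 dvd l - l'" for i l i' l'
    unfolding coset_eq ydiff yM ..
  have ymod: "coset (y (i mod int P1) (l mod int P2)) = coset (y i l)" for i l
    unfolding ceq by (simp add: mod_eq_dvd_iff[symmetric])
  define \<phi> where "\<phi> = (\<lambda>(i, l). coset (y i l))"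
  let ?Z = "integer_mod_group P1 \<times>\<times> integer_mod_group P2"
  let ?A = "disc_group bl M"
  have cZ: "carrier ?Z = {0..<int P1} \<times> {0..<int P2}"
    using pos by (simp add: carrier_integer_mod_group DirProd_def)
  have hom: "\<phi> (u \<otimes>\<^bsub>?Z\<^esub> v) = \<phi> u \<otimes>\<^bsub>?A\<^esub> \<phi> v" for u v
    by (cases u; cases v) (simp add: \<phi>_def ymod mult_disc yd yadd)
  interpret A: comm_group ?A by (rule comm_group_disc)
  interpret Z: group ?Z by (intro DirProd_group group_integer_mod_group)
  have \<phi>A: "\<phi> u \<in> carrier ?A" for u by (cases u) (simp add: \<phi>_def carrier_disc yd)
  have ghom: "\<phi> \<in> hom ?Z ?A" unfolding hom_def using hom \<phi>A by blast
  interpret gh: group_hom ?Z ?A \<phi> by unfold_locales (rule ghom)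
  define I where "I = \<phi> ` carrier ?Z"
  have subI: "subgroup I ?A" unfolding I_def by (rule gh.img_is_subgroup)
  have inj: "inj_on \<phi> (carrier ?Z)"
  proof (rule inj_onI)
    fix u v assume uv: "u \<in> carrier ?Z" "v \<in> carrier ?Z" "\<phi> u = \<phi> v"
    obtain i l where u: "u = (i, l)" by (cases u)
    obtain i' l' where v: "v = (i', l')" by (cases v)
    have r: "0 \<le> i" "i < int P1" "0 \<le> l" "l < int P2" "0 \<le> i'" "i' < int P1" "0 \<le> l'" "l' < int P2"
      using uv(1,2) unfolding cZ u v by simp_all
    have "i mod int P1 = i' mod int P1" "l mod int P2 = l' mod int P2"
      using uv(3) unfolding u v \<phi>_def by (simp_all add: ceq mod_eq_dvd_iff)
    then show "u = v" using r unfolding u v by simp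
  qed
  have cardI: "card I = p ^ (k1 + k2)"
  proof -
    have "card I = card (carrier ?Z)" unfolding I_def by (rule card_image[OF inj])
    also have "\<dots> = P1 * P2" unfolding cZ by (simp add: card_cartesian_product)
    finally show ?thesis by (simp add: P1_def P2_def power_add)
  qed
  have "sylow_subgroup p ?A = ?A\<lparr>carrier := I\<rparr>"
  proof (rule sylow_subgroup_eq[OF comm_group_disc finite_disc p subI cardI])
    fix z and n :: nat
    assume z: "z \<in> carrier ?A" "z [^]\<^bsub>?A\<^esub> (p ^ n) = \<one>\<^bsub>?A\<^esub>"
    obtain w where w: "w \<in> dual" "z = coset w" using z(1) unfolding carrier_disc by blast
    have "real (p ^ n) *\<^sub>R w \<in> M" using z(2) unfolding w(2) pow_disc[OF w(1)] one_disc coset_0 .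
    then obtain i l where "w - y i l \<in> M" using tors[OF w(1)] unfolding y_def by blast
    then have "z = coset (y i l)" unfolding w(2) coset_eq .
    also have "\<dots> = \<phi> (i mod int P1, l mod int P2)" by (simp add: \<phi>_def ymod)
    finally have "z = \<phi> (i mod int P1, l mod int P2)" .
    moreover have "int P1 > 0" "int P2 > 0" using pos by simp_all
    then have "(i mod int P1, l mod int P2) \<in> carrier ?Z" unfolding cZ by (simp only: mem_Times_iff fst_conv snd_conv atLeastLessThan_iff pos_mod_sign pos_mod_bound simp_thms)
    ultimately show "z \<in> I" unfolding I_def by blast
  qed
  moreover have "\<phi> \<in> iso ?Z (?A\<lparr>carrier := I\<rparr>)"
  proof -
    have cc: "carrier (?A\<lparr>carrier := I\<rparr>) = I" and mm: "u \<otimes>\<^bsub>?A\<lparr>carrier := I\<rparr>\<^esub> v = u \<otimes>\<^bsub>?A\<^esub> v" for u v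
      by simp_all
    show ?thesis
      unfolding iso_def hom_def bij_betw_def cc mm using hom inj I_def by blast
  qed
  ultimately have "\<phi> \<in> iso ?Z (sylow_subgroup p ?A)" by simp
  moreover have "disc_form bl (\<phi> (i mod int P1, l mod int P2)) = mod_2Z (bl (y i l) (y i l))" for i l
    using disc_form_coset[OF yd] by (simp add: \<phi>_def ymod)
  ultimately show ?thesis unfolding P1_def P2_def y_def by blast
qed

end

section \<open>Congruences and the 2-adic normal form of a binary form\<close>

lemma Ints_coprime_mult:
  fixes y :: real and u w :: int
  assumes "coprime u w" "of_int u * y \<in> \<int>" "of_int w * y \<in> \<int>"
  shows "y \<in> \<int>"
proof -
  obtain i j where "i * u + j * w = 1" using assms(1) by (metis bezout_int coprime_iff_gcd_eq_1)
  then have "real_of_int (i * u + j * w) = 1" by simp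
  then have "y = of_int i * (of_int u * y) + of_int j * (of_int w * y)" by (simp add: algebra_simps) (metis distrib_left mult.right_neutral)
  moreover have "of_int i * (of_int u * y) + of_int j * (of_int w * y) \<in> \<int>" using assms(2,3) by simp
  ultimately show ?thesis by simp
qed

lemma mod_2Z_eqI:
  assumes "x - y = 2 * of_int n"
  shows "mod_2Z x = mod_2Z y"
proof -
  have x: "x = y + 2 * of_int n" using assms by simp
  have "\<exists>k. x + 2 * of_int i = y + 2 * of_int k" "\<exists>k. y + 2 * of_int i = x + 2 * of_int k" for i :: int
    unfolding x by (intro exI[of _ "n + i"] exI[of _ "i - n"]; simp)+
  then show ?thesis unfolding mod_2Z_def by blast
qed

text \<open>The derivative \<open>2 A x + B\<close> is always odd, so the root 0 modulo 2 lifts to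
  every power of 2.\<close>

lemma quadratic_hensel_2:
  fixes A B C :: int
  assumes "odd B" "even C"
  shows "\<exists>x. 2 ^ j dvd A * x^2 + B * x + C"
proof (cases j)
  case (Suc i)
  have "\<exists>x. 2 ^ Suc i dvd A * x^2 + B * x + C"
  proof (induction i)
    case 0
    show ?case using assms(2) by (intro exI[of _ 0]) simp
  next
    case (Suc i)
    then obtain x e where x: "A * x^2 + B * x + C = 2 ^ Suc i * e" by (elim exE dvdE)
    \<comment> \<open>Newton's correction would be \<open>- e\<close> over the derivative; one more
      power of 2 is wanted, and modulo 2 both the sign and the odd derivative disappear.\<close>
    define x' where "x' = x + 2 ^ Suc i * e"
    have "A * x'^2 + B * x' + C = 2 ^ Suc i * (e + e * (2 * A * x + B) + A * 2 ^ Suc i * e^2)"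
    proof -
      have "A * x'^2 + B * x' + C = (A * x^2 + B * x + C) + 2 ^ Suc i * (e * (2 * A * x + B) + A * 2 ^ Suc i * e^2)"
        unfolding x'_def by (simp add: algebra_simps power2_eq_square)
      then show ?thesis unfolding x by (simp add: algebra_simps)
    qed
    moreover have "2 dvd e + e * (2 * A * x + B) + A * 2 ^ Suc i * e^2" using assms(1) by simp
    ultimately have "2 ^ Suc i * 2 dvd A * x'^2 + B * x' + C" by (simp only: mult_dvd_mono dvd_refl)
    then show ?case by (intro exI[of _ x']) (simp add: mult.commute)
  qed
  then show ?thesis using Suc by simp
qed simp

text \<open>A binary form of odd discriminant is hyperbolic or a multiple of \<open>x\<^sup>2 + xy + y\<^sup>2\<close> over the 2-adic integers.\<close>

lemma odd_binary_form_2_adic: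
  fixes a b c :: int
  assumes "odd a" "odd b"
  obtains x1 y1 x2 y2 \<theta> where "odd \<theta>" "odd (x1 * y2 - x2 * y1)"
    "(\<forall>i l. 2 ^ j dvd a * (i * x1 + l * x2)^2 + b * (i * x1 + l * x2) * (i * y1 + l * y2) + c * (i * y1 + l * y2)^2 - \<theta> * i * l) \<or>
     (\<forall>i l. 2 ^ j dvd a * (i * x1 + l * x2)^2 + b * (i * x1 + l * x2) * (i * y1 + l * y2) + c * (i * y1 + l * y2)^2 - \<theta> * (i^2 + i * l + l^2))"
proof (cases "even c")
  case True
  obtain x0 where "2 ^ j dvd a * x0^2 + b * x0 + c" using quadratic_hensel_2[OF assms(2) True] by blast
  then obtain e where e: "a * x0^2 + b * x0 + c = 2 ^ j * e" by (elim dvdE)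
  \<comment> \<open>Modulo \<open>2 ^ j\<close> the vector \<open>(x0, 1)\<close> is isotropic. It
    is completed by \<open>(1, 0) + z (x0, 1)\<close>, where \<open>z\<close> makes the second
    vector isotropic as well; \<open>\<beta>\<close> is the pairing of the two.\<close>
  define \<beta> where "\<beta> = 2 * a * x0 + b"
  have \<beta>: "odd \<beta>" using assms(2) by (simp add: \<beta>_def)
  then have "coprime \<beta> (2 ^ j)" by simp
  then obtain z where "2 ^ j dvd \<beta> * z + a" using solve_linear_mod by blast
  then obtain e' where e': "\<beta> * z + a = 2 ^ j * e'" by (elim dvdE)
  have "2 ^ j dvd a * (i * x0 + l * (1 + z * x0))^2 + b * (i * x0 + l * (1 + z * x0)) * (i * 1 + l * z) + c * (i * 1 + l * z)^2 - \<beta> * i * l" for i l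
  proof -
    have "a * (i * x0 + l * (1 + z * x0))^2 + b * (i * x0 + l * (1 + z * x0)) * (i * 1 + l * z) + c * (i * 1 + l * z)^2 - \<beta> * i * l
      = (i + l * z)^2 * (a * x0^2 + b * x0 + c) + l^2 * (\<beta> * z + a)"
      unfolding \<beta>_def by (simp add: algebra_simps power2_eq_square)
    then show ?thesis unfolding e e' by simp
  qed
  moreover have "odd (x0 * z - (1 + z * x0) * 1)" by (simp add: mult.commute)
  ultimately show ?thesis using that[OF \<beta>, of x0 z "1 + z * x0" 1] by blast
next
  case False
  \<comment> \<open>Besides \<open>(1, 0)\<close> a vector \<open>(x, y)\<close> is sought with the
    same value \<open>a\<close> and with pairing \<open>a\<close>. The pairing means
    \<open>b y = a (1 - 2x)\<close>; inserted into \<open>b^2 (f - a)\<close> this leaves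
    \<open>a\<close> times the quadratic below, whose middle coefficient \<open>d\<close> is
    odd.\<close>
  define d where "d = b^2 - 4 * a * c"
  have "odd d" "even (a * c - b^2)" using assms False by (simp_all add: d_def)
  then obtain x where "2 ^ Suc j dvd (- d) * x^2 + d * x + (a * c - b^2)" using quadratic_hensel_2 by blast
  then obtain e where e: "(- d) * x^2 + d * x + (a * c - b^2) = 2 ^ Suc j * e" by (elim dvdE)
  have "coprime b (2 ^ Suc j)" using assms(2) by simp
  then obtain y where "2 ^ Suc j dvd b * y + - (a * (1 - 2 * x))" by (rule solve_linear_mod)
  then obtain w where "b * y + - (a * (1 - 2 * x)) = 2 ^ Suc j * w" by (elim dvdE)
  then have w: "b * y = a * (1 - 2 * x) + 2 ^ Suc j * w" by simp
  have "odd (b * y)" unfolding w using assms(1) by simp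
  then have "odd y" by simp
  define f where "f = a * x^2 + b * x * y + c * y^2"
  have "b^2 * f = a * b^2 * x^2 + b^2 * x * (b * y) + c * (b * y)^2"
    by (simp add: f_def algebra_simps power2_eq_square)
  also have "\<dots> = a * b^2 + a * ((- d) * x^2 + d * x + (a * c - b^2))
      + 2 ^ Suc j * (b^2 * x * w + 2 * c * a * (1 - 2 * x) * w + c * 2 ^ Suc j * w^2)"
    unfolding w d_def by (simp add: algebra_simps power2_eq_square)
  finally have "b^2 * (f - a) = 2 ^ Suc j * (a * e + (b^2 * x * w + 2 * c * a * (1 - 2 * x) * w + c * 2 ^ Suc j * w^2))"
    unfolding e by (simp add: algebra_simps)
  then have "2 ^ Suc j dvd b^2 * (f - a)" by simp
  moreover have "coprime (2 ^ Suc j) (b^2)" using assms(2) by simp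
  ultimately have "2 ^ Suc j dvd f - a" using coprime_dvd_mult_right_iff by blast
  then obtain g where g: "f - a = 2 ^ Suc j * g" by (elim dvdE)
  have "2 ^ j dvd a * (i * 1 + l * x)^2 + b * (i * 1 + l * x) * (i * 0 + l * y) + c * (i * 0 + l * y)^2 - a * (i^2 + i * l + l^2)" for i l
  proof -
    have "a * (i * 1 + l * x)^2 + b * (i * 1 + l * x) * (i * 0 + l * y) + c * (i * 0 + l * y)^2 - a * (i^2 + i * l + l^2)
       = i * l * (b * y - a * (1 - 2 * x)) + l^2 * (f - a)"
      unfolding f_def by (simp add: algebra_simps power2_eq_square)
    also have "\<dots> = 2 ^ j * (2 * (i * l * w + l^2 * g))" unfolding g w by (simp add: algebra_simps)
    finally show ?thesis by simp
  qed
  moreover have "odd (1 * y - x * 0)" using \<open>odd y\<close> by simp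
  ultimately show ?thesis using that[OF assms(1), of 1 y x 0] by blast
qed

section \<open>Sylow subgroups of the discriminant group\<close>

context binary_lattice
begin

lemma torsion_denominators:
  assumes "vec \<xi> \<eta> \<in> dual" "real (p ^ n) *\<^sub>R vec \<xi> \<eta> \<in> M"
  shows "of_int (int p ^ n) * \<xi> \<in> \<int>" "of_int (int p ^ n) * \<eta> \<in> \<int>"
    "of_int m * (2 * of_int a * \<xi> + of_int b * \<eta>) \<in> \<int>" "of_int m * (of_int b * \<xi> + 2 * of_int c * \<eta>) \<in> \<int>"
proof -
  show "of_int (int p ^ n) * \<xi> \<in> \<int>" "of_int (int p ^ n) * \<eta> \<in> \<int>"
    using assms(2) by (simp_all add: vec_scale vec_in_M)
  show "of_int m * (2 * of_int a * \<xi> + of_int b * \<eta>) \<in> \<int>" "of_int m * (of_int b * \<xi> + 2 * of_int c * \<eta>) \<in> \<int>"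
    by (rule dualE[OF assms(1)], simp add: vec_inject)+
qed

lemma sylow_trivial:
  assumes p: "prime p" and np: "\<not> int p dvd m * D"
  shows "\<exists>\<phi>. \<phi> \<in> iso (integer_mod_group (p ^ 0) \<times>\<times> integer_mod_group (p ^ 0)) (sylow_subgroup p (disc_group bl M))"
proof -
  have "\<exists>i l :: int. x - (of_int i *\<^sub>R 0 + of_int l *\<^sub>R 0) \<in> M" if x: "x \<in> dual" "real (p ^ n) *\<^sub>R x \<in> M" for x n
  proof -
    obtain \<xi> \<eta> where e: "x = vec \<xi> \<eta>" using dualE[OF x(1)] .
    note t = torsion_denominators[OF x[unfolded e]]
    have "coprime (int p) (m * D)" using p np by (intro prime_imp_coprime) simp_all
    then have "coprime (int p ^ n) (m * D)" using coprime_power_left_iff by blast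
    then have "\<xi> \<in> \<int>" "\<eta> \<in> \<int>"
      using Ints_coprime_mult[OF _ t(1) dual_denominators(1)[OF t(3,4)]] Ints_coprime_mult[OF _ t(2) dual_denominators(2)[OF t(3,4)]] by blast+
    then show ?thesis by (simp add: e vec_in_M)
  qed
  moreover have "(0::'a) \<in> dual" using M_0 dual_subset by blast
  ultimately show ?thesis using sylow_iso[OF p, of 0 0 0 0] M_0 by auto
qed

text \<open>Over the \<open>p\<close>-adic integers \<open>M\<close> is the orthogonal sum of the lines spanned by \<open>n1\<close> and
  \<open>a0 n2 - b0 n1\<close>.\<close>

lemma sylow_diag:
  fixes m0 a0 b0 c0 m' D' :: int
  assumes p: "prime p" and g: "m * (2 * a) = m0 * a0" "m * b = m0 * b0" "m * (2 * c) = m0 * c0"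
    and a0: "\<not> int p dvd a0" and m0: "m0 = int p ^ j * m'" "\<not> int p dvd m'"
    and d0: "b0\<^sup>2 - a0 * c0 = int p ^ v * D'" "\<not> int p dvd D'"
  shows "\<exists>\<phi> \<in> iso (integer_mod_group (p ^ j) \<times>\<times> integer_mod_group (p ^ (j + v))) (sylow_subgroup p (disc_group bl M)).
    \<forall>i l :: int. disc_form bl (\<phi> (i mod int (p ^ j), l mod int (p ^ (j + v))))
       = mod_2Z (of_int (m' * a0 * i\<^sup>2) / of_int (int p ^ j) + of_int (- (m' * a0 * D') * l\<^sup>2) / of_int (int p ^ (j + v)))"
proof -
  define P where "P = real p"
  have P0: "P \<noteq> 0" using p by (simp add: P_def prime_gt_0_nat)
  have Pi: "of_int (int p ^ n) = P ^ n" "real (p ^ n) = P ^ n" for n by (simp_all add: P_def)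
  have gr: "of_int m * (2 * of_int a) = of_int m0 * (of_int a0 :: real)" "of_int m * of_int b = of_int m0 * (of_int b0 :: real)"
    "of_int m * (2 * of_int c) = of_int m0 * (of_int c0 :: real)"
    using arg_cong[OF g(1), of real_of_int] arg_cong[OF g(2), of real_of_int] arg_cong[OF g(3), of real_of_int] by simp_all
  have m0r: "of_int m0 = P ^ j * (of_int m' :: real)" using m0(1) Pi by simp
  have d0r: "(of_int b0)\<^sup>2 - of_int a0 * of_int c0 = P ^ v * (of_int D' :: real)"
    using arg_cong[OF d0(1), of real_of_int] Pi by simp
  have form1: "of_int m * (2 * of_int a * \<xi> + of_int b * \<eta>) = of_int m0 * (of_int a0 * \<xi> + of_int b0 * \<eta>)"
    and form2: "of_int m * (of_int b * \<xi> + 2 * of_int c * \<eta>) = of_int m0 * (of_int b0 * \<xi> + of_int c0 * \<eta>)" for \<xi> \<eta> :: real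
  proof -
    have "of_int m * (2 * of_int a * \<xi> + of_int b * \<eta>) = (of_int m * (2 * of_int a)) * \<xi> + (of_int m * of_int b) * \<eta>"
      "of_int m * (of_int b * \<xi> + 2 * of_int c * \<eta>) = (of_int m * of_int b) * \<xi> + (of_int m * (2 * of_int c)) * \<eta>"
      by (simp_all add: algebra_simps)
    then show "of_int m * (2 * of_int a * \<xi> + of_int b * \<eta>) = of_int m0 * (of_int a0 * \<xi> + of_int b0 * \<eta>)"
      "of_int m * (of_int b * \<xi> + 2 * of_int c * \<eta>) = of_int m0 * (of_int b0 * \<xi> + of_int c0 * \<eta>)"
      unfolding gr by (simp_all add: algebra_simps)
  qed
  have blv: "bl (vec \<xi> \<eta>) (vec \<xi> \<eta>) = of_int m0 * (of_int a0 * \<xi>\<^sup>2 + 2 * of_int b0 * \<xi> * \<eta> + of_int c0 * \<eta>\<^sup>2)" for \<xi> \<eta>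
  proof -
    have "bl (vec \<xi> \<eta>) (vec \<xi> \<eta>) = (of_int m * (2 * of_int a)) * \<xi>\<^sup>2 + 2 * (of_int m * of_int b) * \<xi> * \<eta> + (of_int m * (2 * of_int c)) * \<eta>\<^sup>2"
      unfolding bl_vec by (simp add: algebra_simps power2_eq_square)
    then show ?thesis unfolding gr by (simp add: algebra_simps)
  qed
  \<comment> \<open>The orthogonal vectors \<open>n1\<close> and \<open>a0 n2 - b0 n1\<close> have
    the norms \<open>m0 a0\<close> and \<open>- m0 a0 (b0^2 - a0 c0)\<close>, of exponents
    \<open>j\<close> and \<open>j + v\<close>; divided by these powers of \<open>p\<close> they
    generate the dual lattice locally at \<open>p\<close>.\<close>
  define x1 where "x1 = vec (1 / P ^ j) 0"
  define x2 where "x2 = vec (- of_int b0 / P ^ (j + v)) (of_int a0 / P ^ (j + v))"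
  have comb: "s *\<^sub>R x1 + t *\<^sub>R x2 = vec (s / P ^ j - t * of_int b0 / P ^ (j + v)) (t * of_int a0 / P ^ (j + v))" for s t
    by (simp add: x1_def x2_def vec_scale vec_add)
  have x1d: "x1 \<in> dual"
    unfolding x1_def
  proof (rule dualI[of _ _ "p ^ j"], unfold form1 form2)
    show "of_int m0 * (of_int a0 * (1 / P ^ j) + of_int b0 * 0) \<in> \<int>" "of_int m0 * (of_int b0 * (1 / P ^ j) + of_int c0 * 0) \<in> \<int>"
      using P0 by (simp_all add: m0r)
  qed (use p P0 in \<open>simp_all add: P_def prime_gt_0_nat\<close>)
  have x2d: "x2 \<in> dual"
    unfolding x2_def
  proof (rule dualI[of _ _ "p ^ (j + v)"], unfold form1 form2)
    show "of_int m0 * (of_int a0 * (- of_int b0 / P ^ (j + v)) + of_int b0 * (of_int a0 / P ^ (j + v))) \<in> \<int>"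
      by (simp add: mult.commute)
    have "of_int m0 * (of_int b0 * (- of_int b0 / P ^ (j + v)) + of_int c0 * (of_int a0 / P ^ (j + v)))
      = - (of_int m0 * ((of_int b0)\<^sup>2 - of_int a0 * of_int c0)) / P ^ (j + v)"
      by (simp add: diff_divide_distrib add_divide_distrib algebra_simps power2_eq_square)
    also have "\<dots> = of_int (- (m' * D'))" unfolding d0r m0r using P0 by (simp add: power_add)
    finally show "of_int m0 * (of_int b0 * (- of_int b0 / P ^ (j + v)) + of_int c0 * (of_int a0 / P ^ (j + v))) \<in> \<int>" by simp
  qed (use p P0 in \<open>simp_all add: P_def prime_gt_0_nat\<close>)
  have Pint: "prime (int p)" using p by simp
  have cop: "coprime (int p ^ n) a0" "coprime m' (int p ^ n)" "coprime (m' * D') (int p ^ n)" for n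
  proof -
    have "coprime (int p) a0" "coprime (int p) m'" "coprime (int p) D'"
      using prime_imp_coprime[OF Pint] a0 m0(2) d0(2) by blast+
    then have "coprime (int p ^ n) a0" "coprime (int p ^ n) m'" "coprime (int p ^ n) D'"
      using coprime_power_left_iff by blast+
    then show "coprime (int p ^ n) a0" "coprime m' (int p ^ n)" "coprime (m' * D') (int p ^ n)"
      by (simp_all only: coprime_commute coprime_mult_right_iff coprime_mult_left_iff simp_thms)
  qed
  have "\<exists>\<phi> \<in> iso (integer_mod_group (p ^ j) \<times>\<times> integer_mod_group (p ^ (j + v))) (sylow_subgroup p (disc_group bl M)).
    \<forall>i l :: int. disc_form bl (\<phi> (i mod int (p ^ j), l mod int (p ^ (j + v))))
       = mod_2Z (bl (of_int i *\<^sub>R x1 + of_int l *\<^sub>R x2) (of_int i *\<^sub>R x1 + of_int l *\<^sub>R x2))"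
  proof (rule sylow_iso[OF p x1d x2d])
    show "real (p ^ j) *\<^sub>R x1 \<in> M" "real (p ^ (j + v)) *\<^sub>R x2 \<in> M"
      using P0 by (simp_all only: x1_def x2_def vec_scale vec_in_M Pi) simp_all
    fix i l :: int
    assume "of_int i *\<^sub>R x1 + of_int l *\<^sub>R x2 \<in> M"
    then have z: "of_int i / P ^ j - of_int l * of_int b0 / P ^ (j + v) \<in> \<int>" "of_int l * of_int a0 / P ^ (j + v) \<in> \<int>"
      unfolding comb vec_in_M by simp_all
    obtain z2 :: int where "of_int l * of_int a0 / P ^ (j + v) = of_int z2" using z(2) by (elim Ints_cases)
    then have "of_int (l * a0) = real_of_int (int p ^ (j + v) * z2)" using P0 by (simp add: field_simps P_def)
    then have "int p ^ (j + v) dvd l * a0" by (simp only: of_int_eq_iff) simp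
    then have l: "int p ^ (j + v) dvd l" using cop(1) coprime_dvd_mult_left_iff by blast
    then obtain l' where l': "l = int p ^ (j + v) * l'" by (elim dvdE)
    have "of_int l * of_int b0 / P ^ (j + v) = of_int (l' * b0)" using P0 by (simp add: l' P_def)
    then have "of_int i / P ^ j \<in> \<int>" using z(1) by (metis Ints_add Ints_of_int diff_add_cancel)
    then obtain z1 :: int where "of_int i / P ^ j = of_int z1" by (elim Ints_cases)
    then have "of_int i = real_of_int (int p ^ j * z1)" using P0 by (simp add: field_simps P_def)
    then have "int p ^ j dvd i" by (simp only: of_int_eq_iff) simp
    with l show "int (p ^ j) dvd i \<and> int (p ^ (j + v)) dvd l" by simp
  next
    fix x and n :: nat
    assume x: "x \<in> dual" "real (p ^ n) *\<^sub>R x \<in> M"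
    obtain \<xi> \<eta> where e: "x = vec \<xi> \<eta>" using dualE[OF x(1)] .
    note t = torsion_denominators[OF x[unfolded e], unfolded form1 form2]
    define y1 where "y1 = P ^ j * (of_int a0 * \<xi> + of_int b0 * \<eta>)"
    define y2 where "y2 = P ^ (j + v) * \<eta>"
    have "y1 \<in> \<int>"
    proof (rule Ints_coprime_mult[OF cop(2)])
      show "of_int m' * y1 \<in> \<int>" using t(3) unfolding m0r y1_def by (simp add: mult_ac)
      have "of_int (int p ^ n) * y1 = of_int (int p ^ j) * (of_int a0 * (of_int (int p ^ n) * \<xi>) + of_int b0 * (of_int (int p ^ n) * \<eta>))"
        unfolding y1_def Pi by (simp add: algebra_simps)
      also have "\<dots> \<in> \<int>" by (intro Ints_mult Ints_add Ints_of_int t(1,2))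
      finally show "of_int (int p ^ n) * y1 \<in> \<int>" .
    qed
    then obtain u1 :: int where u1: "y1 = of_int u1" by (elim Ints_cases)
    have "y2 \<in> \<int>"
    proof (rule Ints_coprime_mult[OF cop(3)])
      have "of_int (m' * D') * y2 = of_int m0 * (P ^ v * of_int D') * \<eta>"
        unfolding y2_def m0r by (simp add: power_add)
      also have "\<dots> = of_int b0 * (of_int m0 * (of_int a0 * \<xi> + of_int b0 * \<eta>)) - of_int a0 * (of_int m0 * (of_int b0 * \<xi> + of_int c0 * \<eta>))"
        unfolding d0r[symmetric] by (simp add: algebra_simps power2_eq_square)
      also have "\<dots> \<in> \<int>" by (intro Ints_diff Ints_mult[OF Ints_of_int] t(3,4))
      finally show "of_int (m' * D') * y2 \<in> \<int>" .
      have "of_int (int p ^ n) * y2 = of_int (int p ^ (j + v)) * (of_int (int p ^ n) * \<eta>)" unfolding y2_def Pi by simp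
      also have "\<dots> \<in> \<int>" by (intro Ints_mult Ints_of_int t(2))
      finally show "of_int (int p ^ n) * y2 \<in> \<int>" .
    qed
    then obtain u2 :: int where u2: "y2 = of_int u2" by (elim Ints_cases)
    have ax: "of_int a0 *\<^sub>R x = of_int u1 *\<^sub>R x1 + of_int u2 *\<^sub>R x2"
      unfolding comb e u1[symmetric] u2[symmetric] vec_scale vec_inject y1_def y2_def using P0 by simp
    \<comment> \<open>Only \<open>a0\<close> times \<open>x\<close> is exactly a combination of
      \<open>x1\<close> and \<open>x2\<close>; \<open>a0\<close> is inverted modulo
      \<open>p ^ n\<close>, which carries \<open>x\<close> into \<open>M\<close>.\<close>
    obtain k w where "k * int p ^ n + w * a0 = 1" using cop(1) by (metis bezout_int coprime_iff_gcd_eq_1)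
    then have kw: "of_int k * P ^ n + of_int w * of_int a0 = (1::real)" using Pi(1)[of n] by (metis of_int_1 of_int_add of_int_mult)
    have "x = (of_int k * P ^ n + of_int w * of_int a0) *\<^sub>R x" unfolding kw by simp
    also have "\<dots> = of_int k *\<^sub>R (real (p ^ n) *\<^sub>R x) + of_int w *\<^sub>R (of_int a0 *\<^sub>R x)"
      unfolding Pi by (simp add: scaleR_add_left)
    finally have "x - (of_int (w * u1) *\<^sub>R x1 + of_int (w * u2) *\<^sub>R x2) = of_int k *\<^sub>R (real (p ^ n) *\<^sub>R x)"
      unfolding ax by (simp add: algebra_simps)
    then show "\<exists>i l :: int. x - (of_int i *\<^sub>R x1 + of_int l *\<^sub>R x2) \<in> M" using M_scale[OF x(2)] by metis
  qed
  moreover have "bl (of_int i *\<^sub>R x1 + of_int l *\<^sub>R x2) (of_int i *\<^sub>R x1 + of_int l *\<^sub>R x2)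
      = of_int (m' * a0 * i\<^sup>2) / of_int (int p ^ j) + of_int (- (m' * a0 * D') * l\<^sup>2) / of_int (int p ^ (j + v))" for i l :: int
  proof -
    have "bl (of_int i *\<^sub>R x1 + of_int l *\<^sub>R x2) (of_int i *\<^sub>R x1 + of_int l *\<^sub>R x2)
      = of_int m0 * of_int a0 * (of_int i)\<^sup>2 / (P ^ j)\<^sup>2 - of_int m0 * of_int a0 * ((of_int b0)\<^sup>2 - of_int a0 * of_int c0) * (of_int l)\<^sup>2 / (P ^ (j + v))\<^sup>2"
      unfolding comb blv using P0 by (simp add: field_simps power2_eq_square)
    also have "\<dots> = of_int m' * of_int a0 * (of_int i)\<^sup>2 / P ^ j - of_int m' * of_int a0 * of_int D' * (of_int l)\<^sup>2 / P ^ (j + v)"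
      unfolding d0r m0r using P0 by (simp add: power_add power2_eq_square)
    finally show ?thesis unfolding Pi by simp
  qed
  ultimately show ?thesis by simp
qed

end

section \<open>Invariants of products of two cyclic \<open>p\<close>-groups\<close>

lemma DirProd_nat_pow: "(x, y) [^]\<^bsub>G \<times>\<times> H\<^esub> (n::nat) = (x [^]\<^bsub>G\<^esub> n, y [^]\<^bsub>H\<^esub> n)"
  by (induction n) simp_all

lemma iso_pow_eq_one:
  assumes G: "group G" and H: "group H" and iso: "G \<cong> H"
    and one: "\<And>x. x \<in> carrier G \<Longrightarrow> x [^]\<^bsub>G\<^esub> (n::nat) = \<one>\<^bsub>G\<^esub>" and y: "y \<in> carrier H"
  shows "y [^]\<^bsub>H\<^esub> n = \<one>\<^bsub>H\<^esub>"
proof -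
  obtain \<phi> where \<phi>: "\<phi> \<in> iso G H" using iso by (auto simp: is_iso_def)
  interpret gh: group_hom G H \<phi>
    using G H \<phi> by (simp add: group_hom_def group_hom_axioms_def iso_def)
  obtain x where x: "x \<in> carrier G" "y = \<phi> x" using y \<phi> by (auto simp: iso_def bij_betw_def)
  have "y [^]\<^bsub>H\<^esub> n = \<phi> (x [^]\<^bsub>G\<^esub> n)" unfolding x(2) by (rule gh.hom_nat_pow[symmetric, OF x(1)])
  then show ?thesis unfolding one[OF x(1)] by simp
qed

lemma carrier_prime_power_prod:
  assumes "prime p"
  shows "carrier (integer_mod_group (p ^ k) \<times>\<times> integer_mod_group (p ^ l)) = {0..<int (p ^ k)} \<times> {0..<int (p ^ l)}"
  using assms by (simp add: carrier_integer_mod_group DirProd_def prime_gt_0_nat)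

text \<open>The left group is killed by \<open>p ^ k2\<close>, while \<open>(0, 1)\<close> in the
  right one has order \<open>p ^ l2\<close>.\<close>

lemma prime_power_prod_exponent_le:
  assumes p: "prime p" and k: "k1 \<le> k2"
    and iso: "integer_mod_group (p ^ k1) \<times>\<times> integer_mod_group (p ^ k2) \<cong> integer_mod_group (p ^ l1) \<times>\<times> integer_mod_group (p ^ l2)"
  shows "l2 \<le> k2"
proof (rule ccontr)
  assume "\<not> l2 \<le> k2"
  then have kl: "k2 < l2" by simp
  let ?G = "integer_mod_group (p ^ k1) \<times>\<times> integer_mod_group (p ^ k2)"
  let ?H = "integer_mod_group (p ^ l1) \<times>\<times> integer_mod_group (p ^ l2)"
  have p1: "p > 1" using p by (rule prime_gt_1_nat)
  have dv: "int (p ^ k1) dvd int (p ^ k2)" using k by (simp add: le_imp_power_dvd)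
  have "(0, 1) [^]\<^bsub>?H\<^esub> (p ^ k2) = \<one>\<^bsub>?H\<^esub>"
  proof (rule iso_pow_eq_one[OF _ _ iso])
    show "group ?G" "group ?H" by (intro DirProd_group group_integer_mod_group)+
    fix x assume "x \<in> carrier ?G"
    obtain i j where x: "x = (i, j)" by (cases x)
    have "int (p ^ k1) dvd int (p ^ k2) * i" using dv by (rule dvd_mult2)
    then have "(int (p ^ k2) * i) mod int (p ^ k1) = 0" by (rule dvd_imp_mod_0)
    then show "x [^]\<^bsub>?G\<^esub> (p ^ k2) = \<one>\<^bsub>?G\<^esub>"
      unfolding x DirProd_nat_pow pow_integer_mod_group by simp
  next
    have "int (p ^ l2) > 1" using p1 kl by (simp add: one_less_power)
    then show "(0, 1) \<in> carrier ?H" unfolding carrier_prime_power_prod[OF p] using p1 by simp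
  qed
  then have "int (p ^ k2) mod int (p ^ l2) = 0" unfolding DirProd_nat_pow pow_integer_mod_group by simp
  moreover have "int (p ^ k2) < int (p ^ l2)" using kl p1 by (simp only: of_nat_less_iff power_strict_increasing)
  ultimately show False using p1 by (simp add: mod_pos_pos_trivial)
qed

text \<open>The larger exponent is an invariant as the exponent of the group, the sum of both as its
  order.\<close>

lemma prime_power_prod_iso:
  assumes p: "prime p" and kl: "k1 \<le> k2" "l1 \<le> l2"
    and iso: "integer_mod_group (p ^ k1) \<times>\<times> integer_mod_group (p ^ k2) \<cong> S" "integer_mod_group (p ^ l1) \<times>\<times> integer_mod_group (p ^ l2) \<cong> S"
  shows "k2 = l2 \<and> k1 = l1"
proof -
  let ?G = "integer_mod_group (p ^ k1) \<times>\<times> integer_mod_group (p ^ k2)"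
  let ?H = "integer_mod_group (p ^ l1) \<times>\<times> integer_mod_group (p ^ l2)"
  have G: "group ?G" and H: "group ?H" by (intro DirProd_group group_integer_mod_group)+
  have GH: "?G \<cong> ?H" using iso_trans[OF iso(1) group.iso_sym[OF H iso(2)]] .
  have HG: "?H \<cong> ?G" using group.iso_sym[OF G GH] .
  have "k2 = l2" using prime_power_prod_exponent_le[OF p kl(1) GH] prime_power_prod_exponent_le[OF p kl(2) HG] by simp
  have "card (carrier ?G) = card (carrier ?H)" using GH by (auto simp: is_iso_def iso_def dest: bij_betw_same_card)
  then have "p ^ k1 * p ^ k2 = p ^ l1 * p ^ l2"
    unfolding carrier_prime_power_prod[OF p] card_cartesian_product card_atLeastLessThan_int by (simp only: diff_zero nat_int)
  then have "p ^ (k1 + k2) = p ^ (l1 + l2)" by (simp add: power_add)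
  then have "k1 + k2 = l1 + l2" using prime_gt_1_nat[OF p] power_inject_exp by blast
  with \<open>k2 = l2\<close> show ?thesis by simp
qed

context binary_lattice
begin

text \<open>\<open>D\<close> is odd, so the 2-power torsion consists of the classes of
  \<open>2^-j M\<close>. The vectors that normalize the form in
  \<open>odd_binary_form_2_adic\<close>, divided by \<open>2 ^ j\<close>, generate it, because their
  determinant is invertible modulo \<open>2 ^ j\<close>.\<close>

lemma sylow_two_odd:
  assumes ab: "odd a" "odd b" and m: "m = 2 ^ j * m'" "odd m'"
  obtains \<phi> \<theta> where "\<phi> \<in> iso (integer_mod_group (2 ^ j) \<times>\<times> integer_mod_group (2 ^ j)) (sylow_subgroup 2 (disc_group bl M))"
    "odd \<theta>"
    "(\<forall>i l :: int. disc_form bl (\<phi> (i mod 2 ^ j, l mod 2 ^ j)) = mod_2Z (2 * of_int (\<theta> * i * l) / 2 ^ j)) \<or>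
     (\<forall>i l :: int. disc_form bl (\<phi> (i mod 2 ^ j, l mod 2 ^ j)) = mod_2Z (2 * of_int (\<theta> * (i\<^sup>2 + i * l + l\<^sup>2)) / 2 ^ j))"
proof -
  obtain x1 y1 x2 y2 \<theta> where \<theta>: "odd \<theta>" and det: "odd (x1 * y2 - x2 * y1)" and form:
    "(\<forall>i l. 2 ^ j dvd a * (i * x1 + l * x2)^2 + b * (i * x1 + l * x2) * (i * y1 + l * y2) + c * (i * y1 + l * y2)^2 - \<theta> * i * l) \<or>
     (\<forall>i l. 2 ^ j dvd a * (i * x1 + l * x2)^2 + b * (i * x1 + l * x2) * (i * y1 + l * y2) + c * (i * y1 + l * y2)^2 - \<theta> * (i^2 + i * l + l^2))"
    by (rule odd_binary_form_2_adic[OF ab])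
  define P :: real where "P = 2 ^ j"
  have P0: "P \<noteq> 0" by (simp add: P_def)
  have mr: "of_int m = P * (of_int m' :: real)" by (simp add: m(1) P_def)
  define v1 where "v1 = vec (of_int x1 / P) (of_int y1 / P)"
  define v2 where "v2 = vec (of_int x2 / P) (of_int y2 / P)"
  define X where "X = (\<lambda>i l. i * x1 + l * x2)" define Y where "Y = (\<lambda>i l. i * y1 + l * y2)"
  have comb: "of_int i *\<^sub>R v1 + of_int l *\<^sub>R v2 = vec (of_int (X i l) / P) (of_int (Y i l) / P)" for i l
    by (simp add: v1_def v2_def vec_scale vec_add X_def Y_def add_divide_distrib)
  have dual: "vec (of_int x / P) (of_int y / P) \<in> dual" for x y :: int
  proof (rule dualI[of _ _ "2 ^ j"])
    have "of_int m * (2 * of_int a * (of_int x / P) + of_int b * (of_int y / P)) = of_int (m' * (2 * a * x + b * y))"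
      "of_int m * (of_int b * (of_int x / P) + 2 * of_int c * (of_int y / P)) = of_int (m' * (b * x + 2 * c * y))"
      unfolding mr using P0 by (simp_all add: field_simps)
    then show "of_int m * (2 * of_int a * (of_int x / P) + of_int b * (of_int y / P)) \<in> \<int>"
      "of_int m * (of_int b * (of_int x / P) + 2 * of_int c * (of_int y / P)) \<in> \<int>" by (simp_all only: Ints_of_int)
  qed (simp_all add: P_def)
  have inM: "vec (of_int x / P) (of_int y / P) \<in> M \<longleftrightarrow> 2 ^ j dvd x \<and> 2 ^ j dvd y" for x y :: int
  proof -
    have "of_int x / P \<in> \<int> \<longleftrightarrow> 2 ^ j dvd x" for x :: int
    proof
      assume "of_int x / P \<in> \<int>"
      then obtain z :: int where "of_int x / P = of_int z" by (elim Ints_cases)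
      then have "of_int x = real_of_int (2 ^ j * z)" using P0 by (simp add: field_simps P_def)
      then show "2 ^ j dvd x" by (simp only: of_int_eq_iff) simp
    next
      assume "2 ^ j dvd x"
      then obtain z where "x = 2 ^ j * z" by (elim dvdE)
      then have "of_int x / P = of_int z" using P0 by (simp add: P_def)
      then show "of_int x / P \<in> \<int>" by simp
    qed
    then show ?thesis by (simp add: vec_in_M)
  qed
  have "coprime (x1 * y2 - x2 * y1) (2 ^ j)" using det by simp
  then obtain u w where uw: "u * (x1 * y2 - x2 * y1) + w * 2 ^ j = 1" by (metis bezout_int coprime_iff_gcd_eq_1)
  have two: "prime (2::nat)" by simp
  have "\<exists>\<phi> \<in> iso (integer_mod_group (2 ^ j) \<times>\<times> integer_mod_group (2 ^ j)) (sylow_subgroup 2 (disc_group bl M)).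
    \<forall>i l :: int. disc_form bl (\<phi> (i mod int (2 ^ j), l mod int (2 ^ j)))
       = mod_2Z (bl (of_int i *\<^sub>R v1 + of_int l *\<^sub>R v2) (of_int i *\<^sub>R v1 + of_int l *\<^sub>R v2))"
  proof (rule sylow_iso[OF two])
    show "v1 \<in> dual" "v2 \<in> dual" unfolding v1_def v2_def by (rule dual)+
    show "real (2 ^ j) *\<^sub>R v1 \<in> M" "real (2 ^ j) *\<^sub>R v2 \<in> M"
      by (simp_all add: v1_def v2_def vec_scale vec_in_M P_def)
    fix i l :: int
    assume "of_int i *\<^sub>R v1 + of_int l *\<^sub>R v2 \<in> M"
    then have d: "2 ^ j dvd X i l" "2 ^ j dvd Y i l" unfolding comb inM by simp_all
    have "y2 * X i l - x2 * Y i l = (x1 * y2 - x2 * y1) * i" "x1 * Y i l - y1 * X i l = (x1 * y2 - x2 * y1) * l"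
      by (simp_all add: X_def Y_def algebra_simps)
    moreover have "2 ^ j dvd y2 * X i l - x2 * Y i l" "2 ^ j dvd x1 * Y i l - y1 * X i l" using d by simp_all
    moreover have "coprime (2 ^ j) (x1 * y2 - x2 * y1)" using det by simp
    ultimately have "2 ^ j dvd i" "2 ^ j dvd l" using coprime_dvd_mult_right_iff by metis+
    then show "int (2 ^ j) dvd i \<and> int (2 ^ j) dvd l" by simp
  next
    fix x and n :: nat
    assume x: "x \<in> dual" "real (2 ^ n) *\<^sub>R x \<in> M"
    obtain \<xi> \<eta> where e: "x = vec \<xi> \<eta>" using dualE[OF x(1)] .
    note t = torsion_denominators[OF x[unfolded e]]
    have "odd D" using ab(2) by (simp add: D_def)
    then have cop: "coprime (m' * D) (int 2 ^ n)" using m(2) by simp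
    have "P * \<xi> \<in> \<int>" "P * \<eta> \<in> \<int>"
    proof (rule_tac [!] Ints_coprime_mult[OF cop])
      have "of_int (m' * D) * (P * \<xi>) = of_int (m * D) * \<xi>" "of_int (m' * D) * (P * \<eta>) = of_int (m * D) * \<eta>"
        using mr by simp_all
      then show "of_int (m' * D) * (P * \<xi>) \<in> \<int>" "of_int (m' * D) * (P * \<eta>) \<in> \<int>"
        using dual_denominators[OF t(3,4)] by (simp_all only:)
      have "of_int (int 2 ^ n) * (P * \<xi>) = of_int (2 ^ j) * (of_int (int 2 ^ n) * \<xi>)" "of_int (int 2 ^ n) * (P * \<eta>) = of_int (2 ^ j) * (of_int (int 2 ^ n) * \<eta>)"
        by (simp_all add: P_def)
      then show "of_int (int 2 ^ n) * (P * \<xi>) \<in> \<int>" "of_int (int 2 ^ n) * (P * \<eta>) \<in> \<int>"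
        using t(1,2) Ints_mult[OF Ints_of_int] by metis+
    qed
    then obtain x' y' :: int where xy: "P * \<xi> = of_int x'" "P * \<eta> = of_int y'" by (elim Ints_cases)
    then have \<xi>: "\<xi> = of_int x' / P" "\<eta> = of_int y' / P" using P0 by (simp_all add: field_simps)
    \<comment> \<open>Cramer's rule, with \<open>u\<close> as the inverse of the determinant modulo
      \<open>2 ^ j\<close>.\<close>
    define i where "i = u * (y2 * x' - x2 * y')" define l where "l = u * (x1 * y' - y1 * x')"
    have "X i l = (u * (x1 * y2 - x2 * y1)) * x'" "Y i l = (u * (x1 * y2 - x2 * y1)) * y'"
      by (simp_all add: X_def Y_def i_def l_def algebra_simps)
    moreover have "u * (x1 * y2 - x2 * y1) = 1 - w * 2 ^ j" using uw by simp
    ultimately have "X i l = (1 - w * 2 ^ j) * x'" "Y i l = (1 - w * 2 ^ j) * y'" by (simp_all only:)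
    then have "x' - X i l = 2 ^ j * (w * x')" "y' - Y i l = 2 ^ j * (w * y')" by (simp_all only:) (simp_all add: algebra_simps)
    then have "vec (of_int (x' - X i l) / P) (of_int (y' - Y i l) / P) \<in> M" unfolding inM by simp
    moreover have "x - (of_int i *\<^sub>R v1 + of_int l *\<^sub>R v2) = vec (of_int (x' - X i l) / P) (of_int (y' - Y i l) / P)"
      unfolding comb e \<xi> by (simp add: vec_diff diff_divide_distrib)
    ultimately show "\<exists>i l :: int. x - (of_int i *\<^sub>R v1 + of_int l *\<^sub>R v2) \<in> M" by metis
  qed
  then obtain \<phi> where \<phi>1: "\<phi> \<in> iso (integer_mod_group (2 ^ j) \<times>\<times> integer_mod_group (2 ^ j)) (sylow_subgroup 2 (disc_group bl M))"
    and \<phi>2: "\<forall>i l :: int. disc_form bl (\<phi> (i mod int (2 ^ j), l mod int (2 ^ j)))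
       = mod_2Z (bl (of_int i *\<^sub>R v1 + of_int l *\<^sub>R v2) (of_int i *\<^sub>R v1 + of_int l *\<^sub>R v2))"
    by (rule bexE)
  note \<phi> = \<phi>1 \<phi>2[unfolded of_nat_power of_nat_numeral, rule_format]
  have val: "mod_2Z (bl (of_int i *\<^sub>R v1 + of_int l *\<^sub>R v2) (of_int i *\<^sub>R v1 + of_int l *\<^sub>R v2)) = mod_2Z (2 * of_int (m' * h) / 2 ^ j)"
    if d: "2 ^ j dvd a * (X i l)^2 + b * X i l * Y i l + c * (Y i l)^2 - h" for i l h
  proof -
    obtain z where z: "a * (X i l)^2 + b * X i l * Y i l + c * (Y i l)^2 - h = 2 ^ j * z" using d by (elim dvdE)
    then have F: "a * (X i l)^2 + b * X i l * Y i l + c * (Y i l)^2 = h + 2 ^ j * z" by simp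
    have "bl (of_int i *\<^sub>R v1 + of_int l *\<^sub>R v2) (of_int i *\<^sub>R v1 + of_int l *\<^sub>R v2)
      = 2 * of_int (m' * (a * (X i l)^2 + b * X i l * Y i l + c * (Y i l)^2)) / P"
      unfolding comb bl_vec mr using P0 by (simp add: field_simps power2_eq_square)
    also have "\<dots> = 2 * of_int (m' * h) / 2 ^ j + 2 * of_int (m' * z)"
      unfolding F P_def by (simp add: field_simps)
    finally show ?thesis by (intro mod_2Z_eqI[where n="m' * z"]) simp
  qed
  have \<theta>': "odd (m' * \<theta>)" using \<theta> m(2) by simp
  show ?thesis
    using form
  proof (rule disjE)
    assume F: "\<forall>i l. 2 ^ j dvd a * (i * x1 + l * x2)^2 + b * (i * x1 + l * x2) * (i * y1 + l * y2) + c * (i * y1 + l * y2)^2 - \<theta> * i * l"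
    have "disc_form bl (\<phi> (i mod 2 ^ j, l mod 2 ^ j)) = mod_2Z (2 * of_int (m' * \<theta> * i * l) / 2 ^ j)" for i l
      using val[of i l "\<theta> * i * l"] F unfolding \<phi>(2) X_def Y_def by (simp add: mult.assoc)
    then show thesis by (intro that[OF \<phi>(1) \<theta>'] disjI1 allI)
  next
    assume F: "\<forall>i l. 2 ^ j dvd a * (i * x1 + l * x2)^2 + b * (i * x1 + l * x2) * (i * y1 + l * y2) + c * (i * y1 + l * y2)^2 - \<theta> * (i^2 + i * l + l^2)"
    have "disc_form bl (\<phi> (i mod 2 ^ j, l mod 2 ^ j)) = mod_2Z (2 * of_int (m' * \<theta> * (i\<^sup>2 + i * l + l\<^sup>2)) / 2 ^ j)" for i l
      using val[of i l "\<theta> * (i\<^sup>2 + i * l + l\<^sup>2)"] F unfolding \<phi>(2) X_def Y_def by (simp add: mult.assoc)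
    then show thesis by (intro that[OF \<phi>(1) \<theta>'] disjI2 allI)
  qed
qed

text \<open>For even \<open>D\<close> the \<open>\<theta>\<^sub>1, \<theta>\<^sub>2\<close> of the diagonal form have ratio \<open>- D'\<close> with \<open>D'\<close> the odd part of \<open>D\<close>,
  and \<open>D' \<equiv> 1 (mod 4)\<close> when all prime factors of \<open>D'\<close> are.\<close>

lemma sylow_two_even:
  assumes ab: "odd a" "b = 2 * b'" and m: "m = 2 ^ j * m'" "odd m'" and d: "b'\<^sup>2 - a * c = 2 ^ v * D'" "odd D'"
  obtains \<phi> where "\<phi> \<in> iso (integer_mod_group (2 ^ Suc j) \<times>\<times> integer_mod_group (2 ^ (Suc j + v))) (sylow_subgroup 2 (disc_group bl M))"
    "\<forall>i l :: int. disc_form bl (\<phi> (i mod 2 ^ Suc j, l mod 2 ^ (Suc j + v)))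
       = mod_2Z (of_int (m' * a * i\<^sup>2) / 2 ^ Suc j + of_int (- (m' * a * D') * l\<^sup>2) / 2 ^ (Suc j + v))"
proof -
  \<comment> \<open>For even \<open>b\<close> the Gram matrix is \<open>2 * m\<close> times
    \<open>(a, b'; b', c)\<close>: the scale has exponent \<open>j + 1\<close>, and the odd
    \<open>a\<close> serves as the pivot.\<close>
  have "\<exists>\<phi> \<in> iso (integer_mod_group (2 ^ Suc j) \<times>\<times> integer_mod_group (2 ^ (Suc j + v))) (sylow_subgroup 2 (disc_group bl M)).
    \<forall>i l :: int. disc_form bl (\<phi> (i mod int (2 ^ Suc j), l mod int (2 ^ (Suc j + v))))
       = mod_2Z (of_int (m' * a * i\<^sup>2) / of_int (int 2 ^ Suc j) + of_int (- (m' * a * D') * l\<^sup>2) / of_int (int 2 ^ (Suc j + v)))"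
    by (rule sylow_diag[where ?m0.0="2 * m" and ?a0.0=a and ?b0.0=b' and ?c0.0=c])
       (use assms in simp_all)
  then obtain \<phi> where \<phi>: "\<phi> \<in> iso (integer_mod_group (2 ^ Suc j) \<times>\<times> integer_mod_group (2 ^ (Suc j + v))) (sylow_subgroup 2 (disc_group bl M))"
    "\<forall>i l :: int. disc_form bl (\<phi> (i mod int (2 ^ Suc j), l mod int (2 ^ (Suc j + v))))
       = mod_2Z (of_int (m' * a * i\<^sup>2) / of_int (int 2 ^ Suc j) + of_int (- (m' * a * D') * l\<^sup>2) / of_int (int 2 ^ (Suc j + v)))"
    by (rule bexE)
  show ?thesis
    by (rule that[OF \<phi>(1)])
      (rule \<phi>(2)[unfolded of_nat_power of_nat_numeral of_int_power of_int_numeral])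
qed

end

text \<open>Such a number is a sum of two squares, exactly one of which is odd.\<close>

lemma odd_mod_4_eq_1:
  fixes n :: int
  assumes "n > 0" "odd n" "\<And>p. prime p \<Longrightarrow> int p dvd n \<Longrightarrow> p mod 4 \<noteq> 3"
  shows "n mod 4 = 1"
proof -
  have "\<not> 4 dvd n" using assms(2) by (meson dvd_trans even_numeral)
  then obtain u v where n: "n = u\<^sup>2 + v\<^sup>2" using primitive_two_squares[OF assms(1) _ assms(3)] by metis
  have sq: "x\<^sup>2 mod 4 = (if even x then 0 else 1)" for x :: int
  proof (cases "even x")
    case True
    then obtain y where "x = 2 * y" by (elim evenE)
    then have "x\<^sup>2 = 4 * y\<^sup>2" by (simp add: power2_eq_square)
    then show ?thesis using True by simp
  next
    case False
    then obtain y where "x = 2 * y + 1" by (elim oddE)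
    then have "x\<^sup>2 = 1 + 4 * (y\<^sup>2 + y)" by (simp add: power2_eq_square algebra_simps)
    then have "x\<^sup>2 mod 4 = 1" by (simp only: mod_mult_self2) simp
    then show ?thesis using False by simp
  qed
  have par: "even u \<noteq> even v" using assms(2) unfolding n by simp
  have "n mod 4 = (u\<^sup>2 mod 4 + v\<^sup>2 mod 4) mod 4" unfolding n by (simp add: mod_add_eq)
  also have "\<dots> = 1" unfolding sq using par by (cases "even u") simp_all
  finally show ?thesis .
qed

lemma multiplicity_decompose_prime:
  fixes x :: int
  assumes "prime p" "x \<noteq> 0"
  obtains j y where "x = int p ^ j * y" "\<not> int p dvd y"
proof -
  have "prime (int p)" using assms(1) by simp
  then have "\<not> is_unit (int p)" using not_prime_unit by blast
  from multiplicity_decompose'[OF assms(2) this] show ?thesis using that by metis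
qed

context binary_lattice
begin

text \<open>If \<open>p\<close> divides \<open>m * D\<close>, it is prime to \<open>2 * a\<close>,
  and \<open>sylow_diag\<close> applies to the Gram matrix written as \<open>m\<close> times
  \<open>(2a, b; b, 2c)\<close>. The determinant of that matrix is \<open>- D\<close>, so
  \<open>v\<close> is the exponent of \<open>p\<close> in \<open>D\<close>.\<close>

lemma sylow_odd_prime:
  assumes p: "prime p" "p \<noteq> 2" and cop: "coprime a (m * D)"
  obtains j v where
    "integer_mod_group (p ^ j) \<times>\<times> integer_mod_group (p ^ (j + v)) \<cong> sylow_subgroup p (disc_group bl M)"
    "v = 0 \<longleftrightarrow> \<not> int p dvd D"
proof (cases "int p dvd m * D")
  case False
  obtain \<phi> where \<phi>: "\<phi> \<in> iso (integer_mod_group (p ^ 0) \<times>\<times> integer_mod_group (p ^ 0)) (sylow_subgroup p (disc_group bl M))"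
    using sylow_trivial[OF p(1) False] by (elim exE)
  have "\<not> int p dvd D" using False by (metis dvd_mult)
  then show ?thesis using that[of 0 0] is_isoI[OF \<phi>] by simp
next
  case True
  have Pint: "prime (int p)" using p(1) by simp
  have unit: "\<not> is_unit (int p)" using Pint not_prime_unit by blast
  have "\<not> int p dvd a" using coprime_common_divisor[OF cop _ True] unit by blast
  moreover have "\<not> int p dvd 2"
  proof
    assume "int p dvd 2"
    then have "p dvd 2" by (metis int_dvd_int_iff of_nat_numeral)
    then show False using p primes_dvd_imp_eq two_is_prime_nat by blast
  qed
  ultimately have a: "\<not> int p dvd 2 * a" using Pint prime_dvd_mult_iff by blast
  have D0: "D \<noteq> 0" using nondegenerate(2) by (simp add: D_def)
  obtain j m' where m': "m = int p ^ j * m'" "\<not> int p dvd m'" by (rule multiplicity_decompose_prime[OF p(1) nondegenerate(1)])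
  obtain v D' where D': "D = int p ^ v * D'" "\<not> int p dvd D'" by (rule multiplicity_decompose_prime[OF p(1) D0])
  have d: "b\<^sup>2 - 2 * a * (2 * c) = int p ^ v * D'" using D'(1) by (simp add: D_def algebra_simps)
  obtain \<phi> where "\<phi> \<in> iso (integer_mod_group (p ^ j) \<times>\<times> integer_mod_group (p ^ (j + v))) (sylow_subgroup p (disc_group bl M))"
    by (rule bexE[OF sylow_diag[OF p(1) refl refl refl a m' d D'(2)]])
  then have "integer_mod_group (p ^ j) \<times>\<times> integer_mod_group (p ^ (j + v)) \<cong> sylow_subgroup p (disc_group bl M)" by (rule is_isoI)
  moreover have "v = 0 \<longleftrightarrow> \<not> int p dvd D"
    unfolding D'(1) using D'(2) by (cases v) simp_all
  ultimately show ?thesis by (rule that)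
qed

lemma sylow_odd_prime_square_iff:
  assumes p: "prime p" "p \<noteq> 2" and cop: "coprime a (m * D)"
  shows "(\<exists>k. sylow_subgroup p (disc_group bl M) \<cong> integer_mod_group (p ^ k) \<times>\<times> integer_mod_group (p ^ k)) \<longleftrightarrow> \<not> int p dvd D"
proof -
  obtain j v where jv: "integer_mod_group (p ^ j) \<times>\<times> integer_mod_group (p ^ (j + v)) \<cong> sylow_subgroup p (disc_group bl M)"
    "v = 0 \<longleftrightarrow> \<not> int p dvd D" by (rule sylow_odd_prime[OF assms])
  have "v = 0" if "sylow_subgroup p (disc_group bl M) \<cong> integer_mod_group (p ^ k) \<times>\<times> integer_mod_group (p ^ k)" for k
    using prime_power_prod_iso[OF p(1) le_add1 order_refl iso_trans[OF jv(1) that] iso_refl] by simp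
  moreover have "group (integer_mod_group (p ^ j) \<times>\<times> integer_mod_group (p ^ (j + v)))"
    by (intro DirProd_group group_integer_mod_group)
  then have "sylow_subgroup p (disc_group bl M) \<cong> integer_mod_group (p ^ j) \<times>\<times> integer_mod_group (p ^ (j + v))"
    using jv(1) by (rule group.iso_sym)
  then have "v = 0 \<Longrightarrow> sylow_subgroup p (disc_group bl M) \<cong> integer_mod_group (p ^ j) \<times>\<times> integer_mod_group (p ^ j)" by simp
  ultimately show ?thesis using jv(2) by metis
qed

text \<open>The alternatives follow the parity of \<open>b\<close>: odd \<open>b\<close> leads to
  (iii) or (iv), even \<open>b\<close> to (i) or (ii), according to whether \<open>D/4\<close> is
  odd or twice an odd number.\<close>

lemma sylow_two_form:
  assumes a: "odd a" and D: "D > 0" "good_disc D"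
  shows "((\<exists>k::nat. k \<ge> 1 \<and>
       (\<exists>\<phi> \<in> iso (integer_mod_group (2^k) \<times>\<times> integer_mod_group (2^k)) (sylow_subgroup 2 (disc_group bl M)).
        \<exists>\<theta>1 \<theta>2 :: int. odd \<theta>1 \<and> odd \<theta>2 \<and> (\<theta>1 + \<theta>2) mod 4 = 0 \<and>
          (\<forall>a1 a2 :: int. disc_form bl (\<phi> (a1 mod 2^k, a2 mod 2^k)) =
             mod_2Z (of_int (\<theta>1 * a1^2) / 2^k + of_int (\<theta>2 * a2^2) / 2^k))))
     \<or>
     (\<exists>k::nat. k \<ge> 1 \<and>
       (\<exists>\<phi> \<in> iso (integer_mod_group (2^k) \<times>\<times> integer_mod_group (2^(k+1))) (sylow_subgroup 2 (disc_group bl M)).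
        \<exists>\<theta>1 \<theta>2 :: int. odd \<theta>1 \<and> odd \<theta>2 \<and> (\<theta>1 + \<theta>2) mod 4 = 0 \<and>
          (\<forall>a1 a2 :: int. disc_form bl (\<phi> (a1 mod 2^k, a2 mod 2^(k+1))) =
             mod_2Z (of_int (\<theta>1 * a1^2) / 2^k + of_int (\<theta>2 * a2^2) / 2^(k+1)))))
     \<or>
     (\<exists>k::nat.
       \<exists>\<phi> \<in> iso (integer_mod_group (2^k) \<times>\<times> integer_mod_group (2^k)) (sylow_subgroup 2 (disc_group bl M)).
        \<exists>\<theta>::int. odd \<theta> \<and>
          (\<forall>a1 a2 :: int. disc_form bl (\<phi> (a1 mod 2^k, a2 mod 2^k)) =
             mod_2Z (of_int (\<theta> * a1 * a2) / 2 powi (int k - 1))))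
     \<or>
     (\<exists>k::nat.
       \<exists>\<phi> \<in> iso (integer_mod_group (2^k) \<times>\<times> integer_mod_group (2^k)) (sylow_subgroup 2 (disc_group bl M)).
        \<exists>\<theta>::int. odd \<theta> \<and>
          (\<forall>a1 a2 :: int. disc_form bl (\<phi> (a1 mod 2^k, a2 mod 2^k)) =
             mod_2Z (of_int (\<theta> * (a1^2 + a1 * a2 + a2^2)) / 2 powi (int k - 1)))))" (is "?I \<or> ?II \<or> ?III \<or> ?IV")
proof -
  have two: "prime (2::nat)" by simp
  obtain j m' where "m = int 2 ^ j * m'" "\<not> int 2 dvd m'" by (rule multiplicity_decompose_prime[OF two nondegenerate(1)])
  then have m: "m = 2 ^ j * m'" "odd m'" by simp_all
  show ?thesis
  proof (cases "even b")
    case True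
    then obtain b' where b': "b = 2 * b'" by (elim evenE)
    have D4: "D = 4 * (b'\<^sup>2 - a * c)" unfolding D_def unfolding b' by (simp add: power2_eq_square)
    then have nz: "b'\<^sup>2 - a * c \<noteq> 0" using D(1) by auto
    obtain v D' where "b'\<^sup>2 - a * c = int 2 ^ v * D'" "\<not> int 2 dvd D'" by (rule multiplicity_decompose_prime[OF two nz])
    then have D': "b'\<^sup>2 - a * c = 2 ^ v * D'" "odd D'" by simp_all
    have "D = 2 ^ (v + 2) * D'" unfolding D4 D'(1) by simp
    have "v < 2"
    proof (rule ccontr)
      assume "\<not> v < 2"
      then have "(2::int) ^ 4 dvd 2 ^ (v + 2)" by (intro le_imp_power_dvd) simp
      then have "16 dvd D" unfolding \<open>D = 2 ^ (v + 2) * D'\<close> by simp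
      then show False using D(2) by (simp add: good_disc_def)
    qed
    have "D' > 0" using D(1) unfolding \<open>D = 2 ^ (v + 2) * D'\<close> by (simp add: zero_less_mult_iff)
    moreover have "p mod 4 \<noteq> 3" if "prime p" "int p dvd D'" for p
      using that D(2) unfolding good_disc_def \<open>D = 2 ^ (v + 2) * D'\<close> by (metis dvd_mult)
    ultimately have "D' mod 4 = 1" using odd_mod_4_eq_1 D'(2) by blast
    \<comment> \<open>With \<open>\<theta>1 = m' a\<close> and \<open>\<theta>2 = - m' a D'\<close>
      the sum is \<open>m' a (1 - D')\<close>, so the congruence modulo 4 comes down to that of
      \<open>D'\<close>.\<close>
    then have "4 dvd 1 - D'" by (simp add: mod_eq_dvd_iff[symmetric])
    then have "4 dvd m' * a * (1 - D')" by (rule dvd_mult)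
    then have \<theta>: "(m' * a + - (m' * a * D')) mod 4 = 0" by (simp add: algebra_simps)
    have odds: "odd (m' * a)" "odd (- (m' * a * D'))" using a m(2) D'(2) by simp_all
    obtain \<phi> where \<phi>: "\<phi> \<in> iso (integer_mod_group (2 ^ Suc j) \<times>\<times> integer_mod_group (2 ^ (Suc j + v))) (sylow_subgroup 2 (disc_group bl M))"
      "\<forall>i l :: int. disc_form bl (\<phi> (i mod 2 ^ Suc j, l mod 2 ^ (Suc j + v)))
       = mod_2Z (of_int (m' * a * i\<^sup>2) / 2 ^ Suc j + of_int (- (m' * a * D') * l\<^sup>2) / 2 ^ (Suc j + v))"
      using sylow_two_even[OF a b' m D'] .
    consider "v = 0" | "v = 1" using \<open>v < 2\<close> by linarith
    then show ?thesis
    proof cases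
      case 1
      note \<phi>' = \<phi>[unfolded 1 add_0_right]
      have ?I
        by (rule exI[of _ "Suc j"], rule conjI, simp, rule bexI[OF _ \<phi>'(1)], rule exI[of _ "m' * a"], rule exI[of _ "- (m' * a * D')"])
          (intro conjI odds \<theta> \<phi>'(2))
      then show ?thesis by (rule disjI1)
    next
      case 2
      note \<phi>' = \<phi>[unfolded 2]
      have ?II
        by (rule exI[of _ "Suc j"], rule conjI, simp, rule bexI[OF _ \<phi>'(1)], rule exI[of _ "m' * a"], rule exI[of _ "- (m' * a * D')"])
          (intro conjI odds \<theta> \<phi>'(2))
      then show ?thesis by (intro disjI2[OF disjI1])
    qed
  next
    case False
    \<comment> \<open>An integer exponent is essential at \<open>j = 0\<close>, where the
      denominator \<open>2^(j-1)\<close> is \<open>1/2\<close>.\<close>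
    have pw: "2 * x / 2 ^ j = x / 2 powi (int j - 1)" for x :: real by (simp add: power_int_diff)
    obtain \<phi> \<theta> where \<phi>: "\<phi> \<in> iso (integer_mod_group (2 ^ j) \<times>\<times> integer_mod_group (2 ^ j)) (sylow_subgroup 2 (disc_group bl M))"
      and \<theta>: "odd \<theta>" and form:
      "(\<forall>i l :: int. disc_form bl (\<phi> (i mod 2 ^ j, l mod 2 ^ j)) = mod_2Z (2 * of_int (\<theta> * i * l) / 2 ^ j)) \<or>
     (\<forall>i l :: int. disc_form bl (\<phi> (i mod 2 ^ j, l mod 2 ^ j)) = mod_2Z (2 * of_int (\<theta> * (i\<^sup>2 + i * l + l\<^sup>2)) / 2 ^ j))"
      using sylow_two_odd[OF a False m] .
    from form show ?thesis
    proof (rule disjE)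
      assume F: "\<forall>i l :: int. disc_form bl (\<phi> (i mod 2 ^ j, l mod 2 ^ j)) = mod_2Z (2 * of_int (\<theta> * i * l) / 2 ^ j)"
      have ?III
        by (rule exI[of _ j], rule bexI[OF _ \<phi>], rule exI[of _ \<theta>], rule conjI[OF \<theta> F[unfolded pw]])
      then show ?thesis by (intro disjI2[OF disjI2[OF disjI1]])
    next
      assume F: "\<forall>i l :: int. disc_form bl (\<phi> (i mod 2 ^ j, l mod 2 ^ j)) = mod_2Z (2 * of_int (\<theta> * (i\<^sup>2 + i * l + l\<^sup>2)) / 2 ^ j)"
      have ?IV
        by (rule exI[of _ j], rule bexI[OF _ \<phi>], rule exI[of _ \<theta>], rule conjI[OF \<theta> F[unfolded pw]])
      then show ?thesis by (intro disjI2[OF disjI2[OF disjI2]])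
    qed
  qed
qed

text \<open>If 16 divides \<open>D\<close>, the exponents of the two cyclic factors differ by the
  exponent of 2 in \<open>D/4\<close>, which is at least 2; but exponents are invariants of the
  group.\<close>

lemma not_16_dvd_disc:
  assumes a: "odd a" and kl: "k \<le> l" "l \<le> k + 1"
    and \<phi>: "\<phi> \<in> iso (integer_mod_group (2 ^ k) \<times>\<times> integer_mod_group (2 ^ l)) (sylow_subgroup 2 (disc_group bl M))"
  shows "\<not> 16 dvd D"
proof
  assume dvd: "16 dvd D"
  then have "even D" by (meson dvd_trans even_numeral)
  then have "even b" by (simp add: D_def)
  then obtain b' where b': "b = 2 * b'" by (elim evenE)
  have D4: "D = 4 * (b'\<^sup>2 - a * c)" unfolding D_def unfolding b' by (simp add: power2_eq_square)
  then have nz: "b'\<^sup>2 - a * c \<noteq> 0" using nondegenerate(2) unfolding D_def by auto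
  have "4 * 4 dvd 4 * (b'\<^sup>2 - a * c)" using dvd unfolding D4 by simp
  then have four: "4 dvd b'\<^sup>2 - a * c" unfolding dvd_mult_cancel_left by simp
  have two: "prime (2::nat)" by simp
  obtain j m' where "m = int 2 ^ j * m'" "\<not> int 2 dvd m'" by (rule multiplicity_decompose_prime[OF two nondegenerate(1)])
  then have m: "m = 2 ^ j * m'" "odd m'" by simp_all
  obtain v D' where "b'\<^sup>2 - a * c = int 2 ^ v * D'" "\<not> int 2 dvd D'" by (rule multiplicity_decompose_prime[OF two nz])
  then have D': "b'\<^sup>2 - a * c = 2 ^ v * D'" "odd D'" by simp_all
  have "coprime (2 ^ 2) D'" using D'(2) by (simp only: coprime_power_left_iff coprime_left_2_iff_odd simp_thms)
  moreover have "2 ^ 2 dvd 2 ^ v * D'" using four unfolding D'(1) by simp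
  ultimately have "(2::int) ^ 2 dvd 2 ^ v" using coprime_dvd_mult_left_iff by blast
  then have v: "2 \<le> v" using dvd_power_iff[of "2::int" 2 v] by auto
  obtain \<psi> where "\<psi> \<in> iso (integer_mod_group (2 ^ Suc j) \<times>\<times> integer_mod_group (2 ^ (Suc j + v))) (sylow_subgroup 2 (disc_group bl M))"
    using sylow_two_even[OF a b' m D'] .
  from prime_power_prod_iso[OF two le_add1 kl(1) is_isoI[OF this] is_isoI[OF \<phi>]]
  show False using v kl(2) by simp
qed

text \<open>With \<open>a\<close> prime to \<open>2 m D\<close>, the vector \<open>n1\<close> can be
  used as a pivot at 2 and at every prime dividing \<open>m D\<close>.\<close>

theorem disc_form_conditions_iff:
  assumes cop: "coprime a (2 * m * D)" and D: "D > 0"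
  shows "(\<forall>p::nat. prime p \<longrightarrow> p mod 4 = 3 \<longrightarrow>
       (\<exists>k::nat. sylow_subgroup p (disc_group bl M) \<cong> integer_mod_group (p^k) \<times>\<times> integer_mod_group (p^k)))
    \<and>
    ((\<exists>k::nat. k \<ge> 1 \<and>
       (\<exists>\<phi> \<in> iso (integer_mod_group (2^k) \<times>\<times> integer_mod_group (2^k)) (sylow_subgroup 2 (disc_group bl M)).
        \<exists>\<theta>1 \<theta>2 :: int. odd \<theta>1 \<and> odd \<theta>2 \<and> (\<theta>1 + \<theta>2) mod 4 = 0 \<and>
          (\<forall>a1 a2 :: int. disc_form bl (\<phi> (a1 mod 2^k, a2 mod 2^k)) =
             mod_2Z (of_int (\<theta>1 * a1^2) / 2^k + of_int (\<theta>2 * a2^2) / 2^k))))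
     \<or>
     (\<exists>k::nat. k \<ge> 1 \<and>
       (\<exists>\<phi> \<in> iso (integer_mod_group (2^k) \<times>\<times> integer_mod_group (2^(k+1))) (sylow_subgroup 2 (disc_group bl M)).
        \<exists>\<theta>1 \<theta>2 :: int. odd \<theta>1 \<and> odd \<theta>2 \<and> (\<theta>1 + \<theta>2) mod 4 = 0 \<and>
          (\<forall>a1 a2 :: int. disc_form bl (\<phi> (a1 mod 2^k, a2 mod 2^(k+1))) =
             mod_2Z (of_int (\<theta>1 * a1^2) / 2^k + of_int (\<theta>2 * a2^2) / 2^(k+1)))))
     \<or>
     (\<exists>k::nat.
       \<exists>\<phi> \<in> iso (integer_mod_group (2^k) \<times>\<times> integer_mod_group (2^k)) (sylow_subgroup 2 (disc_group bl M)).
        \<exists>\<theta>::int. odd \<theta> \<and>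
          (\<forall>a1 a2 :: int. disc_form bl (\<phi> (a1 mod 2^k, a2 mod 2^k)) =
             mod_2Z (of_int (\<theta> * a1 * a2) / 2 powi (int k - 1))))
     \<or>
     (\<exists>k::nat.
       \<exists>\<phi> \<in> iso (integer_mod_group (2^k) \<times>\<times> integer_mod_group (2^k)) (sylow_subgroup 2 (disc_group bl M)).
        \<exists>\<theta>::int. odd \<theta> \<and>
          (\<forall>a1 a2 :: int. disc_form bl (\<phi> (a1 mod 2^k, a2 mod 2^k)) =
             mod_2Z (of_int (\<theta> * (a1^2 + a1 * a2 + a2^2)) / 2 powi (int k - 1))))) \<longleftrightarrow> good_disc D" (is "?A \<and> ?B \<longleftrightarrow> _")
proof -
  have cop': "coprime a (m * D)" and a: "odd a" using cop by (simp_all add: mult.assoc)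
  have A: "?A \<longleftrightarrow> (\<forall>p::nat. prime p \<longrightarrow> p mod 4 = 3 \<longrightarrow> \<not> int p dvd D)"
  proof -
    have "(\<exists>k::nat. sylow_subgroup p (disc_group bl M) \<cong> integer_mod_group (p ^ k) \<times>\<times> integer_mod_group (p ^ k)) \<longleftrightarrow> \<not> int p dvd D"
      if "prime p" "p mod 4 = 3" for p
    proof -
      have "p \<noteq> 2" using that(2) by auto
      then show ?thesis using sylow_odd_prime_square_iff[OF that(1) _ cop'] by blast
    qed
    then show ?thesis by (simp only: cong: imp_cong)
  qed
  have "\<not> 16 dvd D" if ?B
    using that
  proof (elim disjE exE conjE bexE)
    fix k \<phi>
    assume "\<phi> \<in> iso (integer_mod_group (2 ^ k) \<times>\<times> integer_mod_group (2 ^ k)) (sylow_subgroup 2 (disc_group bl M))"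
    then show "\<not> 16 dvd D" by (rule not_16_dvd_disc[OF a order_refl le_add1])
  next
    fix k \<phi>
    assume "\<phi> \<in> iso (integer_mod_group (2 ^ k) \<times>\<times> integer_mod_group (2 ^ (k + 1))) (sylow_subgroup 2 (disc_group bl M))"
    then show "\<not> 16 dvd D" by (rule not_16_dvd_disc[OF a le_add1 order_refl])
  next
    fix k \<phi>
    assume "\<phi> \<in> iso (integer_mod_group (2 ^ k) \<times>\<times> integer_mod_group (2 ^ k)) (sylow_subgroup 2 (disc_group bl M))"
    then show "\<not> 16 dvd D" by (rule not_16_dvd_disc[OF a order_refl le_add1])
  next
    fix k \<phi>
    assume "\<phi> \<in> iso (integer_mod_group (2 ^ k) \<times>\<times> integer_mod_group (2 ^ k)) (sylow_subgroup 2 (disc_group bl M))"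
    then show "\<not> 16 dvd D" by (rule not_16_dvd_disc[OF a order_refl le_add1])
  qed
  moreover have ?B if "good_disc D" using sylow_two_form[OF a D that] .
  ultimately show ?thesis unfolding A good_disc_def by argo
qed

end

theorem theorem1p7:
  fixes \<Lambda> :: "(complex^2) set"
    and A :: "form2 set monoid"
    and q :: "form2 set \<Rightarrow> real set"
  assumes "abelian_surface \<Lambda>"
    and "picard_number \<Lambda> = 2"
    and A: "A = disc_group (cup \<Lambda>) (NS \<Lambda>)"
    and q: "q = disc_form (cup \<Lambda>)"
  shows "self_mirror \<Lambda> \<longleftrightarrow>
    (\<forall>p::nat. prime p \<longrightarrow> p mod 4 = 3 \<longrightarrow>
       (\<exists>k::nat. sylow_subgroup p A \<cong> integer_mod_group (p^k) \<times>\<times> integer_mod_group (p^k)))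
    \<and>
    ((\<exists>k::nat. k \<ge> 1 \<and>
       (\<exists>\<phi> \<in> iso (integer_mod_group (2^k) \<times>\<times> integer_mod_group (2^k)) (sylow_subgroup 2 A).
        \<exists>\<theta>1 \<theta>2 :: int. odd \<theta>1 \<and> odd \<theta>2 \<and> (\<theta>1 + \<theta>2) mod 4 = 0 \<and>
          (\<forall>a1 a2 :: int. q (\<phi> (a1 mod 2^k, a2 mod 2^k)) =
             mod_2Z (of_int (\<theta>1 * a1^2) / 2^k + of_int (\<theta>2 * a2^2) / 2^k))))
     \<or>
     (\<exists>k::nat. k \<ge> 1 \<and>
       (\<exists>\<phi> \<in> iso (integer_mod_group (2^k) \<times>\<times> integer_mod_group (2^(k+1))) (sylow_subgroup 2 A).
        \<exists>\<theta>1 \<theta>2 :: int. odd \<theta>1 \<and> odd \<theta>2 \<and> (\<theta>1 + \<theta>2) mod 4 = 0 \<and>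
          (\<forall>a1 a2 :: int. q (\<phi> (a1 mod 2^k, a2 mod 2^(k+1))) =
             mod_2Z (of_int (\<theta>1 * a1^2) / 2^k + of_int (\<theta>2 * a2^2) / 2^(k+1)))))
     \<or>
     (\<exists>k::nat.
       \<exists>\<phi> \<in> iso (integer_mod_group (2^k) \<times>\<times> integer_mod_group (2^k)) (sylow_subgroup 2 A).
        \<exists>\<theta>::int. odd \<theta> \<and>
          (\<forall>a1 a2 :: int. q (\<phi> (a1 mod 2^k, a2 mod 2^k)) =
             mod_2Z (of_int (\<theta> * a1 * a2) / 2 powi (int k - 1))))
     \<or>
     (\<exists>k::nat.
       \<exists>\<phi> \<in> iso (integer_mod_group (2^k) \<times>\<times> integer_mod_group (2^k)) (sylow_subgroup 2 A).
        \<exists>\<theta>::int. odd \<theta> \<and>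
          (\<forall>a1 a2 :: int. q (\<phi> (a1 mod 2^k, a2 mod 2^k)) =
             mod_2Z (of_int (\<theta> * (a1^2 + a1 * a2 + a2^2)) / 2 powi (int k - 1)))))"
proof -
  obtain n1 n2 A0 B C where NS: "NS \<Lambda> = {of_int i *\<^sub>R n1 + of_int j *\<^sub>R n2 | i j :: int. True}"
    and gram: "cup \<Lambda> n1 n1 = of_int (2 * A0)" "cup \<Lambda> n1 n2 = of_int B" "cup \<Lambda> n2 n2 = of_int (2 * C)"
    and disc: "B\<^sup>2 - 4 * A0 * C > 0" and sm: "self_mirror \<Lambda> \<longleftrightarrow> iso4 (- A0) (- B) (- C) A0 B C"
    by (rule NS_lattice[OF assms(1,2)])
  have cup: "cup \<Lambda> (x + y) z = cup \<Lambda> x z + cup \<Lambda> y z" "cup \<Lambda> (t *\<^sub>R x) z = t * cup \<Lambda> x z"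
    "cup \<Lambda> x (y + z) = cup \<Lambda> x y + cup \<Lambda> x z" "cup \<Lambda> x (t *\<^sub>R z) = t * cup \<Lambda> x z" "cup \<Lambda> x y = cup \<Lambda> y x" for x y z t
    unfolding cup_def by (rule wedge_linear wedge_sym)+
  define m where "m = gcd A0 (gcd B C)"
  have m0: "m \<noteq> 0" using disc unfolding m_def by auto
  have dvd: "m dvd A0" "m dvd B" "m dvd C" unfolding m_def by (simp_all add: dvd_trans[OF gcd_dvd2])
  obtain a0 b0 c0 where abc0: "A0 = m * a0" "B = m * b0" "C = m * c0"
    using dvdE[OF dvd(1)] dvdE[OF dvd(2)] dvdE[OF dvd(3)] by metis
  have prim: "is_unit d" if "d dvd a0" "d dvd b0" "d dvd c0" for d
  proof -
    have "m * d dvd A0" "m * d dvd B" "m * d dvd C" unfolding abc0 using that by simp_all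
    then have "m * d dvd m" unfolding m_def by (intro gcd_greatest)
    then show ?thesis using m0 by simp
  qed
  define D where "D = b0\<^sup>2 - 4 * a0 * c0"
  have "B\<^sup>2 - 4 * A0 * C = m\<^sup>2 * D" unfolding abc0 D_def by (simp add: algebra_simps power2_eq_square)
  then have D: "D > 0" using disc m0 by (simp add: zero_less_mult_iff)
  have nz: "2 * m * D \<noteq> 0" using m0 D by simp
  \<comment> \<open>One basis serves both sides: a leading coefficient prime to
    \<open>2 * m * D\<close> is what the local computation of the discriminant group and the
    necessity argument for isometries ask for.\<close>
  obtain p q' u v where pq: "p * v - q' * u = 1" and cop: "coprime (a0 * p\<^sup>2 + b0 * p * q' + c0 * q'\<^sup>2) (2 * m * D)"
    by (rule primitive_form_represents_coprime[OF prim nz])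
  define a where "a = a0 * p\<^sup>2 + b0 * p * q' + c0 * q'\<^sup>2"
  define b where "b = 2 * a0 * p * u + b0 * (p * v + q' * u) + 2 * c0 * q' * v"
  define c where "c = a0 * u\<^sup>2 + b0 * u * v + c0 * v\<^sup>2"
  have "b\<^sup>2 - 4 * a * c = (p * v - q' * u)\<^sup>2 * D"
    unfolding a_def b_def c_def D_def by (simp add: algebra_simps power2_eq_square)
  then have D': "b\<^sup>2 - 4 * a * c = D" unfolding pq by simp
  define n1' where "n1' = of_int p *\<^sub>R n1 + of_int q' *\<^sub>R n2"
  define n2' where "n2' = of_int u *\<^sub>R n1 + of_int v *\<^sub>R n2"
  have gram': "cup \<Lambda> n1' n1' = of_int (2 * (m * a))" "cup \<Lambda> n1' n2' = of_int (m * b)" "cup \<Lambda> n2' n2' = of_int (2 * (m * c))"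
    using cup(5)[of n2 n1] gram unfolding n1'_def n2'_def cup(1-4) a_def b_def c_def abc0
    by (simp_all add: algebra_simps power2_eq_square)
  have NS': "NS \<Lambda> = {of_int i *\<^sub>R n1' + of_int j *\<^sub>R n2' | i j :: int. True}"
  proof (intro subset_antisym subsetI)
    fix x assume "x \<in> NS \<Lambda>"
    then obtain i j where x: "x = of_int i *\<^sub>R n1 + of_int j *\<^sub>R n2" unfolding NS by blast
    have "i = (p * v - q' * u) * i" "j = (p * v - q' * u) * j" unfolding pq by simp_all
    then have ij: "i = (v * i - u * j) * p + (p * j - q' * i) * u" "j = (v * i - u * j) * q' + (p * j - q' * i) * v"
      by (simp_all add: algebra_simps)
    have "of_int (v * i - u * j) *\<^sub>R n1' + of_int (p * j - q' * i) *\<^sub>R n2'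
      = of_int ((v * i - u * j) * p + (p * j - q' * i) * u) *\<^sub>R n1 + of_int ((v * i - u * j) * q' + (p * j - q' * i) * v) *\<^sub>R n2"
      unfolding n1'_def n2'_def by (simp add: algebra_simps)
    then have "x = of_int (v * i - u * j) *\<^sub>R n1' + of_int (p * j - q' * i) *\<^sub>R n2'" unfolding x ij[symmetric] by (rule sym)
    then show "x \<in> {of_int i *\<^sub>R n1' + of_int j *\<^sub>R n2' | i j :: int. True}" by blast
  next
    fix x assume "x \<in> {of_int i *\<^sub>R n1' + of_int j *\<^sub>R n2' | i j :: int. True}"
    then obtain i j :: int where x: "x = of_int i *\<^sub>R n1' + of_int j *\<^sub>R n2'" by blast
    have "x = of_int (i * p + j * u) *\<^sub>R n1 + of_int (i * q' + j * v) *\<^sub>R n2"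
      unfolding x n1'_def n2'_def by (simp add: algebra_simps)
    then show "x \<in> NS \<Lambda>" unfolding NS by blast
  qed
  interpret L: binary_lattice "cup \<Lambda>" n1' n2' a b c m "NS \<Lambda>"
  proof
    show "b\<^sup>2 - 4 * a * c \<noteq> 0" using D unfolding D' by simp
  qed (rule cup(1) cup(2) cup(5) gram' NS' m0)+
  have LD: "L.D = D" unfolding L.D_def D' ..
  have iso: "iso4 (n * a) (n * b) (n * c) (n * a0) (n * b0) (n * c0)" for n
    using iso4_change_of_basis[OF pq, of "n * a0" "n * b0" "n * c0"]
    unfolding a_def b_def c_def by (simp add: algebra_simps)
  have cop': "coprime a (2 * m * D)" using cop by (simp add: a_def)
  have isoD: "iso4 (- (m * a)) (- (m * b)) (- (m * c)) (m * a) (m * b) (m * c) \<longleftrightarrow> good_disc D"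
  proof
    assume i: "iso4 (- (m * a)) (- (m * b)) (- (m * c)) (m * a) (m * b) (m * c)"
    have nz: "b\<^sup>2 - 4 * a * c \<noteq> 0" using D unfolding D' by simp
    have "\<not> int p dvd D" if p: "prime p" "p mod 4 = 3" for p
    proof
      assume pD: "int p dvd D"
      have "prime (int p)" using p(1) by simp
      then have "\<not> is_unit (int p)" using not_prime_unit by blast
      then have "\<not> int p dvd a" using coprime_common_divisor[OF cop'] pD dvd_mult by blast
      then show False using iso4_imp_not_3_mod_4[OF i m0 nz p] pD unfolding D' by blast
    qed
    moreover have "odd a" using cop' by (simp add: mult.assoc)
    then have "\<not> 16 dvd D" using iso4_imp_not_16[OF i m0 nz] unfolding D' by blast
    ultimately show "good_disc D" unfolding good_disc_def by blast
  next
    assume g: "good_disc D"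
    \<comment> \<open>A common divisor of \<open>a\<close> and \<open>b\<close> divides both
      \<open>a\<close> and \<open>D\<close>, which are coprime.\<close>
    have "is_unit d" if "d dvd a" "d dvd b" "d dvd c" for d
    proof -
      have "d dvd b\<^sup>2 - 4 * a * c" using that(1,2) by (simp add: power2_eq_square)
      then have "d dvd 2 * m * D" unfolding D' by simp
      then show ?thesis using coprime_common_divisor[OF cop' that(1)] by blast
    qed
    then show "iso4 (- (m * a)) (- (m * b)) (- (m * c)) (m * a) (m * b) (m * c)"
      using good_disc_imp_iso4[of a b c m] m0 D g unfolding D' by blast
  qed
  have iso': "iso4 (- (m * a)) (- (m * b)) (- (m * c)) (- A0) (- B) (- C)" "iso4 (m * a) (m * b) (m * c) A0 B C"
    using iso[of "- m"] iso[of m] unfolding abc0 by simp_all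
  have "iso4 (- A0) (- B) (- C) A0 B C \<longleftrightarrow> iso4 (- (m * a)) (- (m * b)) (- (m * c)) (m * a) (m * b) (m * c)"
  proof
    assume "iso4 (- A0) (- B) (- C) A0 B C"
    from iso4_trans[OF iso4_trans[OF iso'(1) this] iso4_sym[OF iso'(2)]]
    show "iso4 (- (m * a)) (- (m * b)) (- (m * c)) (m * a) (m * b) (m * c)" .
  next
    assume "iso4 (- (m * a)) (- (m * b)) (- (m * c)) (m * a) (m * b) (m * c)"
    from iso4_trans[OF iso4_trans[OF iso4_sym[OF iso'(1)] this] iso'(2)]
    show "iso4 (- A0) (- B) (- C) A0 B C" .
  qed
  then have "self_mirror \<Lambda> \<longleftrightarrow> good_disc D" unfolding sm isoD .
  then show ?thesis
    unfolding A q using L.disc_form_conditions_iff[unfolded LD, OF cop' D] by (rule trans[OF _ sym])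
qed

end
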